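(* Let $d\ge 1$ be an integer and let $$\max(d(1/p-1),0)<s<1/p,\qquad 0<q<\infty,\qquad (d-1)/d<p<\infty .$$ Then the mapping $$\Lambda:\ g\longmapsto \Lambda g:=(\lambda_h(g))_{h\in H^d},\qquad g\in L_1(I^d),$$ provides an isomorphism between $B_{p,q,1}^s(I^d)$ and the weighted $\ell_q(\ell_p)$ space of all sequences $\Gamma=(\gamma_h)_{h\in H^d}$ of real numbers with finite quasi-norm $$\|\Gamma\|_{\ell_q(\ell_p)}:=\Big(\sum_{k=0}^\infty\Big(\sum_{h\in H_k^d}2^{k(sp-d)}|\gamma_h|^p\Big)^{q/p}\Big)^{1/q}.$$ That is, $\Lambda$ maps $B_{p,q,1}^s(I^d)$ linearly and bijectively onto this sequence space, and there are constants $c,C>0$ independent of $g$ such that $$c\,\|g\|_{B_{p,q,1}^s}\le \|\Lambda g\|_{\ell_q(\ell_p)}\le C\,\|g\|_{B_{p,q,1}^s},\qquad g\in B_{p,q,1}^s(I^d).$$ Consequently, $H^d$ is an unconditional Schauder basis in $B_{p,q,1}^s(I^d)$ for these parameters.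
   Context: Notation: $I=[0,1]$, $I^d\subset\mathbb{R}^d$ is the unit cube with Lebesgue measure, functions are real-valued and identified when equal a.e., $L_p=L_p(I^d)$ with the usual (quasi-)norm. Besov spaces: for $y\in\mathbb{R}^d$ let $I^d_y=\{z\in I^d: z+y\in I^d\}$ and $\Delta_y f(x)=f(x+y)-f(x)$ for $x\in I^d_y$. The first-order $L_p$ modulus of smoothness is $\omega(t,f)_p=\sup_{0<|y|\le t}\|\Delta_y f\|_{L_p(I^d_y)}$, $t>0$. For $0<p,q<\infty$, the space $B_{p,q,1}^s(I^d)$ is the set of all $f\in L_p(I^d)$ with finite quasi-norm $$\|f\|_{B_{p,q,1}^s}=\Big(\|f\|_{L_p}^q+\int_0^1 \big(t^{-s}\omega(t,f)_p\big)^q\,\frac{dt}{t}\Big)^{1/q}.$$ It is a quasi-Banach space. For the parameters of the claim, $B_{p,q,1}^s(I^d)$ is continuously embedded into $L_1(I^d)$, so that $\Lambda$ is defined on it. Haar wavelet system: for $k\ge 0$ and $i=1,\dots,2^k$ let $\Delta_{k,i}=[(i-1)2^{-k},i2^{-k})$. For $k\ge1$, $i=1,\dots,2^{k-1}$, put $h_{\Delta_{k-1,i}}=\chi_{\Delta_{k,2i-1}}-\chi_{\Delta_{k,2i}}$. Set $H_0^d=\{\chi_{I^d}\}$, and for $k\ge 1$ let $H_k^d$ be the set of all tensor products $\psi_1\otimes\cdots\otimes\psi_d$ such that, for some $(i_1,\dots,i_d)\in\{1,\dots,2^{k-1}\}^d$, each $\psi_l$ is either $h_{\Delta_{k-1,i_l}}$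 or $\chi_{\Delta_{k-1,i_l}}$, with at least one $\psi_l$ equal to $h_{\Delta_{k-1,i_l}}$. Then $H^d=\bigcup_{k\ge0}H_k^d$; it is a complete orthogonal system in $L_2(I^d)$. The Haar coefficients of $g\in L_1(I^d)$ are $$\lambda_h(g)=\|h\|_{L_2}^{-2}\int_{I^d} g\,h\,dx,\qquad h\in H^d,$$ so that $g=\sum_{h\in H^d}\lambda_h(g)h$ (a finite sum) for every dyadic step function $g\in\mathrm{span}(H^d)$. Schauder bases: a sequence $(f_m)_{m\in\mathbb{N}}$ in a quasi-Banach space $X$ is a Schauder basis in $X$ if every $f\in X$ has a unique representation $f=\sum_{m=1}^\infty c_mf_m$ converging in $X$. It is an unconditional Schauder basis if every rearrangement of it is a Schauder basis in $X$. *)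

theory Defs
  imports "HOL-Analysis.Analysis"
begin

text \<open>
  The dimension d is the cardinality of the index type, and \<open>1 :: real^'d\<close> is the vector all of
  whose components are 1. Elements of the function spaces are functions on the whole of
  \<open>real^'d\<close>, of which only the values on the unit cube matter; the identification of functions
  that agree almost everywhere is left to the statements that need it.
\<close>

abbreviation unit_cube :: "(real^'d) set"
  where "unit_cube \<equiv> cbox 0 1"

definition Lp_space :: "real \<Rightarrow> 'a::euclidean_space set \<Rightarrow> ('a \<Rightarrow> real) set"
  where "Lp_space p S =
    {f. f \<in> borel_measurable (lebesgue_on S) \<and> integrable (lebesgue_on S) (\<lambda>x. \<bar>f x\<bar> powr p)}"

definition Lp_norm :: "real \<Rightarrow> 'a::euclidean_space set \<Rightarrow> ('a \<Rightarrow> real) \<Rightarrow> real"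
  where "Lp_norm p S f = (LINT x|lebesgue_on S. \<bar>f x\<bar> powr p) powr (1 / p)"

definition shifted_cube :: "real^'d \<Rightarrow> (real^'d) set"
  where "shifted_cube y = {z \<in> unit_cube. z + y \<in> unit_cube}"

text \<open>
  The supremum is over a nonempty set for \<open>t > 0\<close>, and this set is bounded for f in
  \<open>Lp_space p unit_cube\<close> with \<open>p > 0\<close>, so that the real-valued \<open>SUP\<close> is the actual supremum.
\<close>

definition modulus :: "real \<Rightarrow> (real^'d \<Rightarrow> real) \<Rightarrow> real \<Rightarrow> real"
  where "modulus p f t =
    (SUP y \<in> {y. 0 < norm y \<and> norm y \<le> t}. Lp_norm p (shifted_cube y) (\<lambda>x. f (x + y) - f x))"

definition besov_space :: "real \<Rightarrow> real \<Rightarrow> real \<Rightarrow> (real^'d \<Rightarrow> real) set"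
  where "besov_space s p q =
    {f \<in> Lp_space p unit_cube.
       set_integrable lborel {0<..1} (\<lambda>t. (t powr (- s) * modulus p f t) powr q / t)}"

definition besov_norm :: "real \<Rightarrow> real \<Rightarrow> real \<Rightarrow> (real^'d \<Rightarrow> real) \<Rightarrow> real"
  where "besov_norm s p q f =
    (Lp_norm p unit_cube f powr q
      + (LINT t:{0<..1}|lborel. (t powr (- s) * modulus p f t) powr q / t)) powr (1 / q)"

definition dyadic_interval :: "nat \<Rightarrow> nat \<Rightarrow> real set"
  where "dyadic_interval k i = {(real i - 1) / 2 ^ k ..< real i / 2 ^ k}"

text \<open>
  \<open>haar1 k i\<close> is the univariate Haar function supported on \<open>dyadic_interval k i\<close>, where
  \<open>1 \<le> i \<le> 2 ^ k\<close>.
\<close>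

definition haar1 :: "nat \<Rightarrow> nat \<Rightarrow> real \<Rightarrow> real"
  where "haar1 k i x =
    indicator (dyadic_interval (Suc k) (2 * i - 1)) x - indicator (dyadic_interval (Suc k) (2 * i)) x"

primrec haar_level :: "nat \<Rightarrow> (real^'d \<Rightarrow> real) set"
  where
    "haar_level 0 = {indicator unit_cube}"
  | "haar_level (Suc k) =
      {\<lambda>x. \<Prod>l\<in>UNIV. \<psi> l (x $ l) | \<psi> i.
         (\<forall>l. i l \<in> {1..2 ^ k}) \<and>
         (\<forall>l. \<psi> l = haar1 k (i l) \<or> \<psi> l = indicator (dyadic_interval k (i l))) \<and>
         (\<exists>l. \<psi> l = haar1 k (i l))}"

definition haar_system :: "(real^'d \<Rightarrow> real) set"
  where "haar_system = (\<Union>k. haar_level k)"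

definition haar_coeff :: "(real^'d \<Rightarrow> real) \<Rightarrow> (real^'d \<Rightarrow> real) \<Rightarrow> real"
  where "haar_coeff h g =
    (LINT x|lebesgue_on unit_cube. g x * h x) / (Lp_norm 2 unit_cube h)\<^sup>2"

text \<open>
  Families indexed by the Haar system are functions that vanish outside \<open>haar_system\<close>, so that
  equality of families is equality of functions.
\<close>

definition haar_map :: "(real^'d \<Rightarrow> real) \<Rightarrow> (real^'d \<Rightarrow> real) \<Rightarrow> real"
  where "haar_map g = (\<lambda>h. if h \<in> haar_system then haar_coeff h g else 0)"

definition level_sum :: "real \<Rightarrow> real \<Rightarrow> ((real^'d \<Rightarrow> real) \<Rightarrow> real) \<Rightarrow> nat \<Rightarrow> real"
  where "level_sum s p \<gamma> k =
    (\<Sum>h\<in>haar_level k. 2 powr (real k * (s * p - real CARD('d))) * \<bar>\<gamma> h\<bar> powr p)"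

definition lqlp_space :: "real \<Rightarrow> real \<Rightarrow> real \<Rightarrow> ((real^'d \<Rightarrow> real) \<Rightarrow> real) set"
  where "lqlp_space s p q =
    {\<gamma>. (\<forall>h. h \<notin> haar_system \<longrightarrow> \<gamma> h = 0) \<and> summable (\<lambda>k. level_sum s p \<gamma> k powr (q / p))}"

definition lqlp_norm :: "real \<Rightarrow> real \<Rightarrow> real \<Rightarrow> ((real^'d \<Rightarrow> real) \<Rightarrow> real) \<Rightarrow> real"
  where "lqlp_norm s p q \<gamma> = (\<Sum>k. level_sum s p \<gamma> k powr (q / p)) powr (1 / q)"

text \<open>
  For a space X of functions with quasi-norm N, in which functions at distance zero are identified.
  This identification does not affect the definition: convergence to g in the quotient means that
  N of the difference tends to zero, and uniqueness concerns the coefficients only.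
\<close>

definition schauder_basis ::
    "('a \<Rightarrow> real) set \<Rightarrow> (('a \<Rightarrow> real) \<Rightarrow> real) \<Rightarrow> (nat \<Rightarrow> 'a \<Rightarrow> real) \<Rightarrow> bool"
  where "schauder_basis X N f \<longleftrightarrow>
    range f \<subseteq> X \<and>
    (\<forall>g\<in>X. \<exists>!c. (\<lambda>n. N (\<lambda>x. g x - (\<Sum>m<n. c m * f m x))) \<longlonglongrightarrow> 0)"

definition unconditional_schauder_basis ::
    "('a \<Rightarrow> real) set \<Rightarrow> (('a \<Rightarrow> real) \<Rightarrow> real) \<Rightarrow> (nat \<Rightarrow> 'a \<Rightarrow> real) \<Rightarrow> bool"
  where "unconditional_schauder_basis X N f \<longleftrightarrow>
    (\<forall>\<pi>. bij \<pi> \<longrightarrow> schauder_basis X N (f \<circ> \<pi>))"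

end

theory Submission
  imports Defs
begin

text \<open>
Both norms in the theorem describe the same thing: expansions \<open>f = (\<Sum>k. u k)\<close> in which \<open>u k\<close> is constant on
the dyadic cubes of side length \<open>2 powr (- k)\<close> and the numbers \<open>B k = 2 powr (k * s * p) * (LINT x|lborel. \<bar>u k x\<bar> powr p)\<close>
satisfy \<open>(\<Sum>k. B k powr (q / p)) < \<infinity>\<close> (\<open>step_series\<close>). Throughout, d denotes the dimension.

Every such series belongs to the Besov space (\<open>besov_synthesis\<close>). A step function of level k changes only across the faces
of its cubes, so a shift by y changes it on a set of relative size at most about \<open>2 ^ k * norm y\<close> (\<open>shift_power_dyadic_step_le\<close>).
Because \<open>0 < s < 1 / p\<close>, the contributions of all levels to the modulus of smoothness at \<open>2 powr (- j)\<close> form a kernel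
that decays exponentially in \<open>\<bar>j - k\<bar>\<close>, and a discrete Hardy inequality (\<open>discrete_hardy\<close>) gives the norm estimate.

Conversely, every f in the Besov space is such a series (\<open>besov_decomposition\<close>). On each dyadic cube of level k one value
of f itself approximates f in the p-th mean as well as the average of the increments of f over that cube
(\<open>ex_const_approx_on_dyadic_cube\<close>); a value is used instead of a mean because for \<open>p < 1\<close> f is not yet known to be integrable.
The differences of consecutive approximations are the \<open>u k\<close>. As \<open>s > d * (1 / p - 1)\<close>, the series converges in \<open>L_1\<close>, which
embeds the Besov space into \<open>L_1\<close> and allows Haar coefficients to be computed term by term.

The Haar coefficients of level k vanish on all \<open>u j\<close> with \<open>j < k\<close>, and for \<open>k \<le> j\<close> the sum of their p-th powers is controlled by
\<open>u j\<close> up to a factor growing like \<open>2 powr ((j - k) * d * max (1 - p) 0)\<close> (\<open>haar_analysis_le\<close>), which is weaker than the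
decay of \<open>u j\<close>; Hardy's inequality again sums over j (\<open>sequence_of_besov\<close>). In the other direction, the part of level
k of a Haar expansion is a step function of level k whose \<open>L_p\<close> norm is bounded by its coefficients (\<open>haar_synthesis_le\<close>), so
\<open>besov_synthesis\<close> applies to it (\<open>besov_of_sequence\<close>). Injectivity holds since vanishing Haar coefficients make all
integrals over dyadic cubes vanish, and f is an almost everywhere limit of dyadic step functions
(\<open>AE_zero_of_haar_zero\<close>). The basis property then reduces to the corresponding property of the unit vectors in the
sequence space.

All estimates are made for p-th powers of norms. In place of Minkowski's inequality for \<open>p \<ge> 1\<close> and of the p-triangle
inequality for \<open>p < 1\<close> there is one inequality for all positive exponents (\<open>weighted_suminf_powr_le\<close>). It costs a factor
\<open>2 powr (\<epsilon> * \<bar>j - k\<bar>)\<close> in the k-th term, which the strict inequalities between the parameters absorb.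
\<close>

section \<open>Weighted sums and a discrete Hardy inequality\<close>

definition decay :: "real \<Rightarrow> nat \<Rightarrow> nat \<Rightarrow> real"
  where "decay \<delta> j k = 2 powr (- \<delta> * \<bar>real j - real k\<bar>)"

lemma decay_pos [simp]: "0 < decay \<delta> j k"
  by (simp add: decay_def)

lemma decay_nonneg [simp]: "0 \<le> decay \<delta> j k"
  by (simp add: decay_def)

lemma decay_commute: "decay \<delta> j k = decay \<delta> k j"
  by (simp add: decay_def abs_minus_commute)

lemma decay_mult: "decay a j k * decay b j k = decay (a + b) j k"
  by (simp add: decay_def powr_add [symmetric] algebra_simps)

lemma decay_powr: "decay a j k powr r = decay (a * r) j k"
  by (simp add: decay_def powr_powr mult_ac)

lemma sum_decay_le:
  assumes "0 < \<delta>"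
  shows "(\<Sum>k<n. decay \<delta> j k) \<le> 2 / (1 - 2 powr (- \<delta>))"
proof -
  define x where "x = 2 powr (- \<delta>)"
  have x: "0 < x" "x < 1"
    using assms powr_less_one[of 2 "-\<delta>"] by (auto simp: x_def)
  have geo: "(\<Sum>i\<in>A. x ^ i) \<le> 1 / (1 - x)" if "finite A" for A
    using sum_le_suminf[of "\<lambda>i. x ^ i" A] that x suminf_geometric[of x]
    by (simp add: summable_geometric)
  have pw: "decay \<delta> j k = x ^ nat \<bar>int j - int k\<bar>" for k
  proof -
    have "real (nat \<bar>int j - int k\<bar>) = \<bar>real j - real k\<bar>" by simp
    then have "x ^ nat \<bar>int j - int k\<bar> = x powr \<bar>real j - real k\<bar>"
      using x by (metis powr_realpow)
    then show ?thesis by (simp add: decay_def x_def powr_powr)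
  qed
  have "(\<Sum>k<n. decay \<delta> j k) \<le> (\<Sum>k\<in>{..j} \<union> {j..<n}. decay \<delta> j k)"
    by (intro sum_mono2) auto
  also have "\<dots> \<le> (\<Sum>k\<in>{..j}. decay \<delta> j k) + (\<Sum>k\<in>{j..<n}. decay \<delta> j k)"
    by (subst sum_Un) (auto simp: sum_nonneg)
  also have "(\<Sum>k\<in>{..j}. decay \<delta> j k) = (\<Sum>i\<in>(\<lambda>k. j - k) ` {..j}. x ^ i)"
    by (subst sum.reindex) (auto simp: inj_on_def pw nat_diff_distrib intro!: sum.cong arg_cong[where f="\<lambda>n. x ^ n"])
  also have "\<dots> \<le> 1 / (1 - x)" by (rule geo) auto
  also have "(\<Sum>k\<in>{j..<n}. decay \<delta> j k) = (\<Sum>i\<in>(\<lambda>k. k - j) ` {j..<n}. x ^ i)"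
    by (subst sum.reindex) (auto simp: inj_on_def pw intro!: sum.cong arg_cong[where f="\<lambda>n. x ^ n"])
  also have "\<dots> \<le> 1 / (1 - x)" by (rule geo) auto
  finally show ?thesis by (simp add: x_def)
qed

lemma decay_const_pos: "0 < \<delta> \<Longrightarrow> 0 < 2 / (1 - 2 powr (- \<delta> :: real))"
  using powr_less_one[of 2 "-\<delta>"] by simp

lemma summable_decay:
  assumes "0 < \<delta>"
  shows "summable (decay \<delta> j)" "suminf (decay \<delta> j) \<le> 2 / (1 - 2 powr (- \<delta>))"
proof -
  show *: "summable (decay \<delta> j)"
    by (rule summableI_nonneg_bounded[where x="2 / (1 - 2 powr (- \<delta>))"]) (auto intro: sum_decay_le assms)
  show "suminf (decay \<delta> j) \<le> 2 / (1 - 2 powr (- \<delta>))"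
    by (rule suminf_le_const[OF *]) (auto intro: sum_decay_le assms)
qed

definition weight_const :: "real \<Rightarrow> real \<Rightarrow> real"
  where "weight_const r \<epsilon> = (2 / (1 - 2 powr (- (\<epsilon> / r)))) powr r"

lemma weight_const_pos: "0 < r \<Longrightarrow> 0 < \<epsilon> \<Longrightarrow> 0 < weight_const r \<epsilon>"
  using decay_const_pos[of "\<epsilon> / r"] by (simp add: weight_const_def)

text \<open>
A substitute, valid for every exponent \<open>r > 0\<close>, for the triangle inequality in the r-th power. No term of the
series on the right exceeds its sum S, so \<open>v k\<close> is at most \<open>S powr (1 / r)\<close> times a sequence that decays
geometrically away from j, and the latter has a bounded sum.
\<close>

lemma weighted_suminf_powr_le:
  fixes r \<epsilon> :: real and v :: "nat \<Rightarrow> real"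
  assumes "0 < r" "0 < \<epsilon>" and v: "\<And>k. 0 \<le> v k"
    and sm: "summable (\<lambda>k. decay (- \<epsilon>) j k * v k powr r)"
  shows "summable v"
    and "suminf v powr r \<le> weight_const r \<epsilon> * (\<Sum>k. decay (- \<epsilon>) j k * v k powr r)"
proof -
  define c where "c = 2 / (1 - 2 powr (- (\<epsilon> / r)))"
  have c: "0 < c" using decay_const_pos[of "\<epsilon> / r"] assms by (simp add: c_def)
  define S where "S = (\<Sum>k. decay (- \<epsilon>) j k * v k powr r)"
  have S0: "0 \<le> S" unfolding S_def by (intro suminf_nonneg sm) auto
  have le: "v k \<le> S powr (1 / r) * decay (\<epsilon> / r) j k" for k
  proof -
    have "decay (- \<epsilon>) j k * v k powr r \<le> S"
      unfolding S_def using sum_le_suminf[OF sm, of "{k}"] by simp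
    then have "decay \<epsilon> j k * (decay (- \<epsilon>) j k * v k powr r) \<le> decay \<epsilon> j k * S"
      by (intro mult_left_mono) auto
    moreover have "decay \<epsilon> j k * decay (- \<epsilon>) j k = 1"
      by (subst decay_mult) (simp add: decay_def)
    ultimately have "v k powr r \<le> decay \<epsilon> j k * S"
      by (simp add: mult.assoc[symmetric])
    then have "(v k powr r) powr (1 / r) \<le> (decay \<epsilon> j k * S) powr (1 / r)"
      using assms by (intro powr_mono2) auto
    then show ?thesis
      using assms v[of k] S0 by (simp add: powr_powr powr_mult decay_powr mult.commute)
  qed
  have sd: "summable (\<lambda>k. S powr (1 / r) * decay (\<epsilon> / r) j k)"
    using summable_decay(1)[of "\<epsilon> / r" j] assms by (intro summable_mult) (simp add: fun_eq_iff)
  have sv: "summable v"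
    by (rule summable_comparison_test'[OF sd, of 0]) (use le v in auto)
  then show "summable v" .
  have "suminf v \<le> (\<Sum>k. S powr (1 / r) * decay (\<epsilon> / r) j k)"
    by (intro suminf_le le sv sd)
  also have "\<dots> = S powr (1 / r) * suminf (decay (\<epsilon> / r) j)"
    using summable_decay(1)[of "\<epsilon> / r" j] assms by (intro suminf_mult) simp
  also have "\<dots> \<le> S powr (1 / r) * c"
    using summable_decay(2)[of "\<epsilon> / r" j] assms unfolding c_def by (intro mult_left_mono) auto
  finally have "suminf v powr r \<le> (S powr (1 / r) * c) powr r"
    using assms v sv by (intro powr_mono2 suminf_nonneg) auto
  then show "suminf v powr r \<le> weight_const r \<epsilon> * (\<Sum>k. decay (- \<epsilon>) j k * v k powr r)"
    using c S0 assms unfolding S_def[symmetric] weight_const_def c_def[symmetric] by (simp add: powr_mult powr_powr mult.commute)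
qed

definition hardy_const :: "real \<Rightarrow> real \<Rightarrow> real"
  where "hardy_const r \<delta> = weight_const r (\<delta> * r / 2) * (2 / (1 - 2 powr (- (\<delta> * r / 2))))"

lemma hardy_const_pos: "0 < r \<Longrightarrow> 0 < \<delta> \<Longrightarrow> 0 < hardy_const r \<delta>"
  using weight_const_pos[of r "\<delta> * r / 2"] decay_const_pos[of "\<delta> * r / 2"]
  unfolding hardy_const_def by (intro mult_pos_pos) auto

text \<open>
The weighted inequality is applied to \<open>decay \<delta> j k * A k\<close> with half of the available decay as the weight; the other half
remains to sum over j.
\<close>

lemma discrete_hardy:
  fixes r \<delta> :: real
  assumes "0 < r" "0 < \<delta>" and A: "\<And>k. 0 \<le> A k" and sm: "summable (\<lambda>k. A k powr r)"
  shows "summable (\<lambda>k. decay \<delta> j k * A k)"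
    and "summable (\<lambda>j. (\<Sum>k. decay \<delta> j k * A k) powr r)"
    and "(\<Sum>j. (\<Sum>k. decay \<delta> j k * A k) powr r) \<le> hardy_const r \<delta> * (\<Sum>k. A k powr r)"
proof -
  define \<epsilon> where "\<epsilon> = \<delta> * r / 2"
  have e: "0 < \<epsilon>" using assms by (simp add: \<epsilon>_def)
  define C1 where "C1 = weight_const r \<epsilon>"
  have C1: "0 < C1" unfolding C1_def by (rule weight_const_pos[OF assms(1) e])
  define c where "c = 2 / (1 - 2 powr (- \<epsilon>))"
  have c: "0 < c" using decay_const_pos[OF e] by (simp add: c_def)
  have Cc: "hardy_const r \<delta> = C1 * c" by (simp add: hardy_const_def C1_def c_def \<epsilon>_def)
  have eq: "decay (- \<epsilon>) j k * (decay \<delta> j k * A k) powr r = decay \<epsilon> j k * A k powr r" for j k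
  proof -
    have "decay (- \<epsilon>) j k * (decay \<delta> j k * A k) powr r
        = (decay (- \<epsilon>) j k * decay (\<delta> * r) j k) * A k powr r"
      using A by (simp add: powr_mult decay_powr)
    also have "decay (- \<epsilon>) j k * decay (\<delta> * r) j k = decay \<epsilon> j k"
      by (simp add: decay_mult \<epsilon>_def)
    finally show ?thesis .
  qed
  have dle1: "decay \<epsilon> j k \<le> 1" for j k
    using e powr_mono[of "- \<epsilon> * \<bar>real j - real k\<bar>" 0 2] by (simp add: decay_def)
  have sm2: "summable (\<lambda>k. decay \<epsilon> j k * A k powr r)" for j
    by (rule summable_comparison_test'[OF sm, of 0]) (use dle1 in \<open>auto intro: mult_left_le_one_le\<close>)
  have W': "summable (\<lambda>k. decay \<delta> j k * A k)"
     "(\<Sum>k. decay \<delta> j k * A k) powr r \<le> C1 * (\<Sum>k. decay \<epsilon> j k * A k powr r)" for j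
    using weighted_suminf_powr_le[OF assms(1) e, of "\<lambda>k. decay \<delta> j k * A k" j] A sm2[of j]
    unfolding eq C1_def by auto
  have bd: "(\<Sum>j<n. (\<Sum>k. decay \<delta> j k * A k) powr r) \<le> C1 * c * (\<Sum>k. A k powr r)" for n
  proof -
    have "(\<Sum>j<n. (\<Sum>k. decay \<delta> j k * A k) powr r) \<le> (\<Sum>j<n. C1 * (\<Sum>k. decay \<epsilon> j k * A k powr r))"
      by (intro sum_mono W')
    also have "\<dots> = C1 * (\<Sum>k. \<Sum>j<n. decay \<epsilon> j k * A k powr r)"
      by (simp add: sum_distrib_left[symmetric] suminf_sum[OF sm2])
    also have "(\<Sum>k. \<Sum>j<n. decay \<epsilon> j k * A k powr r) \<le> (\<Sum>k. c * A k powr r)"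
    proof (rule suminf_le)
      show "summable (\<lambda>k. \<Sum>j<n. decay \<epsilon> j k * A k powr r)" by (intro summable_sum sm2)
      show "summable (\<lambda>k. c * A k powr r)" by (intro summable_mult sm)
      fix k
      have "(\<Sum>j<n. decay \<epsilon> j k) \<le> c"
        using sum_decay_le[OF e, of k n] by (simp add: decay_commute[of _ _ k] c_def)
      then show "(\<Sum>j<n. decay \<epsilon> j k * A k powr r) \<le> c * A k powr r"
        by (simp add: sum_distrib_right[symmetric] mult_right_mono)
    qed
    also have "\<dots> = c * (\<Sum>k. A k powr r)" by (intro suminf_mult sm)
    finally show ?thesis using C1 by (simp add: mult.assoc)
  qed
  have S: "summable (\<lambda>j. (\<Sum>k. decay \<delta> j k * A k) powr r)"
    by (rule summableI_nonneg_bounded[OF _ bd]) auto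
  show "summable (\<lambda>k. decay \<delta> j k * A k)" by (rule W'(1))
  show "summable (\<lambda>j. (\<Sum>k. decay \<delta> j k * A k) powr r)" by (rule S)
  show "(\<Sum>j. (\<Sum>k. decay \<delta> j k * A k) powr r) \<le> hardy_const r \<delta> * (\<Sum>k. A k powr r)"
    unfolding Cc by (rule suminf_le_const[OF S bd])
qed

text \<open>
Weighted geometric and arithmetic means of \<open>(t / \<mu>) powr p\<close> and 1, with weights \<open>1 / p\<close> and \<open>1 - 1 / p\<close>.
\<close>

lemma powr_ge_tangent:
  fixes p t \<mu> :: real
  assumes "1 \<le> p" "0 \<le> t" "0 < \<mu>"
  shows "\<mu> powr p + p * \<mu> powr (p - 1) * (t - \<mu>) \<le> t powr p"
proof -
  define r where "r = t / \<mu>"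
  have r: "0 \<le> r" "t = r * \<mu>" using assms by (auto simp: r_def)
  have "p * r \<le> r powr p + p - 1"
  proof (cases "r = 0")
    case False
    have "(r powr p) powr (1 / p) * 1 powr (1 - 1 / p) \<le> (1 / p) * r powr p + (1 - 1 / p) * 1"
      using assms r False by (intro Youngs_inequality_0) (auto simp: field_simps)
    then have "r \<le> (1 / p) * r powr p + (1 - 1 / p)"
      using assms r by (simp add: powr_powr)
    then have "p * r \<le> p * ((1 / p) * r powr p + (1 - 1 / p))"
      using assms by (intro mult_left_mono) auto
    then show ?thesis
      using assms by (simp add: distrib_left right_diff_distrib)
  qed (use assms in auto)
  then have "\<mu> powr p * (1 + p * (r - 1)) \<le> \<mu> powr p * r powr p"
    by (intro mult_left_mono) (auto simp: algebra_simps)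
  moreover have "\<mu> powr p = \<mu> powr (p - 1) * \<mu>"
    using assms(3) by (simp add: powr_mult_base mult.commute)
  ultimately show ?thesis
    using r assms by (simp add: powr_mult algebra_simps)
qed

text \<open>
For \<open>p \<le> 1\<close> the p-th power is subadditive; for \<open>p > 1\<close> this is Jensen's inequality, obtained by adding the tangent
inequality at the mean value over all of A. The exponent of the cardinality is sharp in both cases, which the embedding
into \<open>L_1\<close> needs.
\<close>

lemma sum_powr_le:
  fixes c :: "'a \<Rightarrow> real"
  assumes "finite A" "\<And>m. m \<in> A \<Longrightarrow> 0 \<le> c m" "0 < p"
  shows "(\<Sum>m\<in>A. c m) powr p \<le> real (card A) powr max (p - 1) 0 * (\<Sum>m\<in>A. c m powr p)"
proof (cases "(\<Sum>m\<in>A. c m) = 0")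
  case True
  then show ?thesis by (simp add: sum_nonneg)
next
  case False
  define S where "S = (\<Sum>m\<in>A. c m)"
  have S: "0 < S" using False assms sum_nonneg[of A c] by (simp add: S_def less_le)
  have n: "0 < card A" using False assms(1) by (metis card_gt_0_iff sum.empty)
  show ?thesis
  proof (cases "p \<le> 1")
    case True
    have "c m / S \<le> (c m / S) powr p" if "m \<in> A" for m
    proof -
      have "c m \<le> S" unfolding S_def using that assms by (intro member_le_sum) auto
      then have "c m / S \<le> 1" using S by simp
      then have "(c m / S) powr 1 \<le> (c m / S) powr p"
        using True S assms that by (intro powr_mono') auto
      then show ?thesis using S assms(2)[OF that] by simp
    qed
    then have "(\<Sum>m\<in>A. c m / S) \<le> (\<Sum>m\<in>A. (c m / S) powr p)"
      by (rule sum_mono)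
    also have "(\<Sum>m\<in>A. c m / S) = 1"
      using S by (simp add: S_def sum_divide_distrib[symmetric])
    also have "(\<Sum>m\<in>A. (c m / S) powr p) = (\<Sum>m\<in>A. c m powr p) / S powr p"
      using S assms by (simp add: powr_divide sum_divide_distrib)
    finally have "S powr p \<le> (\<Sum>m\<in>A. c m powr p)"
      using S by (simp add: field_simps)
    then show ?thesis using True n by (simp add: S_def max_def)
  next
    case False
    define \<mu> where "\<mu> = S / card A"
    have \<mu>: "0 < \<mu>" using S n by (simp add: \<mu>_def)
    have "(\<Sum>m\<in>A. \<mu> powr p + p * \<mu> powr (p - 1) * (c m - \<mu>)) \<le> (\<Sum>m\<in>A. c m powr p)"
      using False assms \<mu> by (intro sum_mono powr_ge_tangent) auto
    also have "(\<Sum>m\<in>A. \<mu> powr p + p * \<mu> powr (p - 1) * (c m - \<mu>))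
        = card A * \<mu> powr p + p * \<mu> powr (p - 1) * (S - card A * \<mu>)"
      by (simp add: sum.distrib sum_distrib_left[symmetric] sum_subtractf S_def)
    also have "S - card A * \<mu> = 0" using n by (simp add: \<mu>_def)
    finally have "card A * \<mu> powr p \<le> (\<Sum>m\<in>A. c m powr p)" by simp
    then have "card A powr (p - 1) * (card A * \<mu> powr p) \<le> card A powr (p - 1) * (\<Sum>m\<in>A. c m powr p)"
      by (intro mult_left_mono) auto
    moreover have "card A powr (p - 1) * (card A * \<mu> powr p) = (card A * \<mu>) powr p"
    proof -
      have "card A powr (p - 1) * card A = card A powr p"
        using n by (simp add: powr_mult_base mult.commute)
      then show ?thesis using \<mu> by (simp add: powr_mult mult.assoc[symmetric])
    qed
    moreover have "card A * \<mu> = S" using n by (simp add: \<mu>_def)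
    ultimately show ?thesis using False by (simp add: S_def max_def)
  qed
qed

lemma sum_powr_le_crude:
  fixes c :: "'a \<Rightarrow> real"
  assumes "finite A" "\<And>m. m \<in> A \<Longrightarrow> 0 \<le> c m" "0 < p" "card A \<le> n"
  shows "(\<Sum>m\<in>A. c m) powr p \<le> real n powr p * (\<Sum>m\<in>A. c m powr p)"
proof (cases "A = {}")
  case False
  then have n: "1 \<le> real n" using assms(1,4) by (metis One_nat_def card_gt_0_iff le_trans of_nat_1 of_nat_le_iff Suc_leI)
  have "(\<Sum>m\<in>A. c m) powr p \<le> real (card A) powr max (p - 1) 0 * (\<Sum>m\<in>A. c m powr p)"
    using assms by (intro sum_powr_le) auto
  also have "real (card A) powr max (p - 1) 0 \<le> real n powr max (p - 1) 0"
    using assms by (intro powr_mono2) auto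
  also have "\<dots> \<le> real n powr p" using n assms by (intro powr_mono) auto
  finally show ?thesis by (simp add: sum_nonneg mult_right_mono)
qed auto

lemma abs_add_powr_le:
  fixes a b p :: real
  assumes "0 < p"
  shows "\<bar>a + b\<bar> powr p \<le> 2 powr p * (\<bar>a\<bar> powr p + \<bar>b\<bar> powr p)"
proof -
  have "\<bar>a + b\<bar> powr p \<le> (2 * max \<bar>a\<bar> \<bar>b\<bar>) powr p"
    using assms by (intro powr_mono2) auto
  also have "\<dots> = 2 powr p * max \<bar>a\<bar> \<bar>b\<bar> powr p" by (simp add: powr_mult)
  also have "\<dots> \<le> 2 powr p * (\<bar>a\<bar> powr p + \<bar>b\<bar> powr p)"
    by (intro mult_left_mono) (auto simp: max_def)
  finally show ?thesis .
qed

section \<open>Dyadic cubes\<close>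

text \<open>
Unlike the closed unit cube, the half-open one is a disjoint union of dyadic cubes of any level; the two differ by a null set.
\<close>

definition ucube :: "(real^'d) set"
  where "ucube = {x. \<forall>l. 0 \<le> x $ l \<and> x $ l < 1}"

definition cell :: "nat \<Rightarrow> real^'d \<Rightarrow> 'd \<Rightarrow> int"
  where "cell k x = (\<lambda>l. \<lfloor>2 ^ k * x $ l\<rfloor>)"

definition dyadic_cube :: "nat \<Rightarrow> ('d \<Rightarrow> int) \<Rightarrow> (real^'d) set"
  where "dyadic_cube k m = {x. cell k x = m}"

definition cells :: "nat \<Rightarrow> ('d::finite \<Rightarrow> int) set"
  where "cells k = {m. \<forall>l. 0 \<le> m l \<and> m l < 2 ^ k}"

lemma mem_ucube_iff: "x \<in> ucube \<longleftrightarrow> cell k x \<in> cells k"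
proof -
  have "0 \<le> 2 ^ k * x $ l \<longleftrightarrow> 0 \<le> x $ l" for l
    using mult_le_cancel_left_pos[of "2 ^ k :: real" 0 "x $ l"] by simp
  then show ?thesis
    by (auto simp: ucube_def cells_def cell_def floor_less_iff)
qed

lemma mem_dyadic_cube_iff: "x \<in> dyadic_cube k m \<longleftrightarrow> (\<forall>l. m l / 2 ^ k \<le> x $ l \<and> x $ l < (m l + 1) / 2 ^ k)"
  by (auto simp: dyadic_cube_def cell_def fun_eq_iff floor_eq_iff field_simps)

lemma dyadic_cube_0: "dyadic_cube 0 (\<lambda>_. 0) = ucube"
  by (auto simp: mem_dyadic_cube_iff ucube_def)

lemma cells_0: "cells 0 = {\<lambda>_. 0}"
proof -
  have "0 \<le> a \<and> a < 1 \<longleftrightarrow> a = 0" for a :: int by auto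
  then show ?thesis by (auto simp: cells_def fun_eq_iff)
qed

lemma cells_PiE: "cells k = (\<Pi>\<^sub>E l\<in>UNIV. {0..<2 ^ k})"
  by (auto simp: cells_def)

lemma finite_cells [simp]: "finite (cells k)"
  unfolding cells_PiE by (intro finite_PiE) auto

lemma dyadic_cube_subset_ucube: "m \<in> cells k \<Longrightarrow> dyadic_cube k m \<subseteq> ucube"
  by (auto simp: dyadic_cube_def mem_ucube_iff[of _ k])

lemma cell_Suc_div: "cell k x l = cell (Suc k) x l div 2"
proof -
  have "\<lfloor>2 ^ k * x $ l\<rfloor> = \<lfloor>(2 ^ Suc k * x $ l) / real_of_int 2\<rfloor>" by simp
  also have "\<dots> = \<lfloor>2 ^ Suc k * x $ l\<rfloor> div 2" by (rule floor_divide_real_eq_div) simp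
  finally show ?thesis by (simp add: cell_def)
qed

lemma cell_div: "cell j x l = cell (j + n) x l div 2 ^ n"
proof (induction n)
  case (Suc n)
  have "cell j x l = cell (Suc (j + n)) x l div 2 div 2 ^ n"
    using Suc cell_Suc_div[of "j + n" x l] by simp
  also have "\<dots> = cell (Suc (j + n)) x l div (2 * 2 ^ n)"
    by (rule zdiv_zmult2_eq [symmetric]) simp
  finally show ?case by simp
qed simp

lemma cell_eq_mono: "j \<le> k \<Longrightarrow> cell k x = cell k y \<Longrightarrow> cell j x = cell j y"
  by (metis (no_types) cell_div ext le_Suc_ex)

lemma int_div_eq_iff_interval:
  fixes c :: int
  assumes "0 < c"
  shows "a div c = q \<longleftrightarrow> a \<in> {q * c ..< (q + 1) * c}"
proof
  assume "a div c = q"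
  then show "a \<in> {q * c ..< (q + 1) * c}"
    using div_mult_mod_eq[of a c] pos_mod_bound[OF assms, of a] pos_mod_sign[OF assms, of a]
    by (auto simp: distrib_right)
next
  assume "a \<in> {q * c ..< (q + 1) * c}"
  then show "a div c = q"
    by (intro int_div_pos_eq[of _ _ _ "a - q * c"]) (auto simp: algebra_simps)
qed

lemma card_subcells:
  fixes n :: "'d::finite \<Rightarrow> int"
  shows "finite {m. \<forall>l. m l div 2 ^ i = n l}" "card {m. \<forall>l. m l div 2 ^ i = n l} = 2 ^ (i * CARD('d))"
proof -
  have eq: "{m. \<forall>l. m l div 2 ^ i = n l} = (\<Pi>\<^sub>E l\<in>UNIV. {n l * 2 ^ i ..< (n l + 1) * 2 ^ i})"
    by (simp add: PiE_UNIV_domain Pi_def int_div_eq_iff_interval)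
  have "card {n l * 2 ^ i ..< (n l + 1) * 2 ^ i} = 2 ^ i" for l
    by (simp add: algebra_simps nat_power_eq)
  moreover have "card (\<Pi>\<^sub>E l\<in>UNIV. {n l * 2 ^ i ..< (n l + 1) * 2 ^ i})
      = (\<Prod>l\<in>UNIV. card {n l * 2 ^ i ..< (n l + 1) * 2 ^ i})"
    by (rule card_PiE) simp
  ultimately show "card {m. \<forall>l. m l div 2 ^ i = n l} = 2 ^ (i * CARD('d))"
    by (simp only: eq) (simp add: power_mult)
  show "finite {m. \<forall>l. m l div 2 ^ i = n l}"
    unfolding eq by (intro finite_PiE) auto
qed

lemma measurable_vec_nth [measurable]: "(\<lambda>x::real^'d. x $ l) \<in> borel_measurable borel"
  by (intro borel_measurable_continuous_onI continuous_intros)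

lemma measurable_cell [measurable]: "(\<lambda>x. cell k x l) \<in> measurable borel (count_space UNIV)"
  unfolding cell_def by measurable

lemma measurable_cell_eq [measurable (raw)]:
  assumes [measurable]: "f \<in> borel_measurable M" "g \<in> borel_measurable M"
  shows "Measurable.pred M (\<lambda>x. cell k (f x) = cell k (g x))"
  unfolding fun_eq_iff by measurable

lemma sets_dyadic_cube [measurable]: "dyadic_cube k m \<in> sets borel"
  unfolding dyadic_cube_def fun_eq_iff by measurable

lemma sets_ucube [measurable]: "ucube \<in> sets borel"
  unfolding ucube_def by measurable

lemma emeasure_lborel_cbox_cart:
  fixes a b :: "real^'d"
  assumes "\<And>l. a $ l \<le> b $ l"
  shows "emeasure lborel (cbox a b) = ennreal (\<Prod>l\<in>UNIV. b $ l - a $ l)"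
proof -
  have "emeasure lborel (cbox a b) = ennreal (measure lborel (cbox a b))"
    using emeasure_lborel_cbox_finite[of a b] by (intro emeasure_eq_ennreal_measure) auto
  also have "measure lborel (cbox a b) = (\<Prod>l\<in>UNIV. b $ l - a $ l)"
    using assms by (intro content_cbox_cart) (auto simp: interval_ne_empty_cart)
  finally show ?thesis .
qed

lemma emeasure_dyadic_cube:
  "emeasure lborel (dyadic_cube k m :: (real^'d) set) = ennreal ((1 / 2 ^ k) ^ CARD('d))"
proof -
  define a b :: "real^'d" where "a = (\<chi> l. m l / 2 ^ k)" and "b = (\<chi> l. (m l + 1) / 2 ^ k)"
  have eq: "emeasure lborel (cbox a b) = ennreal ((1 / 2 ^ k) ^ CARD('d))"
    by (subst emeasure_lborel_cbox_cart) (auto simp: a_def b_def divide_right_mono diff_divide_distrib [symmetric])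
  have "emeasure lborel (dyadic_cube k m) \<le> emeasure lborel (cbox a b)"
    by (intro emeasure_mono) (auto simp: mem_dyadic_cube_iff mem_box_cart a_def b_def less_imp_le)
  moreover have "emeasure lborel (box a b) \<le> emeasure lborel (dyadic_cube k m)"
    by (intro emeasure_mono) (auto simp: mem_dyadic_cube_iff mem_box_cart a_def b_def less_imp_le)
  moreover have "emeasure lborel (box a b) = emeasure lborel (cbox a b)"
    by (simp add: emeasure_lborel_box_eq emeasure_lborel_cbox_eq)
  ultimately show ?thesis using eq by simp
qed

lemma AE_unit_cube_iff: "AE x in lborel. (x \<in> (unit_cube :: (real^'d) set)) = (x \<in> ucube)"
proof (rule AE_I')
  have "emeasure lborel (cbox 0 (1::real^'d) - box 0 1) = 0"
    by (subst emeasure_Diff) (auto simp: emeasure_lborel_box_eq emeasure_lborel_cbox_eq box_subset_cbox)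
  then show "cbox 0 (1::real^'d) - box 0 1 \<in> null_sets lborel"
    by (auto simp: null_sets_def)
  show "{x \<in> space lborel. (x \<in> (unit_cube :: (real^'d) set)) \<noteq> (x \<in> ucube)} \<subseteq> cbox 0 1 - box 0 1"
    by (auto simp: mem_box_cart ucube_def less_imp_le)
qed

lemma indicator_ucube_sum:
  "(indicator ucube x :: 'a::semiring_1) = (\<Sum>m\<in>cells k. indicator (dyadic_cube k m) x)"
proof (cases "x \<in> ucube")
  case True
  have "(\<Sum>m\<in>cells k. indicator (dyadic_cube k m) x) = (\<Sum>m\<in>cells k. if m = cell k x then 1 else (0::'a))"
    by (intro sum.cong) (auto simp: dyadic_cube_def indicator_def)
  then show ?thesis using True by (simp add: mem_ucube_iff[of x k])
next
  case False
  then have "x \<notin> dyadic_cube k m" if "m \<in> cells k" for m using dyadic_cube_subset_ucube[OF that] by auto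
  then show ?thesis using False by simp
qed

text \<open>
A point leaves its cube under the shift by y only if, in some coordinate l, it lies within \<open>\<bar>y $ l\<bar>\<close> of one of the two faces
orthogonal to that direction.
\<close>

lemma emeasure_dyadic_cube_shift_le:
  fixes y :: "real^'d"
  shows "emeasure lborel {x \<in> dyadic_cube k m. x + y \<notin> dyadic_cube k m}
    \<le> ennreal (2 ^ k * (\<Sum>l\<in>UNIV. \<bar>y $ l\<bar>) * (1 / 2 ^ k) ^ CARD('d))"
proof -
  define lo where "lo l = m l / 2 ^ k" for l
  define hi where "hi l = (m l + 1) / 2 ^ k" for l
  have side: "hi l = lo l + 1 / 2 ^ k" for l
    by (simp add: lo_def hi_def add_divide_distrib)
  have memQ: "x \<in> dyadic_cube k m \<longleftrightarrow> (\<forall>l. lo l \<le> x $ l \<and> x $ l < hi l)" for x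
    by (simp add: mem_dyadic_cube_iff lo_def hi_def)
  define a b :: "'d \<Rightarrow> real^'d" where
    "a l = (\<chi> i. if i = l then (if 0 \<le> y $ l then hi l - \<bar>y $ l\<bar> else lo l) else lo i)" and
    "b l = (\<chi> i. if i = l then (if 0 \<le> y $ l then hi l else lo l + \<bar>y $ l\<bar>) else hi i)" for l
  have em: "emeasure lborel (cbox (a l) (b l)) = ennreal (2 ^ k * \<bar>y $ l\<bar> * (1 / 2 ^ k) ^ CARD('d))" for l
  proof -
    have "emeasure lborel (cbox (a l) (b l)) = ennreal (\<Prod>i\<in>UNIV. b l $ i - a l $ i)"
      by (intro emeasure_lborel_cbox_cart) (auto simp: a_def b_def side)
    also have "(\<Prod>i\<in>UNIV. b l $ i - a l $ i) = (\<Prod>i\<in>UNIV. if i = l then \<bar>y $ l\<bar> else 1 / 2 ^ k)"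
      by (intro prod.cong) (auto simp: a_def b_def side)
    also have "\<dots> = \<bar>y $ l\<bar> * (1 / 2 ^ k) ^ (CARD('d) - 1)"
      by (subst prod.remove[of _ l]) (auto simp: prod.If_cases card_Diff_singleton)
    also have "\<dots> = 2 ^ k * \<bar>y $ l\<bar> * (1 / 2 ^ k) ^ CARD('d)"
      by (subst (2) power_eq_if) simp
    finally show ?thesis .
  qed
  have "emeasure lborel {x \<in> dyadic_cube k m. x + y \<notin> dyadic_cube k m} \<le> emeasure lborel (\<Union>l. cbox (a l) (b l))"
  proof (intro emeasure_mono subsetI)
    fix x assume "x \<in> {x \<in> dyadic_cube k m. x + y \<notin> dyadic_cube k m}"
    then have x: "\<And>l. lo l \<le> x $ l \<and> x $ l < hi l" and "\<exists>l. \<not> (lo l \<le> x $ l + y $ l \<and> x $ l + y $ l < hi l)"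
      by (auto simp: memQ)
    then obtain l where l: "\<not> (lo l \<le> x $ l + y $ l \<and> x $ l + y $ l < hi l)" by blast
    have "a l $ i \<le> x $ i \<and> x $ i \<le> b l $ i" for i
      using x[of i] x[of l] l by (auto simp: a_def b_def)
    then show "x \<in> (\<Union>l. cbox (a l) (b l))" by (auto simp: mem_box_cart)
  qed auto
  also have "\<dots> \<le> (\<Sum>l\<in>UNIV. emeasure lborel (cbox (a l) (b l)))"
    by (intro emeasure_subadditive_finite) auto
  also have "\<dots> = ennreal (\<Sum>l\<in>UNIV. 2 ^ k * \<bar>y $ l\<bar> * (1 / 2 ^ k) ^ CARD('d))"
    unfolding em by (intro sum_ennreal) auto
  also have "(\<Sum>l\<in>UNIV. 2 ^ k * \<bar>y $ l\<bar> * (1 / 2 ^ k) ^ CARD('d))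
      = 2 ^ k * (\<Sum>l\<in>UNIV. \<bar>y $ l\<bar>) * (1 / 2 ^ k) ^ CARD('d)"
    by (simp add: sum_distrib_left sum_distrib_right)
  finally show ?thesis .
qed

section \<open>Dyadic step functions and their shifts\<close>

lemma nn_integral_lborel_shift:
  fixes f :: "'a::euclidean_space \<Rightarrow> ennreal"
  assumes [measurable]: "f \<in> borel_measurable borel"
  shows "(\<integral>\<^sup>+x. f (x + y) \<partial>lborel) = (\<integral>\<^sup>+x. f x \<partial>lborel)"
proof -
  have "(\<integral>\<^sup>+x. f x \<partial>lborel) = (\<integral>\<^sup>+x. f x \<partial>distr lborel borel ((+) y))"
    by (simp only: lborel_distr_plus)
  also have "\<dots> = (\<integral>\<^sup>+x. f (y + x) \<partial>lborel)"
    by (subst nn_integral_distr) auto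
  finally show ?thesis by (simp add: add.commute)
qed

text \<open>
The p-th power of the \<open>L_p\<close> quasi-norm, with values in the extended nonnegative reals so that no integrability has to be
carried along.
\<close>

definition Lp_power :: "real \<Rightarrow> (real^'d \<Rightarrow> real) \<Rightarrow> ennreal"
  where "Lp_power p f = (\<integral>\<^sup>+x. ennreal (\<bar>f x\<bar> powr p) \<partial>lborel)"

text \<open>
The p-th power of the \<open>L_p\<close> quasi-norm of the increment of f, over the part of the half-open cube from which the shift by y
does not lead out of it.
\<close>

definition shift_power :: "real \<Rightarrow> (real^'d \<Rightarrow> real) \<Rightarrow> real^'d \<Rightarrow> ennreal"
  where "shift_power p f y = (\<integral>\<^sup>+x. ennreal (\<bar>f (x + y) - f x\<bar> powr p)
      * indicator {x. x \<in> ucube \<and> x + y \<in> ucube} x \<partial>lborel)"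

definition dyadic_step :: "nat \<Rightarrow> (real^'d \<Rightarrow> real) \<Rightarrow> bool"
  where "dyadic_step k u \<longleftrightarrow>
    (\<forall>x. x \<notin> ucube \<longrightarrow> u x = 0) \<and> (\<forall>x y. cell k x = cell k y \<longrightarrow> u x = u y)"

text \<open>
The value on the cube with index m, read off at the lower left corner.
\<close>

definition step_value :: "nat \<Rightarrow> (real^'d \<Rightarrow> real) \<Rightarrow> ('d \<Rightarrow> int) \<Rightarrow> real"
  where "step_value k u m = u (\<chi> l. m l / 2 ^ k)"

lemma cell_corner: "cell k (\<chi> l. m l / 2 ^ k) = m"
  by (simp add: cell_def fun_eq_iff)

lemma dstepI:
  "(\<And>x. x \<notin> ucube \<Longrightarrow> u x = 0) \<Longrightarrow> (\<And>x y. cell k x = cell k y \<Longrightarrow> u x = u y) \<Longrightarrow> dyadic_step k u"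
  unfolding dyadic_step_def by blast

lemma dyadic_step_outside: "dyadic_step k u \<Longrightarrow> x \<notin> ucube \<Longrightarrow> u x = 0"
  and dstepD: "dyadic_step k u \<Longrightarrow> cell k x = cell k y \<Longrightarrow> u x = u y"
  unfolding dyadic_step_def by blast+

lemma dyadic_step_eq_step_value: "dyadic_step k u \<Longrightarrow> u x = step_value k u (cell k x)"
  unfolding step_value_def by (rule dstepD, assumption, rule cell_corner[symmetric])

lemma dyadic_step_zero [simp]: "dyadic_step k (\<lambda>x. 0)"
  by (simp add: dyadic_step_def)

lemma dyadic_step_mono: "j \<le> k \<Longrightarrow> dyadic_step j u \<Longrightarrow> dyadic_step k u"
  by (rule dstepI) (auto intro: dyadic_step_outside dstepD cell_eq_mono)

lemma dyadic_step_add: "dyadic_step k u \<Longrightarrow> dyadic_step k v \<Longrightarrow> dyadic_step k (\<lambda>x. u x + v x)"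
  by (rule dstepI) (simp add: dyadic_step_outside, intro arg_cong2[where f="(+)"] dstepD, auto)

lemma dyadic_step_cmult: "dyadic_step k u \<Longrightarrow> dyadic_step k (\<lambda>x. a * u x)"
  by (rule dstepI) (simp add: dyadic_step_outside, rule arg_cong[where f="(*) a"], rule dstepD)

lemma dyadic_step_diff: "dyadic_step k u \<Longrightarrow> dyadic_step k v \<Longrightarrow> dyadic_step k (\<lambda>x. u x - v x)"
  by (rule dstepI) (simp add: dyadic_step_outside, intro arg_cong2[where f="(-)"] dstepD, auto)

lemma dyadic_step_sum: "(\<And>i. i \<in> A \<Longrightarrow> dyadic_step k (u i)) \<Longrightarrow> dyadic_step k (\<lambda>x. \<Sum>i\<in>A. u i x)"
  by (rule dstepI) (auto intro!: sum.neutral sum.cong intro: dyadic_step_outside dstepD)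

lemma borel_dyadic_step:
  assumes "dyadic_step k u"
  shows "u \<in> borel_measurable borel"
proof -
  have "u x = (\<Sum>m\<in>cells k. step_value k u m * indicator (dyadic_cube k m) x)" for x
  proof -
    have "u x = u x * indicator ucube x" using dyadic_step_outside[OF assms] by (auto simp: indicator_def)
    also have "\<dots> = (\<Sum>m\<in>cells k. u x * indicator (dyadic_cube k m) x)"
      by (simp add: indicator_ucube_sum[of _ k] sum_distrib_left)
    also have "\<dots> = (\<Sum>m\<in>cells k. step_value k u m * indicator (dyadic_cube k m) x)"
      using dyadic_step_eq_step_value[OF assms] by (intro sum.cong) (auto simp: dyadic_cube_def indicator_def)
    finally show ?thesis .
  qed
  then have "u = (\<lambda>x. \<Sum>m\<in>cells k. step_value k u m * indicator (dyadic_cube k m) x)" by blast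
  also have "\<dots> \<in> borel_measurable borel" by measurable
  finally show ?thesis .
qed

lemma nn_integral_ucube_cells:
  assumes [measurable]: "F \<in> borel_measurable borel"
  shows "(\<integral>\<^sup>+x. F x * indicator ucube x \<partial>lborel) = (\<Sum>m\<in>cells k. \<integral>\<^sup>+x. F x * indicator (dyadic_cube k m) x \<partial>lborel)"
  by (subst nn_integral_sum[symmetric]) (auto simp: indicator_ucube_sum[of _ k] sum_distrib_left)

lemma nn_integral_dyadic_step:
  assumes u: "dyadic_step k u" and A [measurable]: "A \<in> sets borel" and "0 < p"
  shows "(\<integral>\<^sup>+x. ennreal (\<bar>u x\<bar> powr p) * indicator A x \<partial>lborel)
    = (\<Sum>m\<in>cells k. ennreal (\<bar>step_value k u m\<bar> powr p) * emeasure lborel (dyadic_cube k m \<inter> A))"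
proof -
  note [measurable] = borel_dyadic_step[OF u]
  have "(\<integral>\<^sup>+x. ennreal (\<bar>u x\<bar> powr p) * indicator A x \<partial>lborel)
      = (\<integral>\<^sup>+x. (ennreal (\<bar>u x\<bar> powr p) * indicator A x) * indicator ucube x \<partial>lborel)"
    using dyadic_step_outside[OF u] assms by (intro nn_integral_cong) (auto simp: indicator_def)
  also have "\<dots> = (\<Sum>m\<in>cells k. \<integral>\<^sup>+x. (ennreal (\<bar>u x\<bar> powr p) * indicator A x) * indicator (dyadic_cube k m) x \<partial>lborel)"
    by (intro nn_integral_ucube_cells) measurable
  also have "\<dots> = (\<Sum>m\<in>cells k. \<integral>\<^sup>+x. ennreal (\<bar>step_value k u m\<bar> powr p) * indicator (dyadic_cube k m \<inter> A) x \<partial>lborel)"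
    using dyadic_step_eq_step_value[OF u] by (intro sum.cong nn_integral_cong) (auto simp: dyadic_cube_def indicator_def)
  also have "\<dots> = (\<Sum>m\<in>cells k. ennreal (\<bar>step_value k u m\<bar> powr p) * emeasure lborel (dyadic_cube k m \<inter> A))"
    by (intro sum.cong refl nn_integral_cmult_indicator) auto
  finally show ?thesis .
qed

lemma Lp_power_dyadic_step:
  fixes u :: "real^'d \<Rightarrow> real"
  assumes u: "dyadic_step k u" and "0 < p"
  shows "Lp_power p u = (\<Sum>m\<in>cells k. ennreal (\<bar>step_value k u m\<bar> powr p) * ennreal ((1 / 2 ^ k) ^ CARD('d)))"
  using nn_integral_dyadic_step[OF u, of UNIV p] assms by (simp add: Lp_power_def emeasure_dyadic_cube)

text \<open>
Only the points near the boundaries of the cubes contribute, and by translation invariance each cube contributes the same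
proportion of its mass.
\<close>

lemma nn_integral_dyadic_step_jump_le:
  fixes u :: "real^'d \<Rightarrow> real"
  assumes u: "dyadic_step k u" and p: "0 < p"
  shows "(\<integral>\<^sup>+x. ennreal (\<bar>u x\<bar> powr p) * indicator {x. cell k (x + y) \<noteq> cell k x} x \<partial>lborel)
    \<le> ennreal (2 ^ k * (\<Sum>l\<in>UNIV. \<bar>y $ l\<bar>)) * Lp_power p u"
proof -
  have "(\<integral>\<^sup>+x. ennreal (\<bar>u x\<bar> powr p) * indicator {x. cell k (x + y) \<noteq> cell k x} x \<partial>lborel)
      = (\<Sum>m\<in>cells k. ennreal (\<bar>step_value k u m\<bar> powr p)
          * emeasure lborel (dyadic_cube k m \<inter> {x. cell k (x + y) \<noteq> cell k x}))"
    using p by (intro nn_integral_dyadic_step u) measurable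
  also have "\<dots> \<le> (\<Sum>m\<in>cells k. ennreal (\<bar>step_value k u m\<bar> powr p)
          * ennreal (2 ^ k * (\<Sum>l\<in>UNIV. \<bar>y $ l\<bar>) * (1 / 2 ^ k) ^ CARD('d)))"
  proof (intro sum_mono mult_left_mono)
    fix m :: "'d \<Rightarrow> int"
    have "dyadic_cube k m \<inter> {x. cell k (x + y) \<noteq> cell k x} = {x \<in> dyadic_cube k m. x + y \<notin> dyadic_cube k m}"
      by (auto simp: dyadic_cube_def)
    then show "emeasure lborel (dyadic_cube k m \<inter> {x. cell k (x + y) \<noteq> cell k x})
        \<le> ennreal (2 ^ k * (\<Sum>l\<in>UNIV. \<bar>y $ l\<bar>) * (1 / 2 ^ k) ^ CARD('d))"
      using emeasure_dyadic_cube_shift_le[of k m y] by simp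
  qed auto
  also have "\<dots> = (\<Sum>m\<in>cells k. ennreal (2 ^ k * (\<Sum>l\<in>UNIV. \<bar>y $ l\<bar>))
       * (ennreal (\<bar>step_value k u m\<bar> powr p) * ennreal ((1 / 2 ^ k) ^ CARD('d))))"
    by (intro sum.cong refl) (simp add: ennreal_mult'[symmetric] sum_nonneg mult_ac)
  also have "\<dots> = ennreal (2 ^ k * (\<Sum>l\<in>UNIV. \<bar>y $ l\<bar>)) * Lp_power p u"
    by (simp add: Lp_power_dyadic_step[OF u p] sum_distrib_left)
  finally show ?thesis .
qed

lemma shift_power_le_Lp_power:
  fixes f :: "real^'d \<Rightarrow> real"
  assumes [measurable]: "f \<in> borel_measurable borel" and "0 < p"
  shows "shift_power p f y \<le> ennreal (2 * 2 powr p) * Lp_power p f"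
proof -
  have "shift_power p f y \<le> (\<integral>\<^sup>+x. ennreal (2 powr p) * (ennreal (\<bar>f (x + y)\<bar> powr p) + ennreal (\<bar>f x\<bar> powr p)) \<partial>lborel)"
    unfolding shift_power_def
  proof (rule nn_integral_mono)
    fix x
    have "\<bar>f (x + y) + - f x\<bar> powr p \<le> 2 powr p * (\<bar>f (x + y)\<bar> powr p + \<bar>- f x\<bar> powr p)"
      by (intro abs_add_powr_le assms)
    then have "ennreal (\<bar>f (x + y) - f x\<bar> powr p) \<le> ennreal (2 powr p) * (ennreal (\<bar>f (x + y)\<bar> powr p) + ennreal (\<bar>f x\<bar> powr p))"
      by (simp add: ennreal_plus[symmetric] ennreal_mult'[symmetric] del: ennreal_plus)
    then show "ennreal (\<bar>f (x + y) - f x\<bar> powr p) * indicator {x. x \<in> ucube \<and> x + y \<in> ucube} x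
        \<le> ennreal (2 powr p) * (ennreal (\<bar>f (x + y)\<bar> powr p) + ennreal (\<bar>f x\<bar> powr p))"
      by (auto simp: indicator_def)
  qed
  also have "\<dots> = ennreal (2 powr p) * ((\<integral>\<^sup>+x. ennreal (\<bar>f (x + y)\<bar> powr p) \<partial>lborel) + Lp_power p f)"
    by (subst nn_integral_cmult, measurable, subst nn_integral_add) (auto simp: Lp_power_def)
  also have "(\<integral>\<^sup>+x. ennreal (\<bar>f (x + y)\<bar> powr p) \<partial>lborel) = Lp_power p f"
    unfolding Lp_power_def by (rule nn_integral_lborel_shift[where f="\<lambda>x. ennreal (\<bar>f x\<bar> powr p)"]) measurable
  also have "ennreal (2 powr p) * (Lp_power p f + Lp_power p f) = ennreal (2 * 2 powr p) * Lp_power p f"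
    by (simp add: mult_2[symmetric] ennreal_mult' mult_ac)
  finally show ?thesis .
qed

text \<open>
The increment vanishes unless x and \<open>x + y\<close> lie in different cubes. The term with the value at \<open>x + y\<close> is brought to the form
of the other one by the substitution of \<open>x + y\<close> for x, which replaces y by its negative.
\<close>

lemma shift_power_dyadic_step_le_jump:
  fixes u :: "real^'d \<Rightarrow> real"
  assumes u: "dyadic_step k u" and p: "0 < p"
  shows "shift_power p u y \<le> ennreal (2 * 2 powr p * (2 ^ k * (\<Sum>l\<in>UNIV. \<bar>y $ l\<bar>))) * Lp_power p u"
proof -
  note [measurable] = borel_dyadic_step[OF u]
  define V where "V z = (\<integral>\<^sup>+x. ennreal (\<bar>u x\<bar> powr p) * indicator {x. cell k (x + z) \<noteq> cell k x} x \<partial>lborel)" for z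
  have "shift_power p u y \<le> (\<integral>\<^sup>+x. ennreal (2 powr p) *
     (ennreal (\<bar>u (x + y)\<bar> powr p) * indicator {x. cell k (x + y) \<noteq> cell k x} x
       + ennreal (\<bar>u x\<bar> powr p) * indicator {x. cell k (x + y) \<noteq> cell k x} x) \<partial>lborel)"
    unfolding shift_power_def
  proof (rule nn_integral_mono)
    fix x
    have "\<bar>u (x + y) + - u x\<bar> powr p \<le> 2 powr p * (\<bar>u (x + y)\<bar> powr p + \<bar>- u x\<bar> powr p)"
      by (intro abs_add_powr_le assms)
    then have *: "ennreal (\<bar>u (x + y) - u x\<bar> powr p) \<le> ennreal (2 powr p) * (ennreal (\<bar>u (x + y)\<bar> powr p) + ennreal (\<bar>u x\<bar> powr p))"
      by (simp add: ennreal_plus[symmetric] ennreal_mult'[symmetric] del: ennreal_plus)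
    have **: "u (x + y) = u x" if "cell k (x + y) = cell k x" by (rule dstepD[OF u that])
    show "ennreal (\<bar>u (x + y) - u x\<bar> powr p) * indicator {x. x \<in> ucube \<and> x + y \<in> ucube} x
        \<le> ennreal (2 powr p) * (ennreal (\<bar>u (x + y)\<bar> powr p) * indicator {x. cell k (x + y) \<noteq> cell k x} x
       + ennreal (\<bar>u x\<bar> powr p) * indicator {x. cell k (x + y) \<noteq> cell k x} x)"
      using * ** p by (auto simp: indicator_def)
  qed
  also have "\<dots> = ennreal (2 powr p) * ((\<integral>\<^sup>+x. ennreal (\<bar>u (x + y)\<bar> powr p) * indicator {x. cell k (x + y) \<noteq> cell k x} x \<partial>lborel) + V y)"
    unfolding V_def by (subst nn_integral_cmult, measurable, subst nn_integral_add) auto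
  also have "(\<integral>\<^sup>+x. ennreal (\<bar>u (x + y)\<bar> powr p) * indicator {x. cell k (x + y) \<noteq> cell k x} x \<partial>lborel) = V (- y)"
  proof -
    have "(\<integral>\<^sup>+x. ennreal (\<bar>u (x + y)\<bar> powr p) * indicator {x. cell k (x + y) \<noteq> cell k x} x \<partial>lborel)
      = (\<integral>\<^sup>+x. (\<lambda>x. ennreal (\<bar>u x\<bar> powr p) * indicator {x. cell k (x + (- y)) \<noteq> cell k x} x) (x + y) \<partial>lborel)"
      by (intro nn_integral_cong) (auto simp: indicator_def)
    also have "\<dots> = V (- y)"
      unfolding V_def by (rule nn_integral_lborel_shift) measurable
    finally show ?thesis .
  qed
  also have "ennreal (2 powr p) * (V (- y) + V y)
     \<le> ennreal (2 powr p) * (ennreal (2 ^ k * (\<Sum>l\<in>UNIV. \<bar>y $ l\<bar>)) * Lp_power p u + ennreal (2 ^ k * (\<Sum>l\<in>UNIV. \<bar>y $ l\<bar>)) * Lp_power p u)"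
    using nn_integral_dyadic_step_jump_le[OF u p, of y] nn_integral_dyadic_step_jump_le[OF u p, of "- y"]
    unfolding V_def by (intro mult_left_mono add_mono) auto
  also have "\<dots> = ennreal (2 * 2 powr p * (2 ^ k * (\<Sum>l\<in>UNIV. \<bar>y $ l\<bar>))) * Lp_power p u"
    by (simp add: mult_2[symmetric] ennreal_mult' sum_nonneg mult_ac)
  finally show ?thesis .
qed

lemma shift_power_dyadic_step_le:
  fixes u :: "real^'d \<Rightarrow> real"
  assumes u: "dyadic_step k u" and p: "0 < p" and y: "norm y \<le> 2 powr (- real j)"
  shows "shift_power p u y \<le> ennreal (2 * 2 powr p * CARD('d) * min 1 (2 powr (real k - real j))) * Lp_power p u"
proof (cases "k < j")
  case True
  have "(\<Sum>l\<in>UNIV. \<bar>y $ l\<bar>) \<le> (\<Sum>l\<in>(UNIV::'d set). 2 powr (- real j))"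
    using y component_le_norm_cart[of y] by (intro sum_mono) (meson order_trans)
  then have "2 ^ k * (\<Sum>l\<in>UNIV. \<bar>y $ l\<bar>) \<le> 2 ^ k * (CARD('d) * 2 powr (- real j))"
    by (intro mult_left_mono) auto
  also have "\<dots> = CARD('d) * 2 powr (real k - real j)"
    by (simp add: powr_diff powr_minus powr_realpow field_simps)
  finally have "2 * 2 powr p * (2 ^ k * (\<Sum>l\<in>UNIV. \<bar>y $ l\<bar>)) \<le> 2 * 2 powr p * (CARD('d) * 2 powr (real k - real j))"
    by (intro mult_left_mono) auto
  moreover have "min 1 (2 powr (real k - real j)) = 2 powr (real k - real j)"
    using True powr_mono[of "real k - real j" 0 2] by (simp add: min_def)
  ultimately show ?thesis
    by (intro order_trans[OF shift_power_dyadic_step_le_jump[OF u p, of y]] mult_right_mono ennreal_leI) (simp_all add: mult_ac)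
next
  case False
  then have "min 1 (2 powr (real k - real j)) = (1::real)" by (simp add: min_def ge_one_powr_ge_zero)
  moreover have "2 * 2 powr p * 1 \<le> 2 * 2 powr p * real CARD('d)"
    by (intro mult_left_mono) (auto simp: Suc_leI)
  ultimately show ?thesis
    by (intro order_trans[OF shift_power_le_Lp_power[OF borel_dyadic_step[OF u] p, of y]] mult_right_mono ennreal_leI) simp_all
qed

lemma ucube_midpoint: "x \<in> ucube \<Longrightarrow> x + y \<in> ucube \<Longrightarrow> x + y /\<^sub>R 2 \<in> ucube"
  unfolding ucube_def mem_Collect_eq
proof (intro allI)
  fix l assume "\<forall>l. 0 \<le> x $ l \<and> x $ l < 1" "\<forall>l. 0 \<le> (x + y) $ l \<and> (x + y) $ l < 1"
  then have "0 \<le> x $ l" "x $ l < 1" "0 \<le> x $ l + y $ l" "x $ l + y $ l < 1" by auto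
  then show "0 \<le> (x + y /\<^sub>R 2) $ l \<and> (x + y /\<^sub>R 2) $ l < 1" by simp
qed

text \<open>
The increment is split at the midpoint, which lies in the cube by convexity.
\<close>

lemma shift_power_le_shift_power_half:
  fixes f :: "real^'d \<Rightarrow> real"
  assumes [measurable]: "f \<in> borel_measurable borel" and p: "0 < p"
  shows "shift_power p f y \<le> ennreal (2 * 2 powr p) * shift_power p f (y /\<^sub>R 2)"
proof -
  define h where "h = y /\<^sub>R 2"
  have yh: "x + y = (x + h) + h" for x by (simp add: h_def scaleR_left_distrib[symmetric] add.assoc)
  define F where "F x = ennreal (\<bar>f (x + h) - f x\<bar> powr p) * indicator {x. x \<in> ucube \<and> x + h \<in> ucube} x" for x
  have [measurable]: "F \<in> borel_measurable borel" unfolding F_def by measurable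
  have "shift_power p f y \<le> (\<integral>\<^sup>+x. ennreal (2 powr p) * (F (x + h) + F x) \<partial>lborel)"
    unfolding shift_power_def
  proof (rule nn_integral_mono)
    fix x
    have "\<bar>(f (x + y) - f (x + h)) + (f (x + h) - f x)\<bar> powr p
        \<le> 2 powr p * (\<bar>f (x + y) - f (x + h)\<bar> powr p + \<bar>f (x + h) - f x\<bar> powr p)"
      by (intro abs_add_powr_le p)
    then have "ennreal (\<bar>f (x + y) - f x\<bar> powr p)
        \<le> ennreal (2 powr p) * (ennreal (\<bar>f (x + y) - f (x + h)\<bar> powr p) + ennreal (\<bar>f (x + h) - f x\<bar> powr p))"
      by (simp add: ennreal_plus[symmetric] ennreal_mult'[symmetric] del: ennreal_plus)
    moreover have "x \<in> ucube \<Longrightarrow> x + y \<in> ucube \<Longrightarrow> x + h \<in> ucube"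
      unfolding h_def by (rule ucube_midpoint)
    ultimately show "ennreal (\<bar>f (x + y) - f x\<bar> powr p) * indicator {x. x \<in> ucube \<and> x + y \<in> ucube} x
        \<le> ennreal (2 powr p) * (F (x + h) + F x)"
      unfolding F_def yh by (auto simp: indicator_def)
  qed
  also have "\<dots> = ennreal (2 powr p) * ((\<integral>\<^sup>+x. F (x + h) \<partial>lborel) + (\<integral>\<^sup>+x. F x \<partial>lborel))"
    by (subst nn_integral_cmult, measurable, subst nn_integral_add) auto
  also have "(\<integral>\<^sup>+x. F (x + h) \<partial>lborel) = (\<integral>\<^sup>+x. F x \<partial>lborel)"
    by (rule nn_integral_lborel_shift) measurable
  also have "(\<integral>\<^sup>+x. F x \<partial>lborel) = shift_power p f h" by (simp add: F_def shift_power_def)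
  also have "ennreal (2 powr p) * (shift_power p f h + shift_power p f h) = ennreal (2 * 2 powr p) * shift_power p f h"
    by (simp add: mult_2[symmetric] ennreal_mult' mult_ac)
  finally show ?thesis by (simp add: h_def)
qed

text \<open>
This gives the doubling property of the modulus of smoothness: two points of one dyadic cube are at a distance that may exceed the
side length by a factor depending on the dimension.
\<close>

lemma shift_power_le_shift_power_dyadic_fraction:
  fixes f :: "real^'d \<Rightarrow> real"
  assumes "f \<in> borel_measurable borel" "0 < p"
  shows "shift_power p f y \<le> ennreal ((2 * 2 powr p) ^ m) * shift_power p f (y /\<^sub>R 2 ^ m)"
proof (induction m)
  case (Suc m)
  have "shift_power p f (y /\<^sub>R 2 ^ m) \<le> ennreal (2 * 2 powr p) * shift_power p f (y /\<^sub>R 2 ^ m /\<^sub>R 2)"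
    by (rule shift_power_le_shift_power_half[OF assms])
  then have "ennreal ((2 * 2 powr p) ^ m) * shift_power p f (y /\<^sub>R 2 ^ m)
      \<le> ennreal ((2 * 2 powr p) ^ m) * (ennreal (2 * 2 powr p) * shift_power p f (y /\<^sub>R 2 ^ m /\<^sub>R 2))"
    by (rule mult_left_mono) simp
  with Suc have "shift_power p f y \<le> ennreal ((2 * 2 powr p) ^ m) * (ennreal (2 * 2 powr p) * shift_power p f (y /\<^sub>R 2 ^ m /\<^sub>R 2))"
    by (rule order_trans)
  also have "\<dots> = ennreal ((2 * 2 powr p) ^ Suc m) * shift_power p f (y /\<^sub>R 2 ^ Suc m)"
    by (simp add: ennreal_mult' mult_ac)
  finally show ?case .
qed simp

section \<open>Approximation by step functions\<close>

text \<open>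
The constant is one of the values of f: if the p-th mean deviation of f from each value \<open>f y\<close> exceeded the average over
y of these deviations, then so would the average itself.
\<close>

lemma ex_const_approx_on_dyadic_cube:
  fixes f :: "real^'d \<Rightarrow> real"
  assumes [measurable]: "f \<in> borel_measurable borel"
  shows "\<exists>c. (\<integral>\<^sup>+x. ennreal (\<bar>f x - c\<bar> powr p) * indicator (dyadic_cube k m) x \<partial>lborel)
     \<le> ennreal ((2 ^ k) ^ CARD('d)) * (\<integral>\<^sup>+y. (\<integral>\<^sup>+x. ennreal (\<bar>f x - f y\<bar> powr p)
          * indicator (dyadic_cube k m) x \<partial>lborel) * indicator (dyadic_cube k m) y \<partial>lborel)"
proof (rule ccontr)
  define J where "J y = (\<integral>\<^sup>+x. ennreal (\<bar>f x - f y\<bar> powr p) * indicator (dyadic_cube k m) x \<partial>lborel)" for y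
  have [measurable]: "J \<in> borel_measurable borel"
    unfolding J_def by measurable
  define A where "A = (\<integral>\<^sup>+y. J y * indicator (dyadic_cube k m) y \<partial>lborel)"
  define B where "B = ennreal ((2 ^ k) ^ CARD('d)) * A"
  assume neg: "\<not> ?thesis"
  have less: "B < J y" for y
    using neg[unfolded not_ex not_le, rule_format, of "f y"] unfolding A_def B_def J_def .
  have Bfin: "B \<noteq> \<infinity>" using less[of 0] by auto
  have em: "emeasure lborel (dyadic_cube k m) = ennreal ((1 / 2 ^ k) ^ CARD('d))" by (rule emeasure_dyadic_cube)
  have I: "(\<integral>\<^sup>+y. B * indicator (dyadic_cube k m) y \<partial>lborel) = A"
  proof -
    have "ennreal ((2 ^ k) ^ CARD('d)) * ennreal ((1 / 2 ^ k) ^ CARD('d)) = 1"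
      by (simp add: ennreal_mult'[symmetric] power_one_over)
    moreover have "(\<integral>\<^sup>+y. B * indicator (dyadic_cube k m) y \<partial>lborel) = B * ennreal ((1 / 2 ^ k) ^ CARD('d))"
      by (simp add: nn_integral_cmult_indicator em)
    moreover have "B * ennreal ((1 / 2 ^ k) ^ CARD('d)) = (ennreal ((2 ^ k) ^ CARD('d)) * ennreal ((1 / 2 ^ k) ^ CARD('d))) * A"
      by (simp only: B_def mult_ac)
    ultimately show ?thesis by simp
  qed
  \<comment> \<open>The strict inequality survives integration because B is finite and the cube has positive measure.\<close>
  have "(\<integral>\<^sup>+y. B * indicator (dyadic_cube k m) y \<partial>lborel) < (\<integral>\<^sup>+y. J y * indicator (dyadic_cube k m) y \<partial>lborel)"
  proof (rule nn_integral_less)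
    show "(\<integral>\<^sup>+y. B * indicator (dyadic_cube k m) y \<partial>lborel) \<noteq> \<infinity>"
      using Bfin by (simp add: nn_integral_cmult_indicator em ennreal_mult_eq_top_iff)
    show "AE y in lborel. B * indicator (dyadic_cube k m) y \<le> J y * indicator (dyadic_cube k m) y"
      using less by (auto simp: indicator_def less_imp_le)
    show "\<not> (AE y in lborel. J y * indicator (dyadic_cube k m) y \<le> B * indicator (dyadic_cube k m) y)"
    proof
      assume "AE y in lborel. J y * indicator (dyadic_cube k m) y \<le> B * indicator (dyadic_cube k m) y"
      then have "AE y in lborel. y \<notin> dyadic_cube k m"
        by eventually_elim (use less in \<open>auto simp: indicator_def not_le[symmetric]\<close>)
      then have "emeasure lborel (dyadic_cube k m) = 0"
        by (subst (asm) AE_iff_measurable[OF _ refl]) auto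
      then show False by (simp add: em)
    qed
  qed measurable
  then show False using I by (simp add: A_def)
qed

lemma sum_indicator_dyadic_cube_mult:
  "(\<Sum>m\<in>cells k. indicator (dyadic_cube k m) x * indicator (dyadic_cube k m) y)
    = (indicator {x. x \<in> ucube \<and> y \<in> ucube \<and> cell k x = cell k y} x :: ennreal)"
proof -
  have "(\<Sum>m\<in>cells k. indicator (dyadic_cube k m) x * indicator (dyadic_cube k m) y)
      = (\<Sum>m\<in>cells k. indicator (dyadic_cube k m) x * (if cell k x = cell k y then 1 else 0 :: ennreal))"
    by (intro sum.cong) (auto simp: dyadic_cube_def indicator_def)
  also have "\<dots> = indicator ucube x * (if cell k x = cell k y then 1 else 0)"
    by (simp add: indicator_ucube_sum[of _ k] sum_distrib_right)
  also have "\<dots> = indicator {x. x \<in> ucube \<and> y \<in> ucube \<and> cell k x = cell k y} x"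
    by (auto simp: indicator_def mem_ucube_iff[of _ k])
  finally show ?thesis .
qed

text \<open>
Summing the local estimates leaves the double integral of \<open>\<bar>f x - f y\<bar> powr p\<close> over pairs in a common cube. With \<open>x = z + y\<close>
the coordinates of z are at most the side length in absolute value, and by Fubini the double integral is at most an
integral of shift powers over a cube of twice the side length.
\<close>

lemma ex_dyadic_step_approx:
  fixes f :: "real^'d \<Rightarrow> real"
  assumes [measurable]: "f \<in> borel_measurable borel"
    and W: "\<And>z. (\<And>l. \<bar>z $ l\<bar> \<le> 1 / 2 ^ k) \<Longrightarrow> shift_power p f z \<le> ennreal T"
  shows "\<exists>u. dyadic_step k u \<and> (\<integral>\<^sup>+x. ennreal (\<bar>f x - u x\<bar> powr p) * indicator ucube x \<partial>lborel)
      \<le> ennreal (2 ^ CARD('d)) * ennreal T"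
proof -
  let ?N = "ennreal ((2 ^ k) ^ CARD('d))"
  have ex: "\<forall>m. \<exists>c. (\<integral>\<^sup>+x. ennreal (\<bar>f x - c\<bar> powr p) * indicator (dyadic_cube k m) x \<partial>lborel)
     \<le> ?N * (\<integral>\<^sup>+y. (\<integral>\<^sup>+x. ennreal (\<bar>f x - f y\<bar> powr p)
          * indicator (dyadic_cube k m) x \<partial>lborel) * indicator (dyadic_cube k m) y \<partial>lborel)"
    using ex_const_approx_on_dyadic_cube[of f p k] by simp
  from choice[OF ex] obtain c where c': "\<forall>m. (\<integral>\<^sup>+x. ennreal (\<bar>f x - c m\<bar> powr p) * indicator (dyadic_cube k m) x \<partial>lborel)
     \<le> ?N * (\<integral>\<^sup>+y. (\<integral>\<^sup>+x. ennreal (\<bar>f x - f y\<bar> powr p)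
          * indicator (dyadic_cube k m) x \<partial>lborel) * indicator (dyadic_cube k m) y \<partial>lborel)"
    by (rule exE)
  note c = c'[rule_format]
  define u where "u x = (if x \<in> ucube then c (cell k x) else 0)" for x
  have u: "dyadic_step k u"
    by (rule dstepI) (auto simp: u_def mem_ucube_iff[of _ k])
  note [measurable] = borel_dyadic_step[OF u]
  define C :: "(real^'d) set" where "C = cbox (\<chi> l. - (1 / 2 ^ k)) (\<chi> l. 1 / 2 ^ k)"
  have C: "z \<in> C \<longleftrightarrow> (\<forall>l. \<bar>z $ l\<bar> \<le> 1 / 2 ^ k)" for z
    by (auto simp: C_def mem_box_cart abs_le_iff minus_le_iff)
  have [measurable]: "C \<in> sets borel" by (simp add: C_def)
  have emC: "emeasure lborel C = ennreal ((2 / 2 ^ k) ^ CARD('d))"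
    unfolding C_def by (subst emeasure_lborel_cbox_cart) auto
  have near: "z \<in> C" if "cell k (y + z) = cell k y" for z y
  proof -
    have "\<bar>z $ l\<bar> \<le> 1 / 2 ^ k" for l
    proof -
      have "\<lfloor>2 ^ k * (z $ l + y $ l)\<rfloor> = \<lfloor>2 ^ k * y $ l\<rfloor>"
        using fun_cong[OF that, of l] by (simp add: cell_def add.commute)
      then have "\<bar>2 ^ k * (z $ l + y $ l) - 2 ^ k * y $ l\<bar> \<le> 1" by linarith
      then have "2 ^ k * \<bar>z $ l\<bar> \<le> 1" by (simp add: algebra_simps abs_mult)
      then show ?thesis by (simp add: field_simps)
    qed
    then show ?thesis by (simp add: C)
  qed
  have "(\<integral>\<^sup>+x. ennreal (\<bar>f x - u x\<bar> powr p) * indicator ucube x \<partial>lborel)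
      = (\<Sum>m\<in>cells k. \<integral>\<^sup>+x. ennreal (\<bar>f x - u x\<bar> powr p) * indicator (dyadic_cube k m) x \<partial>lborel)"
    by (rule nn_integral_ucube_cells) measurable
  also have "\<dots> = (\<Sum>m\<in>cells k. \<integral>\<^sup>+x. ennreal (\<bar>f x - c m\<bar> powr p) * indicator (dyadic_cube k m) x \<partial>lborel)"
    using dyadic_cube_subset_ucube[where 'a='d] by (intro sum.cong refl nn_integral_cong) (auto simp: u_def dyadic_cube_def indicator_def)
  also have "\<dots> \<le> (\<Sum>m\<in>cells k. ?N * (\<integral>\<^sup>+y. (\<integral>\<^sup>+x. ennreal (\<bar>f x - f y\<bar> powr p)
          * indicator (dyadic_cube k m) x \<partial>lborel) * indicator (dyadic_cube k m) y \<partial>lborel))"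
    by (intro sum_mono c)
  also have "\<dots> = ?N * (\<integral>\<^sup>+y. (\<Sum>m\<in>cells k. (\<integral>\<^sup>+x. ennreal (\<bar>f x - f y\<bar> powr p)
          * indicator (dyadic_cube k m) x \<partial>lborel) * indicator (dyadic_cube k m) y) \<partial>lborel)"
    by (subst nn_integral_sum) (measurable, simp only: sum_distrib_left)
  also have "(\<integral>\<^sup>+y. (\<Sum>m\<in>cells k. (\<integral>\<^sup>+x. ennreal (\<bar>f x - f y\<bar> powr p)
          * indicator (dyadic_cube k m) x \<partial>lborel) * indicator (dyadic_cube k m) y) \<partial>lborel)
      = (\<integral>\<^sup>+y. (\<integral>\<^sup>+x. ennreal (\<bar>f x - f y\<bar> powr p)
          * indicator {x. x \<in> ucube \<and> y \<in> ucube \<and> cell k x = cell k y} x \<partial>lborel) \<partial>lborel)"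
  proof (rule nn_integral_cong)
    fix y
    have "(\<Sum>m\<in>cells k. (\<integral>\<^sup>+x. ennreal (\<bar>f x - f y\<bar> powr p) * indicator (dyadic_cube k m) x \<partial>lborel) * indicator (dyadic_cube k m) y)
       = (\<integral>\<^sup>+x. (\<Sum>m\<in>cells k. ennreal (\<bar>f x - f y\<bar> powr p) * indicator (dyadic_cube k m) x * indicator (dyadic_cube k m) y) \<partial>lborel)"
      by (subst nn_integral_sum, measurable) (intro sum.cong refl nn_integral_multc[symmetric], measurable)
    also have "\<dots> = (\<integral>\<^sup>+x. ennreal (\<bar>f x - f y\<bar> powr p)
          * indicator {x. x \<in> ucube \<and> y \<in> ucube \<and> cell k x = cell k y} x \<partial>lborel)"
      by (simp only: mult.assoc sum_distrib_left[symmetric] sum_indicator_dyadic_cube_mult)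
    finally show "(\<Sum>m\<in>cells k. (\<integral>\<^sup>+x. ennreal (\<bar>f x - f y\<bar> powr p) * indicator (dyadic_cube k m) x \<partial>lborel) * indicator (dyadic_cube k m) y)
       = (\<integral>\<^sup>+x. ennreal (\<bar>f x - f y\<bar> powr p)
          * indicator {x. x \<in> ucube \<and> y \<in> ucube \<and> cell k x = cell k y} x \<partial>lborel)" .
  qed
  also have "\<dots> = (\<integral>\<^sup>+y. (\<integral>\<^sup>+z. ennreal (\<bar>f (z + y) - f y\<bar> powr p)
          * indicator {x. x \<in> ucube \<and> y \<in> ucube \<and> cell k x = cell k y} (z + y) \<partial>lborel) \<partial>lborel)"
    by (intro nn_integral_cong nn_integral_lborel_shift[symmetric]) measurable
  also have "\<dots> \<le> (\<integral>\<^sup>+y. (\<integral>\<^sup>+z. ennreal (\<bar>f (y + z) - f y\<bar> powr p)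
          * indicator {x. x \<in> ucube \<and> x + z \<in> ucube} y * indicator C z \<partial>lborel) \<partial>lborel)"
    using near by (intro nn_integral_mono) (auto simp: indicator_def add.commute[of _ "_ :: real^'d"])
  also have "\<dots> = (\<integral>\<^sup>+z. (\<integral>\<^sup>+y. ennreal (\<bar>f (y + z) - f y\<bar> powr p)
          * indicator {x. x \<in> ucube \<and> x + z \<in> ucube} y * indicator C z \<partial>lborel) \<partial>lborel)"
    by (rule lborel_pair.Fubini') measurable
  also have "\<dots> = (\<integral>\<^sup>+z. shift_power p f z * indicator C z \<partial>lborel)"
    unfolding shift_power_def by (intro nn_integral_cong nn_integral_multc) measurable
  also have "\<dots> \<le> (\<integral>\<^sup>+z. ennreal T * indicator C z \<partial>lborel)"
    using W by (intro nn_integral_mono) (auto simp: indicator_def C)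
  also have "\<dots> = ennreal T * ennreal ((2 / 2 ^ k) ^ CARD('d))"
    by (simp add: nn_integral_cmult_indicator emC)
  finally have "(\<integral>\<^sup>+x. ennreal (\<bar>f x - u x\<bar> powr p) * indicator ucube x \<partial>lborel)
      \<le> ?N * (ennreal T * ennreal ((2 / 2 ^ k) ^ CARD('d)))"
    by (simp add: mult_left_mono)
  also have "\<dots> = (?N * ennreal ((2 / 2 ^ k) ^ CARD('d))) * ennreal T"
    by (simp only: mult_ac)
  also have "?N * ennreal ((2 / 2 ^ k) ^ CARD('d)) = ennreal (2 ^ CARD('d))"
    by (subst ennreal_mult'[symmetric]) (auto simp: power_mult_distrib[symmetric])
  finally show ?thesis using u by blast
qed

section \<open>Local integral bounds for step functions\<close>

lemma LINT_cells:
  fixes g :: "('d::finite \<Rightarrow> int) \<Rightarrow> real"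
  assumes "finite A"
  shows "integrable lborel (\<lambda>x::real^'d. g (cell k x) * indicator {x. cell k x \<in> A} x)"
    and "(LINT x|lborel. g (cell k (x::real^'d)) * indicator {x. cell k x \<in> A} x) = (\<Sum>m\<in>A. g m * (1 / 2 ^ k) ^ CARD('d))"
proof -
  have eq: "g (cell k x) * indicator {x. cell k x \<in> A} x = (\<Sum>m\<in>A. g m * indicator (dyadic_cube k m) x)" for x :: "real^'d"
  proof -
    have "(\<Sum>m\<in>A. g m * indicator (dyadic_cube k m) x) = (\<Sum>m\<in>A. if m = cell k x then g m else 0)"
      by (intro sum.cong) (auto simp: dyadic_cube_def indicator_def)
    then show ?thesis using assms by (simp add: indicator_def)
  qed
  have I: "integrable lborel (\<lambda>x::real^'d. g m * indicator (dyadic_cube k m) x)" for m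
    by (intro integrable_mult_right integrable_real_indicator) (auto simp: emeasure_dyadic_cube)
  show "integrable lborel (\<lambda>x::real^'d. g (cell k x) * indicator {x. cell k x \<in> A} x)"
    unfolding eq by (intro Bochner_Integration.integrable_sum I)
  show "(LINT x|lborel. g (cell k (x::real^'d)) * indicator {x. cell k x \<in> A} x) = (\<Sum>m\<in>A. g m * (1 / 2 ^ k) ^ CARD('d))"
    unfolding eq by (subst Bochner_Integration.integral_sum[OF I]) (simp add: measure_def emeasure_dyadic_cube)
qed

lemma integrable_dyadic_step_powr:
  fixes u :: "real^'d \<Rightarrow> real"
  assumes u: "dyadic_step k u" and r: "0 < r"
  shows "integrable lborel (\<lambda>x. \<bar>u x\<bar> powr r)"
proof -
  have "(\<lambda>x. \<bar>u x\<bar> powr r) = (\<lambda>x. \<bar>step_value k u (cell k x)\<bar> powr r * indicator {x. cell k x \<in> cells k} x)"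
    using dyadic_step_outside[OF u] dyadic_step_eq_step_value[OF u] r by (auto simp: fun_eq_iff indicator_def mem_ucube_iff[of _ k])
  then show ?thesis using LINT_cells(1)[OF finite_cells, of "\<lambda>m. \<bar>step_value k u m\<bar> powr r" k k] by simp
qed

lemma integrable_dyadic_step:
  assumes "dyadic_step k u"
  shows "integrable lborel u"
proof -
  have "integrable lborel (\<lambda>x. norm (u x))"
    using integrable_dyadic_step_powr[OF assms, of 1] by simp
  then show ?thesis
    by (rule integrable_norm_cancel) (use borel_dyadic_step[OF assms] in simp)
qed

lemma Lp_power_dyadic_step_real:
  fixes u :: "real^'d \<Rightarrow> real"
  assumes u: "dyadic_step k u" and r: "0 < r"
  shows "Lp_power r u = ennreal (LINT x|lborel. \<bar>u x\<bar> powr r)"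
  unfolding Lp_power_def by (rule nn_integral_eq_integral[OF integrable_dyadic_step_powr[OF u r]]) (rule AE_I2, simp)

text \<open>
On one cube of level j the integrals of \<open>\<bar>u\<bar>\<close> and of \<open>\<bar>u\<bar> powr p\<close> are finite sums with \<open>2 ^ ((k - j) * d)\<close> terms of equal weight,
and are compared by \<open>sum_powr_le\<close>.
\<close>

lemma sum_local_L1_powr_le:
  fixes u :: "real^'d \<Rightarrow> real" and p :: real
  assumes u: "dyadic_step k u" and jk: "j \<le> k" and p: "0 < p"
  shows "(\<Sum>n\<in>cells j. (LINT x|lborel. \<bar>u x\<bar> * indicator (dyadic_cube j n) x) powr p)
    \<le> 2 powr (CARD('d) * (real (k - j) * max (p - 1) 0 - k * (p - 1))) * (LINT x|lborel. \<bar>u x\<bar> powr p)"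
proof -
  define K where "K = 2 powr (CARD('d) * (real (k - j) * max (p - 1) 0 - k * (p - 1)))"
  have K: "K = (2 ^ ((k - j) * CARD('d))) powr max (p - 1) 0 * ((1 / 2 ^ k) ^ CARD('d)) powr (p - 1)"
  proof -
    have "(2::real) ^ ((k - j) * CARD('d)) = 2 powr (real (k - j) * CARD('d))"
      by (simp add: powr_realpow[symmetric])
    moreover have "(1 / 2 ^ k :: real) ^ CARD('d) = 2 powr (- (real k * CARD('d)))"
      by (simp add: powr_minus powr_realpow[symmetric] powr_powr power_one_over power_mult[symmetric] field_simps)
    ultimately show ?thesis
      by (simp add: K_def powr_powr powr_add[symmetric] algebra_simps)
  qed
  define A where "A n = {m. \<forall>l. m l div 2 ^ (k - j) = n l}" for n :: "'d \<Rightarrow> int"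
  have A: "finite (A n)" "card (A n) = 2 ^ ((k - j) * CARD('d))" for n
    using card_subcells[of "k - j" n] by (auto simp: A_def)
  have inA: "x \<in> dyadic_cube j n \<longleftrightarrow> cell k x \<in> A n" for x n
    using cell_div[of j x _ "k - j"] jk by (auto simp: A_def dyadic_cube_def fun_eq_iff)
  have I: "(LINT x|lborel. \<bar>u x\<bar> powr r * indicator (dyadic_cube j n) x) = (\<Sum>m\<in>A n. \<bar>step_value k u m\<bar> powr r * (1 / 2 ^ k) ^ CARD('d))"
    for r n
  proof -
    have "(\<lambda>x. \<bar>u x\<bar> powr r * indicator (dyadic_cube j n) x) = (\<lambda>x. \<bar>step_value k u (cell k x)\<bar> powr r * indicator {x. cell k x \<in> A n} x)"
      using dyadic_step_eq_step_value[OF u] by (auto simp: fun_eq_iff indicator_def inA)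
    then show ?thesis using LINT_cells(2)[OF A(1), of "\<lambda>m. \<bar>step_value k u m\<bar> powr r" k n] by simp
  qed
  have step: "(LINT x|lborel. \<bar>u x\<bar> * indicator (dyadic_cube j n) x) powr p
      \<le> K * (LINT x|lborel. \<bar>u x\<bar> powr p * indicator (dyadic_cube j n) x)" for n
  proof -
    define w :: real where "w = (1 / 2 ^ k) ^ CARD('d)"
    have w: "0 < w" by (simp add: w_def)
    have "(LINT x|lborel. \<bar>u x\<bar> * indicator (dyadic_cube j n) x) = w * (\<Sum>m\<in>A n. \<bar>step_value k u m\<bar>)"
      using I[of 1 n] by (simp add: w_def sum_distrib_right mult.commute)
    then have "(LINT x|lborel. \<bar>u x\<bar> * indicator (dyadic_cube j n) x) powr p = w powr p * (\<Sum>m\<in>A n. \<bar>step_value k u m\<bar>) powr p"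
      using w by (simp add: powr_mult sum_nonneg)
    also have "\<dots> \<le> w powr p * (real (card (A n)) powr max (p - 1) 0 * (\<Sum>m\<in>A n. \<bar>step_value k u m\<bar> powr p))"
      using A p by (intro mult_left_mono sum_powr_le) auto
    also have "w powr p = w powr (p - 1) * w" using w by (simp add: powr_mult_base mult.commute)
    finally have "(LINT x|lborel. \<bar>u x\<bar> * indicator (dyadic_cube j n) x) powr p
        \<le> w powr (p - 1) * w * (real (card (A n)) powr max (p - 1) 0 * (\<Sum>m\<in>A n. \<bar>step_value k u m\<bar> powr p))" .
    moreover have "(LINT x|lborel. \<bar>u x\<bar> powr p * indicator (dyadic_cube j n) x) = w * (\<Sum>m\<in>A n. \<bar>step_value k u m\<bar> powr p)"
      unfolding I w_def[symmetric] by (simp add: sum_distrib_left mult.commute)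
    ultimately show ?thesis
      unfolding K w_def[symmetric] by (simp add: A mult_ac)
  qed
  have "(\<Sum>n\<in>cells j. (LINT x|lborel. \<bar>u x\<bar> * indicator (dyadic_cube j n) x) powr p)
     \<le> (\<Sum>n\<in>cells j. K * (LINT x|lborel. \<bar>u x\<bar> powr p * indicator (dyadic_cube j n) x))"
    by (intro sum_mono step)
  also have "\<dots> = K * (LINT x|lborel. (\<Sum>n\<in>cells j. \<bar>u x\<bar> powr p * indicator (dyadic_cube j n) x))"
    using integrable_dyadic_step_powr[OF u p]
    by (subst Bochner_Integration.integral_sum) (auto simp: sum_distrib_left intro!: integrable_real_mult_indicator)
  also have "(\<lambda>x. \<Sum>n\<in>cells j. \<bar>u x\<bar> powr p * indicator (dyadic_cube j n) x) = (\<lambda>x. \<bar>u x\<bar> powr p)"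
    unfolding sum_distrib_left[symmetric] indicator_ucube_sum[of _ j, symmetric]
    using dyadic_step_outside[OF u] p by (auto simp: fun_eq_iff indicator_def)
  finally show ?thesis by (simp add: K_def)
qed

lemma L1_powr_le:
  fixes u :: "real^'d \<Rightarrow> real" and p :: real
  assumes u: "dyadic_step k u" and p: "0 < p"
  shows "(LINT x|lborel. \<bar>u x\<bar>) powr p \<le> 2 powr (k * (CARD('d) * max (1 - p) 0)) * (LINT x|lborel. \<bar>u x\<bar> powr p)"
proof -
  have "(\<lambda>x. \<bar>u x\<bar> * indicator ucube x) = (\<lambda>x. \<bar>u x\<bar>)"
    using dyadic_step_outside[OF u] by (auto simp: fun_eq_iff indicator_def)
  moreover have "real (k - 0) * max (p - 1) 0 - k * (p - 1) = k * max (1 - p) 0"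
    by (simp add: max_def algebra_simps)
  ultimately show ?thesis
    using sum_local_L1_powr_le[OF u _ p, of 0] by (simp add: cells_0 dyadic_cube_0 mult_ac)
qed

section \<open>Borel representatives and the modulus of smoothness\<close>

text \<open>
Functions in the Besov space are measurable with respect to the completed measure only. A Borel measurable representative
that vanishes off the half-open cube allows translations and Fubini's theorem to be used with \<open>lborel\<close>.
\<close>

definition borel_rep :: "(real^'d \<Rightarrow> real) \<Rightarrow> (real^'d \<Rightarrow> real) \<Rightarrow> bool"
  where "borel_rep f g \<longleftrightarrow> g \<in> borel_measurable borel \<and> (\<forall>x. x \<notin> ucube \<longrightarrow> g x = 0) \<and>
    (AE x in lebesgue_on unit_cube. f x = g x)"

lemma AE_lborel_shift:
  fixes y :: "'a::euclidean_space"
  assumes "AE x in lborel. P x"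
  shows "AE x in lborel. P (x + y)"
proof -
  obtain N where N: "{x \<in> space lborel. \<not> P x} \<subseteq> N" "emeasure lborel N = 0" "N \<in> sets lborel"
    using assms by (rule AE_E)
  have "AE x in distr lborel borel ((+) y). x \<notin> N"
    unfolding lborel_distr_plus using N by (intro AE_I[of _ _ N]) auto
  then have "AE x in lborel. y + x \<notin> N"
    using N by (subst (asm) AE_distr_iff) auto
  then show ?thesis
    by eventually_elim (use N in \<open>auto simp: add.commute\<close>)
qed

lemma AE_unit_cube_lborel:
  fixes P :: "real^'d \<Rightarrow> bool"
  shows "(AE x in lebesgue_on unit_cube. P x) \<longleftrightarrow> (AE x in lborel. x \<in> ucube \<longrightarrow> P x)"
proof -
  have "(AE x in lebesgue_on unit_cube. P x) \<longleftrightarrow> (AE x in lborel. x \<in> unit_cube \<longrightarrow> P x)"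
    by (simp add: AE_restrict_space_iff AE_completion_iff)
  also have "\<dots> \<longleftrightarrow> (AE x in lborel. x \<in> ucube \<longrightarrow> P x)"
  proof
    assume "AE x in lborel. x \<in> unit_cube \<longrightarrow> P x"
    then show "AE x in lborel. x \<in> ucube \<longrightarrow> P x" using AE_unit_cube_iff by eventually_elim auto
  next
    assume "AE x in lborel. x \<in> ucube \<longrightarrow> P x"
    then show "AE x in lborel. x \<in> unit_cube \<longrightarrow> P x" using AE_unit_cube_iff by eventually_elim auto
  qed
  finally show ?thesis .
qed

lemma ex_borel_rep:
  fixes f :: "real^'d \<Rightarrow> real"
  assumes "f \<in> borel_measurable (lebesgue_on unit_cube)"
  shows "\<exists>g. borel_rep f g"
proof -
  have "(\<lambda>x. if x \<in> unit_cube then f x else 0) \<in> borel_measurable lebesgue"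
    using assms by (subst borel_measurable_if) auto
  then obtain g where g: "g \<in> borel_measurable lborel" "AE x in lborel. (if x \<in> unit_cube then f x else 0) = g x"
    using completion_ex_borel_measurable_real by blast
  have [measurable]: "g \<in> borel_measurable borel" using g(1) by simp
  have "AE x in lborel. x \<in> ucube \<longrightarrow> f x = g x * indicator ucube x"
    using g(2) AE_unit_cube_iff by eventually_elim (auto split: if_splits)
  then have "borel_rep f (\<lambda>x. g x * indicator ucube x)"
    unfolding borel_rep_def AE_unit_cube_lborel by auto
  then show ?thesis by blast
qed

lemma borel_rep_AE_iff:
  assumes "borel_rep f f'" "borel_rep g g'"
  shows "(AE x in lebesgue_on unit_cube. f x = g x) \<longleftrightarrow> (AE x in lborel. f' x = g' x)"
proof
  have A: "AE x in lborel. x \<in> ucube \<longrightarrow> f x = f' x" "AE x in lborel. x \<in> ucube \<longrightarrow> g x = g' x"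
    and B: "\<And>x. x \<notin> ucube \<Longrightarrow> f' x = 0" "\<And>x. x \<notin> ucube \<Longrightarrow> g' x = 0"
    using assms by (auto simp: borel_rep_def AE_unit_cube_lborel)
  show "AE x in lborel. f' x = g' x" if "AE x in lebesgue_on unit_cube. f x = g x"
    using that[unfolded AE_unit_cube_lborel] A by eventually_elim (metis B)
  show "AE x in lebesgue_on unit_cube. f x = g x" if "AE x in lborel. f' x = g' x"
    using that A unfolding AE_unit_cube_lborel by eventually_elim auto
qed

lemma borel_rep_cong:
  assumes "borel_rep f f'" "AE x in lebesgue_on unit_cube. g x = f x"
  shows "borel_rep g f'"
proof -
  have "AE x in lebesgue_on unit_cube. f x = f' x"
    using assms(1) by (simp add: borel_rep_def)
  with assms(2) have "AE x in lebesgue_on unit_cube. g x = f' x"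
    by eventually_elim simp
  then show ?thesis using assms(1) by (simp add: borel_rep_def)
qed

lemma borel_rep_self:
  assumes "g \<in> borel_measurable borel" "\<And>x. x \<notin> ucube \<Longrightarrow> g x = 0"
  shows "borel_rep g g"
  using assms by (auto simp: borel_rep_def)

lemma borel_rep_lincomb:
  assumes "borel_rep f f'" "borel_rep g g'"
  shows "borel_rep (\<lambda>x. a * f x + b * g x) (\<lambda>x. a * f' x + b * g' x)"
proof -
  have "AE x in lebesgue_on unit_cube. f x = f' x" "AE x in lebesgue_on unit_cube. g x = g' x"
    using assms by (auto simp: borel_rep_def)
  then have "AE x in lebesgue_on unit_cube. a * f x + b * g x = a * f' x + b * g' x"
    by eventually_elim simp
  then show ?thesis using assms by (auto simp: borel_rep_def)
qed

text \<open>
Functionals of the form \<open>\<integral> \<phi> x (f x)\<close> may be computed from the representative; this covers p-th powers as well as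
integrals against a Haar function.
\<close>

lemma borel_rep_LINT:
  fixes f :: "real^'d \<Rightarrow> real" and \<phi> :: "real^'d \<Rightarrow> real \<Rightarrow> real"
  assumes r: "borel_rep f f'"
    and \<phi>: "(\<lambda>x. \<phi> x (f' x)) \<in> borel_measurable borel" "\<And>x. x \<notin> ucube \<Longrightarrow> \<phi> x 0 = 0"
  shows "(\<lambda>x. \<phi> x (f x)) \<in> borel_measurable (lebesgue_on unit_cube)"
    and "(LINT x|lebesgue_on unit_cube. \<phi> x (f x)) = (LINT x|lborel. \<phi> x (f' x))"
    and "integrable (lebesgue_on unit_cube) (\<lambda>x. \<phi> x (f x)) \<longleftrightarrow> integrable lborel (\<lambda>x. \<phi> x (f' x))"
proof -
  let ?F = "\<lambda>x. indicator unit_cube x *\<^sub>R \<phi> x (f x)" and ?G = "\<lambda>x. \<phi> x (f' x)"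
  have out: "\<phi> x (f' x) = 0" if "x \<notin> ucube" for x
    using r that \<phi>(2) by (auto simp: borel_rep_def)
  have "AE x in lborel. x \<in> ucube \<longrightarrow> f x = f' x"
    using r by (simp add: borel_rep_def AE_unit_cube_lborel)
  then have ae': "AE x in lborel. ?G x = ?F x"
    using AE_unit_cube_iff by eventually_elim (auto simp: indicator_def out)
  then have ae: "AE x in lebesgue. ?G x = ?F x" by (simp add: AE_completion_iff)
  have G: "?G \<in> borel_measurable lebesgue" using \<phi>(1) by (simp add: measurable_completion)
  have F: "?F \<in> borel_measurable lebesgue" by (rule borel_measurable_AE[OF G ae])
  then show m: "(\<lambda>x. \<phi> x (f x)) \<in> borel_measurable (lebesgue_on unit_cube)"
    by (subst borel_measurable_restrict_space_iff) (simp_all add: mult.commute)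
  have "(LINT x|lebesgue_on unit_cube. \<phi> x (f x)) = (LINT x|lebesgue. ?F x)"
    by (rule integral_restrict_space) simp
  also have "\<dots> = (LINT x|lebesgue. ?G x)"
    by (rule integral_cong_AE) (use F G ae in \<open>auto elim: AE_mp\<close>)
  also have "\<dots> = (LINT x|lborel. ?G x)"
    using \<phi>(1) by (intro integral_completion) simp
  finally show "(LINT x|lebesgue_on unit_cube. \<phi> x (f x)) = (LINT x|lborel. \<phi> x (f' x))" .
  have "integrable (lebesgue_on unit_cube) (\<lambda>x. \<phi> x (f x)) \<longleftrightarrow> integrable lebesgue ?F"
    by (rule integrable_restrict_space) simp
  also have "\<dots> \<longleftrightarrow> integrable lebesgue ?G"
    by (rule integrable_cong_AE) (use F G ae in \<open>auto elim: AE_mp\<close>)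
  also have "\<dots> \<longleftrightarrow> integrable lborel ?G"
    using \<phi>(1) by (intro integrable_completion) simp
  finally show "integrable (lebesgue_on unit_cube) (\<lambda>x. \<phi> x (f x)) \<longleftrightarrow> integrable lborel (\<lambda>x. \<phi> x (f' x))" .
qed

lemma borel_rep_Lp_space:
  fixes f :: "real^'d \<Rightarrow> real"
  assumes r: "borel_rep f f'" and p: "0 < p"
  shows "f \<in> Lp_space p unit_cube \<longleftrightarrow> Lp_power p f' < \<infinity>"
    and "Lp_norm p unit_cube f = enn2real (Lp_power p f') powr (1 / p)"
proof -
  have [measurable]: "f' \<in> borel_measurable borel" using r by (simp add: borel_rep_def)
  note L = borel_rep_LINT[OF r, of "\<lambda>x v. \<bar>v\<bar> powr p"]
  have "f \<in> borel_measurable (lebesgue_on unit_cube)"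
    using borel_rep_LINT(1)[OF r, of "\<lambda>x v. v"] by simp
  then show "f \<in> Lp_space p unit_cube \<longleftrightarrow> Lp_power p f' < \<infinity>"
    using L(3) by (simp add: Lp_space_def Lp_power_def integrable_iff_bounded)
  show "Lp_norm p unit_cube f = enn2real (Lp_power p f') powr (1 / p)"
    using L(2) by (simp add: Lp_norm_def Lp_power_def integral_eq_nn_integral)
qed

lemma borel_rep_Lp_norm_shift:
  fixes f :: "real^'d \<Rightarrow> real"
  assumes r: "borel_rep f f'" and p: "0 < p"
  shows "Lp_norm p (shifted_cube y) (\<lambda>x. f (x + y) - f x) = enn2real (shift_power p f' y) powr (1 / p)"
proof -
  have [measurable]: "f' \<in> borel_measurable borel" using r by (simp add: borel_rep_def)
  have scl [measurable]: "shifted_cube y \<in> sets borel" for y :: "real^'d"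
  proof -
    have minus_le_iff_add_nonneg: "- y $ i \<le> x $ i \<longleftrightarrow> 0 \<le> x $ i + y $ i" for x i by linarith
    have "shifted_cube y = unit_cube \<inter> cbox (- y) (1 - y)"
      by (auto simp: minus_le_iff_add_nonneg shifted_cube_def mem_box_cart le_diff_eq)
    then show ?thesis by simp
  qed
  let ?F = "\<lambda>x. indicator (shifted_cube y) x *\<^sub>R (\<bar>f (x + y) - f x\<bar> powr p)"
  let ?G = "\<lambda>x. \<bar>f' (x + y) - f' x\<bar> powr p * indicator {x. x \<in> ucube \<and> x + y \<in> ucube} x"
  have r1: "AE x in lborel. x \<in> ucube \<longrightarrow> f x = f' x"
    using r by (simp add: borel_rep_def AE_unit_cube_lborel)
  have "AE x in lborel. ?G x = ?F x"
    using r1 AE_lborel_shift[OF r1, of y] AE_unit_cube_iff AE_lborel_shift[OF AE_unit_cube_iff, of y]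
    by eventually_elim (auto simp: indicator_def shifted_cube_def)
  then have ae: "AE x in lebesgue. ?G x = ?F x" by (simp add: AE_completion_iff)
  have G: "?G \<in> borel_measurable lborel" by measurable
  then have G': "?G \<in> borel_measurable lebesgue" by (rule measurable_completion)
  have F: "?F \<in> borel_measurable lebesgue" by (rule borel_measurable_AE[OF G' ae])
  have "(LINT x|lebesgue_on (shifted_cube y). \<bar>f (x + y) - f x\<bar> powr p) = (LINT x|lebesgue. ?F x)"
    by (rule integral_restrict_space) simp
  also have "\<dots> = (LINT x|lebesgue. ?G x)"
    by (rule integral_cong_AE) (use F G' ae in \<open>auto elim: AE_mp\<close>)
  also have "\<dots> = (LINT x|lborel. ?G x)"
    using G by (rule integral_completion)
  also have "\<dots> = enn2real (\<integral>\<^sup>+x. ennreal (?G x) \<partial>lborel)"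
    by (rule integral_eq_nn_integral) (use G in auto)
  also have "(\<integral>\<^sup>+x. ennreal (?G x) \<partial>lborel) = shift_power p f' y"
    unfolding shift_power_def by (intro nn_integral_cong) (auto simp: indicator_def)
  finally show ?thesis by (simp add: Lp_norm_def)
qed

lemma shift_power_finite:
  assumes "f \<in> borel_measurable borel" "0 < p" "Lp_power p f < \<infinity>"
  shows "shift_power p f y < \<infinity>"
  using shift_power_le_Lp_power[OF assms(1,2), of y] assms(3)
  by (metis ennreal_mult_less_top ennreal_less_top infinity_ennreal_def order_le_less_trans)

lemma ex_norm_between: "0 < t \<Longrightarrow> \<exists>y::'a::euclidean_space. 0 < norm y \<and> norm y \<le> t"
  using vector_choose_size[of t, where 'a='a] by (metis less_imp_le order_refl)

lemma modulus_bdd_above: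
  fixes f :: "real^'d \<Rightarrow> real"
  assumes r: "borel_rep f f'" and p: "0 < p" and fin: "Lp_power p f' < \<infinity>"
  shows "bdd_above ((\<lambda>y. Lp_norm p (shifted_cube y) (\<lambda>x. f (x + y) - f x)) ` Y)"
proof (rule bdd_aboveI2)
  fix y
  have b: "f' \<in> borel_measurable borel" using r by (simp add: borel_rep_def)
  have "enn2real (shift_power p f' y) \<le> enn2real (ennreal (2 * 2 powr p) * Lp_power p f')"
    using shift_power_le_Lp_power[OF b p, of y] fin by (intro enn2real_mono) (auto simp: ennreal_mult_less_top)
  then show "Lp_norm p (shifted_cube y) (\<lambda>x. f (x + y) - f x) \<le> enn2real (ennreal (2 * 2 powr p) * Lp_power p f') powr (1 / p)"
    unfolding borel_rep_Lp_norm_shift[OF r p] using p by (intro powr_mono2) auto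
qed

text \<open>
The zero shift, over which the supremum in the modulus does not run, has shift power 0.
\<close>

lemma shift_power_le_modulus:
  fixes f :: "real^'d \<Rightarrow> real"
  assumes r: "borel_rep f f'" and p: "0 < p" and fin: "Lp_power p f' < \<infinity>" and y: "norm y \<le> t"
  shows "shift_power p f' y \<le> ennreal (modulus p f t powr p)"
proof (cases "y = 0")
  case True
  then show ?thesis using p by (simp add: shift_power_def)
next
  case False
  have b: "f' \<in> borel_measurable borel" using r by (simp add: borel_rep_def)
  have "Lp_norm p (shifted_cube y) (\<lambda>x. f (x + y) - f x) \<le> modulus p f t"
    unfolding modulus_def using False y by (intro cSUP_upper modulus_bdd_above[OF r p fin]) auto
  then have "enn2real (shift_power p f' y) powr (1 / p) \<le> modulus p f t"
    by (simp add: borel_rep_Lp_norm_shift[OF r p])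
  then have "(enn2real (shift_power p f' y) powr (1 / p)) powr p \<le> modulus p f t powr p"
    using p by (intro powr_mono2) auto
  then have "enn2real (shift_power p f' y) \<le> modulus p f t powr p"
    using p by (simp add: powr_powr)
  then show ?thesis
    using shift_power_finite[OF b p fin, of y] by (metis ennreal_enn2real ennreal_leI infinity_ennreal_def)
qed

lemma modulus_powr_le:
  fixes f :: "real^'d \<Rightarrow> real"
  assumes r: "borel_rep f f'" and p: "0 < p" and t: "0 < t" and T: "0 \<le> T"
    and W: "\<And>y. norm y \<le> t \<Longrightarrow> shift_power p f' y \<le> ennreal T"
  shows "modulus p f t powr p \<le> T"
proof -
  obtain y0 :: "real^'d" where y0: "0 < norm y0 \<and> norm y0 \<le> t" using ex_norm_between[OF t] by blast
  have le: "Lp_norm p (shifted_cube y) (\<lambda>x. f (x + y) - f x) \<le> T powr (1 / p)" if "norm y \<le> t" for y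
  proof -
    have "enn2real (shift_power p f' y) \<le> T" using W[OF that] T by (simp add: enn2real_leI)
    then show ?thesis unfolding borel_rep_Lp_norm_shift[OF r p] using p by (intro powr_mono2) auto
  qed
  have "0 \<le> Lp_norm p (shifted_cube y0) (\<lambda>x. f (x + y0) - f x)"
    by (simp add: Lp_norm_def)
  also have "\<dots> \<le> modulus p f t"
    unfolding modulus_def using y0 le
    by (intro cSUP_upper bdd_aboveI2[where M="T powr (1 / p)"]) auto
  finally have m0: "0 \<le> modulus p f t" .
  have "modulus p f t \<le> T powr (1 / p)"
    unfolding modulus_def using y0 le by (intro cSUP_least) auto
  then have "modulus p f t powr p \<le> (T powr (1 / p)) powr p"
    using m0 p by (intro powr_mono2) auto
  then show ?thesis using p T by (simp add: powr_powr)
qed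

lemma modulus_mono:
  fixes f :: "real^'d \<Rightarrow> real"
  assumes r: "borel_rep f f'" and p: "0 < p" and fin: "Lp_power p f' < \<infinity>" and t: "0 < t" "t \<le> t'"
  shows "modulus p f t \<le> modulus p f t'"
  unfolding modulus_def using t ex_norm_between[OF t(1), where 'a="real^'d"]
  by (intro cSUP_subset_mono modulus_bdd_above[OF r p fin]) auto

lemma modulus_nonneg:
  fixes f :: "real^'d \<Rightarrow> real"
  assumes r: "borel_rep f f'" and p: "0 < p" and fin: "Lp_power p f' < \<infinity>" and t: "0 < t"
  shows "0 \<le> modulus p f t"
proof -
  obtain y0 :: "real^'d" where y0: "0 < norm y0 \<and> norm y0 \<le> t" using ex_norm_between[OF t] by blast
  have "0 \<le> Lp_norm p (shifted_cube y0) (\<lambda>x. f (x + y0) - f x)"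
    by (simp add: Lp_norm_def)
  also have "\<dots> \<le> modulus p f t"
    unfolding modulus_def using y0 by (intro cSUP_upper modulus_bdd_above[OF r p fin]) auto
  finally show ?thesis .
qed

lemma modulus_cong_rep:
  fixes f :: "real^'d \<Rightarrow> real"
  assumes "borel_rep f f'" "borel_rep g f'" "0 < p"
  shows "modulus p f = modulus p g"
  unfolding modulus_def fun_eq_iff
  by (simp add: borel_rep_Lp_norm_shift[OF assms(1,3)] borel_rep_Lp_norm_shift[OF assms(2,3)])

lemma besov_cong_rep:
  fixes f :: "real^'d \<Rightarrow> real"
  assumes "borel_rep f f'" "borel_rep g f'" "0 < p"
  shows "f \<in> besov_space s p q \<longleftrightarrow> g \<in> besov_space s p q" "besov_norm s p q f = besov_norm s p q g"
  using borel_rep_Lp_space[OF assms(1,3)] borel_rep_Lp_space[OF assms(2,3)]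
  by (simp_all add: besov_space_def besov_norm_def modulus_cong_rep[OF assms])

section \<open>The Besov norm as a dyadic sum\<close>

definition dyadic_ring :: "nat \<Rightarrow> real set"
  where "dyadic_ring j = {2 powr (- real (Suc j)) <.. 2 powr (- real j)}"

lemma sets_dyadic_ring [measurable, simp]: "dyadic_ring j \<in> sets borel"
  by (simp add: dyadic_ring_def)

lemma disjoint_dyadic_ring: "disjoint_family dyadic_ring"
proof -
  have "dyadic_ring i \<inter> dyadic_ring j = {}" if "i < j" for i j
  proof -
    have "2 powr (- real j) \<le> (2::real) powr (- real (Suc i))"
      using that by (intro powr_mono) auto
    then show ?thesis by (auto simp: dyadic_ring_def)
  qed
  then show ?thesis
    unfolding disjoint_family_on_def by (metis Int_commute linorder_neqE_nat)
qed

lemma UN_dyadic_ring: "(\<Union>j. dyadic_ring j) = {0<..1}"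
proof (intro equalityI subsetI)
  fix x assume "x \<in> (\<Union>j. dyadic_ring j)"
  then obtain j where j: "2 powr (- real (Suc j)) < x" "x \<le> 2 powr (- real j)" by (auto simp: dyadic_ring_def)
  have "0 < x" using j(1) by (meson less_trans powr_gt_zero zero_less_numeral less_numeral_extra(3) numeral_neq_zero order_le_less_trans powr_ge_zero)
  moreover have "2 powr (- real j) \<le> (2::real) powr 0" by (intro powr_mono) auto
  ultimately show "x \<in> {0<..1}" using j(2) by simp
next
  fix x :: real assume x: "x \<in> {0<..1}"
  define j where "j = nat \<lfloor>- log 2 x\<rfloor>"
  have "0 \<le> - log 2 x" using x by simp
  then have "real j \<le> - log 2 x" "- log 2 x < real (Suc j)"
    unfolding j_def by linarith+
  then have "log 2 x \<le> - real j" "- real (Suc j) < log 2 x" by linarith+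
  then have "x \<le> 2 powr (- real j)" "2 powr (- real (Suc j)) < x"
    using x by (auto simp: log_le_iff less_log_iff)
  then show "x \<in> (\<Union>j. dyadic_ring j)" by (auto simp: dyadic_ring_def)
qed

lemma emeasure_dyadic_ring: "emeasure lborel (dyadic_ring j) = ennreal (2 powr (- real (Suc j)))"
proof -
  have "2 powr (- real j) = 2 * (2::real) powr (- real (Suc j))"
    using powr_add[of "2::real" 1 "- real (Suc j)"] by simp
  then show ?thesis
    unfolding dyadic_ring_def by (subst emeasure_lborel_Ioc) (auto intro!: powr_mono)
qed

text \<open>
The modulus of smoothness enters the Besov norm only as a nonnegative monotone function of t, and this is all that the
comparison of the integral with a dyadic sum uses.
\<close>

locale mono_profile =
  fixes m :: "real \<Rightarrow> real" and s q :: real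
  assumes mono: "0 < a \<Longrightarrow> a \<le> b \<Longrightarrow> m a \<le> m b"
    and nonneg: "0 < a \<Longrightarrow> 0 \<le> m a"
    and s: "0 < s" and q: "0 < q"
begin

definition weight :: "real \<Rightarrow> real"
  where "weight t = (t powr (- s) * m t) powr q / t"

definition dyadic_term :: "nat \<Rightarrow> real"
  where "dyadic_term j = (2 powr (real j * s) * m (2 powr (- real j))) powr q"

lemma dyadic_term_nonneg: "0 \<le> dyadic_term j"
  by (simp add: dyadic_term_def)

lemma borel_weight: "(\<lambda>t. weight t * indicator {0<..1} t) \<in> borel_measurable borel"
proof -
  have "m \<in> borel_measurable (restrict_space borel {0<..})"
    by (rule borel_measurable_mono_on_fnc) (auto simp: mono_on_def mono)
  then have [measurable]: "(\<lambda>t. m t * indicator {0<..} t) \<in> borel_measurable borel"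
    by (subst (asm) borel_measurable_restrict_space_iff) (auto simp: mult.commute)
  have "(\<lambda>t. weight t * indicator {0<..1} t)
      = (\<lambda>t. ((t powr (- s) * (m t * indicator {0<..} t)) powr q / t) * indicator {0<..1} t)"
    by (auto simp: weight_def indicator_def fun_eq_iff)
  also have "\<dots> \<in> borel_measurable borel" by measurable
  finally show ?thesis .
qed

lemma weight_nonneg: "0 < t \<Longrightarrow> 0 \<le> weight t"
  by (simp add: weight_def)

lemma dyadic_ring_pos: "t \<in> dyadic_ring j \<Longrightarrow> 0 < t"
  using UN_dyadic_ring by auto

text \<open>
The unit interval is split at the powers of 2, between which all factors of the integrand vary by bounded factors.
\<close>

lemma nn_integral_weight_eq:
  "(\<integral>\<^sup>+t. ennreal (weight t * indicator {0<..1} t) \<partial>lborel)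
    = (\<Sum>j. \<integral>\<^sup>+t. ennreal (weight t * indicator {0<..1} t) * indicator (dyadic_ring j) t \<partial>lborel)"
proof -
  note [measurable] = borel_weight
  have "(\<integral>\<^sup>+t. ennreal (weight t * indicator {0<..1} t) \<partial>lborel)
      = (\<integral>\<^sup>+t. (\<Sum>j. ennreal (weight t * indicator {0<..1} t) * indicator (dyadic_ring j) t) \<partial>lborel)"
    by (intro nn_integral_cong)
      (simp add: ennreal_suminf_cmult suminf_indicator[OF disjoint_dyadic_ring] UN_dyadic_ring split: split_indicator)
  also have "\<dots> = (\<Sum>j. \<integral>\<^sup>+t. ennreal (weight t * indicator {0<..1} t) * indicator (dyadic_ring j) t \<partial>lborel)"
    by (rule nn_integral_suminf) measurable
  finally show ?thesis .
qed

lemma nn_integral_weight_ring_le: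
  "(\<integral>\<^sup>+t. ennreal (weight t * indicator {0<..1} t) * indicator (dyadic_ring j) t \<partial>lborel)
    \<le> ennreal (2 powr (s * q) * dyadic_term j)"
proof -
  have le: "weight t \<le> 2 powr (s * q) * dyadic_term j * 2 powr (real (Suc j))" if t: "t \<in> dyadic_ring j" for t
  proof -
    have t0: "0 < t" using dyadic_ring_pos[OF t] .
    have t1: "2 powr (- real (Suc j)) \<le> t" "t \<le> 2 powr (- real j)" using t by (auto simp: dyadic_ring_def)
    have "t powr (- s) \<le> (2 powr (- real (Suc j))) powr (- s)"
      using t1 s by (intro powr_mono2') auto
    also have "\<dots> = 2 powr s * 2 powr (real j * s)"
      by (simp add: powr_powr powr_add[symmetric] algebra_simps)
    finally have "t powr (- s) * m t \<le> (2 powr s * 2 powr (real j * s)) * m (2 powr (- real j))"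
      using t0 t1 by (intro mult_mono mono nonneg) auto
    then have "(t powr (- s) * m t) powr q \<le> ((2 powr s * 2 powr (real j * s)) * m (2 powr (- real j))) powr q"
      using q t0 nonneg[OF t0] by (intro powr_mono2) auto
    also have "\<dots> = 2 powr (s * q) * dyadic_term j"
      using nonneg[of "2 powr (- real j)"] by (simp add: dyadic_term_def powr_mult powr_powr mult_ac)
    finally have A: "(t powr (- s) * m t) powr q \<le> 2 powr (s * q) * dyadic_term j" .
    have "1 / t \<le> 1 / 2 powr (- real (Suc j))" using t1 t0 by (intro divide_left_mono) auto
    then have B: "1 / t \<le> 2 powr (real (Suc j))" by (metis powr_minus_divide minus_minus)
    show ?thesis
      using mult_mono[OF A B] t0 by (simp add: weight_def dyadic_term_def)
  qed
  have "(\<integral>\<^sup>+t. ennreal (weight t * indicator {0<..1} t) * indicator (dyadic_ring j) t \<partial>lborel)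
      \<le> (\<integral>\<^sup>+t. ennreal (2 powr (s * q) * dyadic_term j * 2 powr (real (Suc j))) * indicator (dyadic_ring j) t \<partial>lborel)"
    using le by (intro nn_integral_mono) (auto simp: indicator_def intro!: ennreal_leI)
  also have "\<dots> = ennreal (2 powr (s * q) * dyadic_term j * 2 powr (real (Suc j))) * ennreal (2 powr (- real (Suc j)))"
    by (subst nn_integral_cmult_indicator) (auto simp: emeasure_dyadic_ring)
  also have "\<dots> = ennreal (2 powr (s * q) * dyadic_term j)"
    by (subst ennreal_mult'[symmetric]) (auto simp: dyadic_term_nonneg mult.assoc powr_add[symmetric])
  finally show ?thesis .
qed

lemma nn_integral_weight_ring_ge:
  "ennreal (dyadic_term (Suc j) / (2 * 2 powr (s * q)))
    \<le> (\<integral>\<^sup>+t. ennreal (weight t * indicator {0<..1} t) * indicator (dyadic_ring j) t \<partial>lborel)"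
proof -
  have le: "dyadic_term (Suc j) / 2 powr (s * q) * 2 powr (real j) \<le> weight t" if t: "t \<in> dyadic_ring j" for t
  proof -
    have t0: "0 < t" using dyadic_ring_pos[OF t] .
    have t1: "2 powr (- real (Suc j)) \<le> t" "t \<le> 2 powr (- real j)" using t by (auto simp: dyadic_ring_def)
    have "2 powr (real j * s) = (2 powr (- real j)) powr (- s)"
      by (simp add: powr_powr)
    also have "\<dots> \<le> t powr (- s)"
      using t0 t1 s by (intro powr_mono2') auto
    finally have "2 powr (real j * s) * m (2 powr (- real (Suc j))) \<le> t powr (- s) * m t"
      using t0 t1 by (intro mult_mono mono nonneg) auto
    then have "(2 powr (real j * s) * m (2 powr (- real (Suc j)))) powr q \<le> (t powr (- s) * m t) powr q"
      using q nonneg[of "2 powr (- real (Suc j))"] by (intro powr_mono2) auto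
    also have "2 powr (real j * s) = 2 powr (- s) * 2 powr (real (Suc j) * s)"
      by (simp add: powr_add[symmetric] algebra_simps)
    also have "(2 powr (- s) * 2 powr (real (Suc j) * s) * m (2 powr (- real (Suc j)))) powr q = dyadic_term (Suc j) / 2 powr (s * q)"
    proof -
      have "(2 powr (- s) * (2 powr (real (Suc j) * s) * m (2 powr (- real (Suc j))))) powr q
          = (2 powr (- s)) powr q * (2 powr (real (Suc j) * s) * m (2 powr (- real (Suc j)))) powr q"
        by (rule powr_mult)
      also have "(2 powr (- s)) powr q = 1 / 2 powr (s * q)"
        by (subst powr_powr) (simp add: powr_minus_divide)
      finally show ?thesis by (simp add: dyadic_term_def mult.assoc)
    qed
    finally have A: "dyadic_term (Suc j) / 2 powr (s * q) \<le> (t powr (- s) * m t) powr q" .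
    have "1 / 2 powr (- real j) \<le> 1 / t" using t1 t0 by (intro divide_left_mono) auto
    then have B: "2 powr (real j) \<le> 1 / t" by (metis powr_minus_divide minus_minus)
    show ?thesis
      using mult_mono[OF A B] t0 by (simp add: weight_def dyadic_term_def)
  qed
  have "ennreal (dyadic_term (Suc j) / (2 * 2 powr (s * q)))
      = ennreal (dyadic_term (Suc j) / 2 powr (s * q) * 2 powr (real j)) * ennreal (2 powr (- real (Suc j)))"
  proof -
    have "2 powr (real j) * 2 powr (- real (Suc j)) = (1 / 2 :: real)"
      using powr_add[of 2 "real j" "- real (Suc j)"] by (simp add: powr_minus)
    then have "dyadic_term (Suc j) / 2 powr (s * q) * (2 powr (real j) * 2 powr (- real (Suc j))) = dyadic_term (Suc j) / (2 * 2 powr (s * q))"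
      by (simp only:) simp
    then show ?thesis by (simp only: mult.assoc[symmetric]) (simp add: ennreal_mult'[symmetric] dyadic_term_nonneg)
  qed
  also have "\<dots> = (\<integral>\<^sup>+t. ennreal (dyadic_term (Suc j) / 2 powr (s * q) * 2 powr (real j)) * indicator (dyadic_ring j) t \<partial>lborel)"
    by (subst nn_integral_cmult_indicator) (auto simp: emeasure_dyadic_ring)
  also have "\<dots> \<le> (\<integral>\<^sup>+t. ennreal (weight t * indicator {0<..1} t) * indicator (dyadic_ring j) t \<partial>lborel)"
    using UN_dyadic_ring le by (intro nn_integral_mono) (auto simp: indicator_def intro!: ennreal_leI)
  finally show ?thesis .
qed

lemma integral_of_summable:
  assumes "summable dyadic_term"
  shows "set_integrable lborel {0<..1} weight"
    and "(LINT t:{0<..1}|lborel. weight t) \<le> 2 powr (s * q) * suminf dyadic_term"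
proof -
  have "(\<integral>\<^sup>+t. ennreal (weight t * indicator {0<..1} t) \<partial>lborel) \<le> (\<Sum>j. ennreal (2 powr (s * q) * dyadic_term j))"
    unfolding nn_integral_weight_eq by (intro suminf_le nn_integral_weight_ring_le) auto
  also have "\<dots> = ennreal (\<Sum>j. 2 powr (s * q) * dyadic_term j)"
    using assms by (intro suminf_ennreal2 summable_mult) (auto simp: dyadic_term_nonneg)
  also have "(\<Sum>j. 2 powr (s * q) * dyadic_term j) = 2 powr (s * q) * suminf dyadic_term"
    by (rule suminf_mult[OF assms])
  finally have le: "(\<integral>\<^sup>+t. ennreal (weight t * indicator {0<..1} t) \<partial>lborel) \<le> ennreal (2 powr (s * q) * suminf dyadic_term)" .
  have I: "integrable lborel (\<lambda>t. weight t * indicator {0<..1} t)"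
  proof (rule integrableI_nonneg)
    show "(\<integral>\<^sup>+t. ennreal (weight t * indicator {0<..1} t) \<partial>lborel) < \<infinity>"
      using le by (rule order_le_less_trans) simp
  qed (use borel_weight weight_nonneg in \<open>auto simp: indicator_def\<close>)
  then show "set_integrable lborel {0<..1} weight"
    by (simp add: set_integrable_def mult.commute)
  have "(LINT t:{0<..1}|lborel. weight t) = (LINT t|lborel. weight t * indicator {0<..1} t)"
    by (simp add: set_lebesgue_integral_def mult.commute)
  also have "\<dots> = enn2real (\<integral>\<^sup>+t. ennreal (weight t * indicator {0<..1} t) \<partial>lborel)"
    using borel_weight weight_nonneg by (intro integral_eq_nn_integral) (auto simp: indicator_def)
  also have "\<dots> \<le> 2 powr (s * q) * suminf dyadic_term"
    using le suminf_nonneg[OF assms dyadic_term_nonneg] by (intro enn2real_leI) auto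
  finally show "(LINT t:{0<..1}|lborel. weight t) \<le> 2 powr (s * q) * suminf dyadic_term" .
qed

lemma summable_of_integral:
  assumes "set_integrable lborel {0<..1} weight"
  shows "summable (\<lambda>j. dyadic_term (Suc j))"
    and "(\<Sum>j. dyadic_term (Suc j)) \<le> 2 * 2 powr (s * q) * (LINT t:{0<..1}|lborel. weight t)"
proof -
  define c where "c = 2 * 2 powr (s * q)"
  have c: "0 < c" by (simp add: c_def)
  have I: "integrable lborel (\<lambda>t. weight t * indicator {0<..1} t)"
    using assms by (simp add: set_integrable_def mult.commute)
  have eq: "(LINT t:{0<..1}|lborel. weight t) = (LINT t|lborel. weight t * indicator {0<..1} t)"
    by (simp add: set_lebesgue_integral_def mult.commute)
  have nn: "(\<integral>\<^sup>+t. ennreal (weight t * indicator {0<..1} t) \<partial>lborel) = ennreal (LINT t:{0<..1}|lborel. weight t)"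
    unfolding eq using weight_nonneg by (intro nn_integral_eq_integral I) (auto simp: indicator_def)
  have "(\<Sum>j. ennreal (dyadic_term (Suc j) / c)) \<le> ennreal (LINT t:{0<..1}|lborel. weight t)"
    unfolding nn[symmetric] nn_integral_weight_eq c_def by (intro suminf_le nn_integral_weight_ring_ge) auto
  then have fin: "(\<Sum>j. ennreal (dyadic_term (Suc j) / c)) \<le> ennreal (LINT t:{0<..1}|lborel. weight t)" .
  have sm: "summable (\<lambda>j. dyadic_term (Suc j) / c)"
    using fin c by (intro summable_suminf_not_top) (auto simp: dyadic_term_nonneg top_unique)
  have "ennreal (\<Sum>j. dyadic_term (Suc j) / c) \<le> ennreal (LINT t:{0<..1}|lborel. weight t)"
  proof -
    have "(\<Sum>j. ennreal (dyadic_term (Suc j) / c)) = ennreal (\<Sum>j. dyadic_term (Suc j) / c)"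
      using c dyadic_term_nonneg by (intro suminf_ennreal2 sm) auto
    with fin show ?thesis by (simp only:)
  qed
  moreover have "0 \<le> (LINT t:{0<..1}|lborel. weight t)"
    unfolding eq using weight_nonneg by (intro integral_nonneg_AE AE_I2) (auto simp: indicator_def)
  ultimately have le: "(\<Sum>j. dyadic_term (Suc j) / c) \<le> (LINT t:{0<..1}|lborel. weight t)"
    by simp
  show sm': "summable (\<lambda>j. dyadic_term (Suc j))"
    using summable_mult[OF sm, of c] c by simp
  have "(\<Sum>j. dyadic_term (Suc j)) / c \<le> (LINT t:{0<..1}|lborel. weight t)"
    using le by (simp only: suminf_divide[OF sm'])
  then have "(\<Sum>j. dyadic_term (Suc j)) \<le> (LINT t:{0<..1}|lborel. weight t) * c"
    using c by (simp only: pos_divide_le_eq)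
  then show "(\<Sum>j. dyadic_term (Suc j)) \<le> 2 * 2 powr (s * q) * (LINT t:{0<..1}|lborel. weight t)"
    by (simp only: c_def mult.commute)
qed

end

lemma besov_norm_powr:
  fixes f :: "real^'d \<Rightarrow> real"
  assumes r: "borel_rep f f'" and p: "0 < p" and q: "0 < q"
  shows "besov_norm s p q f powr q = enn2real (Lp_power p f') powr (q / p)
      + (LINT t:{0<..1}|lborel. (t powr (- s) * modulus p f t) powr q / t)"
    and "0 \<le> (LINT t:{0<..1}|lborel. (t powr (- s) * modulus p f t) powr q / t)"
proof -
  show nn: "0 \<le> (LINT t:{0<..1}|lborel. (t powr (- s) * modulus p f t) powr q / t)"
    unfolding set_lebesgue_integral_def by (intro integral_nonneg_AE AE_I2) (auto simp: indicator_def)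
  show "besov_norm s p q f powr q = enn2real (Lp_power p f') powr (q / p)
      + (LINT t:{0<..1}|lborel. (t powr (- s) * modulus p f t) powr q / t)"
    using nn q by (simp add: besov_norm_def powr_powr borel_rep_Lp_space(2)[OF r p])
qed

lemma mono_profile_modulus:
  fixes f :: "real^'d \<Rightarrow> real"
  assumes "borel_rep f f'" "0 < p" "Lp_power p f' < \<infinity>" "0 < s" "0 < q"
  shows "mono_profile (modulus p f) s q"
  using assms by unfold_locales (auto intro: modulus_mono modulus_nonneg)

lemma modulus_powr_le_Lp_power:
  fixes f :: "real^'d \<Rightarrow> real"
  assumes r: "borel_rep f f'" and p: "0 < p" and fin: "Lp_power p f' < \<infinity>" and t: "0 < t"
  shows "modulus p f t powr p \<le> 2 * 2 powr p * enn2real (Lp_power p f')"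
proof (rule modulus_powr_le[OF r p t])
  fix y :: "real^'d"
  have b: "f' \<in> borel_measurable borel" using r by (simp add: borel_rep_def)
  have "ennreal (2 * 2 powr p * enn2real (Lp_power p f')) = ennreal (2 * 2 powr p) * Lp_power p f'"
    using fin by (simp add: ennreal_mult'')
  then show "shift_power p f' y \<le> ennreal (2 * 2 powr p * enn2real (Lp_power p f'))"
    using shift_power_le_Lp_power[OF b p, of y] by (simp only:)
qed simp

lemma besov_of_summable:
  fixes f :: "real^'d \<Rightarrow> real"
  assumes r: "borel_rep f f'" and p: "0 < p" and fin: "Lp_power p f' < \<infinity>" and s: "0 < s" and q: "0 < q"
    and sm: "summable (\<lambda>j. (2 powr (real j * s) * modulus p f (2 powr (- real j))) powr q)"
  shows "f \<in> besov_space s p q"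
    and "besov_norm s p q f powr q \<le> enn2real (Lp_power p f') powr (q / p)
      + 2 powr (s * q) * (\<Sum>j. (2 powr (real j * s) * modulus p f (2 powr (- real j))) powr q)"
proof -
  interpret mono_profile "modulus p f" s q
    by (rule mono_profile_modulus[OF r p fin s q])
  have dyadic_term: "dyadic_term = (\<lambda>j. (2 powr (real j * s) * modulus p f (2 powr (- real j))) powr q)"
    and weight: "weight = (\<lambda>t. (t powr (- s) * modulus p f t) powr q / t)"
    by (auto simp: dyadic_term_def weight_def fun_eq_iff)
  note I = integral_of_summable[unfolded dyadic_term weight, OF sm]
  show "f \<in> besov_space s p q"
    using I(1) borel_rep_Lp_space(1)[OF r p] fin by (simp add: besov_space_def)
  show "besov_norm s p q f powr q \<le> enn2real (Lp_power p f') powr (q / p)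
      + 2 powr (s * q) * (\<Sum>j. (2 powr (real j * s) * modulus p f (2 powr (- real j))) powr q)"
    unfolding besov_norm_powr(1)[OF r p q] using I(2) by (rule add_left_mono)
qed

text \<open>
The rings bound the terms with \<open>j \<ge> 1\<close> only. The term with \<open>j = 0\<close> is bounded by the \<open>L_p\<close> quasi-norm.
\<close>

lemma summable_of_besov:
  fixes f :: "real^'d \<Rightarrow> real"
  assumes r: "borel_rep f f'" and p: "0 < p" and s: "0 < s" and q: "0 < q"
    and f: "f \<in> besov_space s p q"
  shows "Lp_power p f' < \<infinity>"
    and "summable (\<lambda>j. (2 powr (real j * s) * modulus p f (2 powr (- real j))) powr q)"
    and "(\<Sum>j. (2 powr (real j * s) * modulus p f (2 powr (- real j))) powr q)
      \<le> ((2 * 2 powr p) powr (q / p) + 2 * 2 powr (s * q)) * besov_norm s p q f powr q"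
proof -
  show fin: "Lp_power p f' < \<infinity>"
    using f borel_rep_Lp_space(1)[OF r p] by (simp add: besov_space_def)
  interpret mono_profile "modulus p f" s q
    by (rule mono_profile_modulus[OF r p fin s q])
  have dyadic_term: "dyadic_term = (\<lambda>j. (2 powr (real j * s) * modulus p f (2 powr (- real j))) powr q)"
    and weight: "weight = (\<lambda>t. (t powr (- s) * modulus p f t) powr q / t)"
    by (auto simp: dyadic_term_def weight_def fun_eq_iff)
  define I where "I = (LINT t:{0<..1}|lborel. weight t)"
  define N where "N = enn2real (Lp_power p f')"
  have B: "besov_norm s p q f powr q = N powr (q / p) + I" "0 \<le> I"
    using besov_norm_powr[OF r p q] by (auto simp: I_def N_def weight)
  have si: "set_integrable lborel {0<..1} weight"
    using f by (simp add: besov_space_def weight)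
  have sm: "summable dyadic_term"
    using summable_of_integral(1)[OF si] by (simp add: summable_Suc_iff)
  show "summable (\<lambda>j. (2 powr (real j * s) * modulus p f (2 powr (- real j))) powr q)"
    using sm by (simp only: dyadic_term)
  have "dyadic_term 0 = modulus p f 1 powr q"
    by (simp add: dyadic_term)
  also have "\<dots> = (modulus p f 1 powr p) powr (q / p)"
    using p by (simp add: powr_powr)
  also have "\<dots> \<le> (2 * 2 powr p * N) powr (q / p)"
    using p q modulus_powr_le_Lp_power[OF r p fin, of 1] by (intro powr_mono2) (auto simp: N_def)
  also have "\<dots> = (2 * 2 powr p) powr (q / p) * N powr (q / p)"
    by (rule powr_mult)
  finally have d0: "dyadic_term 0 \<le> (2 * 2 powr p) powr (q / p) * N powr (q / p)" .
  have "suminf dyadic_term = dyadic_term 0 + (\<Sum>j. dyadic_term (Suc j))"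
    using suminf_split_head[OF sm] by simp
  also have "\<dots> \<le> (2 * 2 powr p) powr (q / p) * N powr (q / p) + 2 * 2 powr (s * q) * I"
    using d0 summable_of_integral(2)[OF si] by (intro add_mono) (auto simp: I_def)
  also have "\<dots> \<le> ((2 * 2 powr p) powr (q / p) + 2 * 2 powr (s * q)) * (N powr (q / p) + I)"
    using B(2) by (simp add: algebra_simps)
  finally show "(\<Sum>j. (2 powr (real j * s) * modulus p f (2 powr (- real j))) powr q)
      \<le> ((2 * 2 powr p) powr (q / p) + 2 * 2 powr (s * q)) * besov_norm s p q f powr q"
    by (simp only: B dyadic_term)
qed

section \<open>Series of step functions lie in the Besov space\<close>

lemma bounded_of_summable_powr:
  fixes B :: "nat \<Rightarrow> real"
  assumes "\<And>k. 0 \<le> B k" "0 < r" "summable (\<lambda>k. B k powr r)"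
  shows "B k \<le> (\<Sum>k. B k powr r) powr (1 / r)"
proof -
  have "B k powr r \<le> (\<Sum>k. B k powr r)"
    using sum_le_suminf[OF assms(3), of "{k}"] by simp
  then have "(B k powr r) powr (1 / r) \<le> (\<Sum>k. B k powr r) powr (1 / r)"
    using assms(2) by (intro powr_mono2) auto
  then show ?thesis using assms by (simp add: powr_powr)
qed

text \<open>
B majorises the normalised powers \<open>2 powr (k * s * p) * (LINT x|lborel. \<bar>u k x\<bar> powr p)\<close> without being equal to them, which
leaves the freedom to read B off from an estimate.
\<close>

definition step_series :: "real \<Rightarrow> real \<Rightarrow> real \<Rightarrow> (nat \<Rightarrow> real^'d \<Rightarrow> real) \<Rightarrow> (nat \<Rightarrow> real) \<Rightarrow> bool"
  where "step_series s p q u B \<longleftrightarrow> (\<forall>k. dyadic_step k (u k)) \<and> (\<forall>k. 0 \<le> B k) \<and>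
    (\<forall>k. (LINT x|lborel. \<bar>u k x\<bar> powr p) \<le> 2 powr (- (real k * s * p)) * B k) \<and>
    summable (\<lambda>k. B k powr (q / p))"

lemma step_seriesD:
  assumes "step_series s p q u B"
  shows "dyadic_step k (u k)" "0 \<le> B k"
    "(LINT x|lborel. \<bar>u k x\<bar> powr p) \<le> 2 powr (- (real k * s * p)) * B k"
    "summable (\<lambda>k. B k powr (q / p))"
  using assms by (auto simp: step_series_def)

text \<open>
The terms \<open>B k\<close> are bounded, so that the \<open>L_1\<close> norms of \<open>u k\<close> are dominated by a geometric series: passing from \<open>L_p\<close> to \<open>L_1\<close>
costs, in the p-th power, the factor \<open>2 powr (k * d * max (1 - p) 0)\<close>, which grows more slowly than \<open>2 powr (k * s * p)\<close>.
\<close>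

lemma step_series_L1:
  fixes u :: "nat \<Rightarrow> real^'d \<Rightarrow> real" and s p q :: real
  assumes p: "0 < p" and q: "0 < q" and sig: "CARD('d) * max (1 - p) 0 < s * p"
    and ser: "step_series s p q u B"
  shows "summable (\<lambda>k. LINT x|lborel. \<bar>u k x\<bar>)"
    and "AE x in lborel. summable (\<lambda>k. \<bar>u k x\<bar>)"
proof -
  note u = step_seriesD(1)[OF ser] and B = step_seriesD(2)[OF ser]
    and le = step_seriesD(3)[OF ser] and sm = step_seriesD(4)[OF ser]
  define M where "M = (\<Sum>k. B k powr (q / p)) powr (p / q)"
  define \<delta> where "\<delta> = (s * p - CARD('d) * max (1 - p) 0) / p"
  have \<delta>: "0 < \<delta>" using sig p by (simp add: \<delta>_def)
  have BM: "B k \<le> M" for k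
    using bounded_of_summable_powr[OF B _ sm, of k] p q by (simp add: M_def)
  have b: "(LINT x|lborel. \<bar>u k x\<bar>) \<le> M powr (1 / p) * decay \<delta> 0 k" for k
  proof -
    have "(LINT x|lborel. \<bar>u k x\<bar>) powr p \<le> 2 powr (k * (CARD('d) * max (1 - p) 0)) * (LINT x|lborel. \<bar>u k x\<bar> powr p)"
      by (rule L1_powr_le[OF u p])
    also have "\<dots> \<le> 2 powr (k * (CARD('d) * max (1 - p) 0)) * (2 powr (- (real k * s * p)) * M)"
      using BM[of k] by (intro mult_left_mono order_trans[OF le[of k]]) auto
    also have "\<dots> = decay (\<delta> * p) 0 k * M"
    proof -
      have "2 powr (k * (CARD('d) * max (1 - p) 0)) * 2 powr (- (real k * s * p)) = decay (\<delta> * p) 0 k"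
      proof -
        have "\<delta> * p = s * p - CARD('d) * max (1 - p) 0" using p by (simp add: \<delta>_def)
        then show ?thesis
          unfolding decay_def by (simp only:) (simp add: powr_add[symmetric] algebra_simps)
      qed
      then show ?thesis by (simp add: mult.assoc[symmetric])
    qed
    finally have "((LINT x|lborel. \<bar>u k x\<bar>) powr p) powr (1 / p) \<le> (decay (\<delta> * p) 0 k * M) powr (1 / p)"
      using p by (intro powr_mono2) auto
    then show ?thesis
      using p by (simp add: powr_powr powr_mult decay_powr mult.commute)
  qed
  have "summable (\<lambda>k. M powr (1 / p) * decay \<delta> 0 k)"
    by (intro summable_mult summable_decay \<delta>)
  then show sL: "summable (\<lambda>k. LINT x|lborel. \<bar>u k x\<bar>)"
    by (rule summable_comparison_test'[where N=0]) (use b in auto)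
  have [measurable]: "u k \<in> borel_measurable borel" for k by (rule borel_dyadic_step[OF u])
  have "(\<integral>\<^sup>+x. (\<Sum>k. ennreal \<bar>u k x\<bar>) \<partial>lborel) = (\<Sum>k. \<integral>\<^sup>+x. ennreal \<bar>u k x\<bar> \<partial>lborel)"
    by (rule nn_integral_suminf) measurable
  also have "\<dots> = (\<Sum>k. ennreal (LINT x|lborel. \<bar>u k x\<bar>))"
    using integrable_dyadic_step[OF u] by (intro suminf_cong nn_integral_eq_integral) auto
  also have "\<dots> = ennreal (\<Sum>k. LINT x|lborel. \<bar>u k x\<bar>)"
    by (intro suminf_ennreal2 sL) auto
  finally have "(\<integral>\<^sup>+x. (\<Sum>k. ennreal \<bar>u k x\<bar>) \<partial>lborel) \<noteq> \<infinity>" by simp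
  then have "AE x in lborel. (\<Sum>k. ennreal \<bar>u k x\<bar>) \<noteq> \<infinity>"
    by (intro nn_integral_PInf_AE) measurable
  then show "AE x in lborel. summable (\<lambda>k. \<bar>u k x\<bar>)"
    by eventually_elim (rule summable_suminf_not_top, auto)
qed

text \<open>
If v is not summable, then the right-hand side is infinite, so that the default value of the sum on the left does no harm.
\<close>

lemma weighted_suminf_powr_le_ennreal:
  fixes r \<epsilon> :: real
  assumes "0 < r" "0 < \<epsilon>"
  shows "ennreal (\<bar>suminf v\<bar> powr r)
    \<le> ennreal (weight_const r \<epsilon>) * (\<Sum>k. ennreal (decay (- \<epsilon>) j k * \<bar>v k\<bar> powr r))"
proof (cases "(\<Sum>k. ennreal (decay (- \<epsilon>) j k * \<bar>v k\<bar> powr r)) = \<infinity>")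
  case True
  then show ?thesis using weight_const_pos[OF assms] by (simp add: ennreal_mult_top)
next
  case False
  then have sm: "summable (\<lambda>k. decay (- \<epsilon>) j k * \<bar>v k\<bar> powr r)"
    by (intro summable_suminf_not_top) auto
  note W = weighted_suminf_powr_le[OF assms, of "\<lambda>k. \<bar>v k\<bar>", OF abs_ge_zero sm]
  have "\<bar>suminf v\<bar> powr r \<le> (\<Sum>k. \<bar>v k\<bar>) powr r"
    using summable_rabs[OF W(1)] assms by (intro powr_mono2) auto
  also note W(2)
  finally have "ennreal (\<bar>suminf v\<bar> powr r)
      \<le> ennreal (weight_const r \<epsilon> * (\<Sum>k. decay (- \<epsilon>) j k * \<bar>v k\<bar> powr r))"
    by (rule ennreal_leI)
  also have "\<dots> = ennreal (weight_const r \<epsilon>) * (\<Sum>k. ennreal (decay (- \<epsilon>) j k * \<bar>v k\<bar> powr r))"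
    using sm weight_const_pos[OF assms] by (subst suminf_ennreal2) (auto simp: ennreal_mult' suminf_nonneg)
  finally show ?thesis .
qed

lemma nn_integral_suminf_powr_le:
  fixes r \<epsilon> :: real and v :: "nat \<Rightarrow> 'a::euclidean_space \<Rightarrow> real"
  assumes r: "0 < r" and e: "0 < \<epsilon>"
    and v [measurable]: "\<And>k. v k \<in> borel_measurable borel" and A [measurable]: "A \<in> sets borel"
    and T: "\<And>k. 0 \<le> T k"
    and le: "\<And>k. (\<integral>\<^sup>+x. ennreal (\<bar>v k x\<bar> powr r) * indicator A x \<partial>lborel) \<le> ennreal (T k)"
    and sm: "summable (\<lambda>k. decay (- \<epsilon>) j k * T k)"
  shows "(\<integral>\<^sup>+x. ennreal (\<bar>\<Sum>k. v k x\<bar> powr r) * indicator A x \<partial>lborel)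
    \<le> ennreal (weight_const r \<epsilon> * (\<Sum>k. decay (- \<epsilon>) j k * T k))"
proof -
  let ?C = "weight_const r \<epsilon>"
  have "(\<integral>\<^sup>+x. ennreal (\<bar>\<Sum>k. v k x\<bar> powr r) * indicator A x \<partial>lborel)
    \<le> (\<integral>\<^sup>+x. ennreal ?C * (\<Sum>k. ennreal (decay (- \<epsilon>) j k) * (ennreal (\<bar>v k x\<bar> powr r) * indicator A x)) \<partial>lborel)"
  proof (rule nn_integral_mono)
    fix x
    show "ennreal (\<bar>\<Sum>k. v k x\<bar> powr r) * indicator A x
        \<le> ennreal ?C * (\<Sum>k. ennreal (decay (- \<epsilon>) j k) * (ennreal (\<bar>v k x\<bar> powr r) * indicator A x))"
      using weighted_suminf_powr_le_ennreal[OF r e, of "\<lambda>k. v k x" j] by (simp add: indicator_def ennreal_mult')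
  qed
  also have "\<dots> = ennreal ?C * (\<Sum>k. ennreal (decay (- \<epsilon>) j k) * (\<integral>\<^sup>+x. ennreal (\<bar>v k x\<bar> powr r) * indicator A x \<partial>lborel))"
    by (simp add: nn_integral_cmult nn_integral_suminf)
  also have "\<dots> \<le> ennreal ?C * (\<Sum>k. ennreal (decay (- \<epsilon>) j k) * ennreal (T k))"
    using le by (intro mult_left_mono suminf_le) auto
  also have "(\<Sum>k. ennreal (decay (- \<epsilon>) j k) * ennreal (T k)) = (\<Sum>k. ennreal (decay (- \<epsilon>) j k * T k))"
    by (simp add: ennreal_mult')
  also have "\<dots> = ennreal (\<Sum>k. decay (- \<epsilon>) j k * T k)"
    using T by (intro suminf_ennreal2 sm) auto
  also have "ennreal ?C * \<dots> = ennreal (?C * (\<Sum>k. decay (- \<epsilon>) j k * T k))"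
    using weight_const_pos[OF r e] by (simp add: ennreal_mult' less_imp_le)
  finally show ?thesis .
qed

text \<open>
With \<open>\<tau> = s * p\<close>. Levels \<open>k \<ge> j\<close> are damped at rate \<open>\<tau>\<close> by the size of \<open>u k\<close>, levels \<open>k < j\<close> at rate
\<open>1 - \<tau>\<close> because step functions of low level are nearly invariant under small shifts. The weight takes away \<open>\<epsilon>\<close> from the smaller
rate, and at least \<open>\<epsilon>\<close> is left.
\<close>

lemma synthesis_kernel_le:
  fixes \<epsilon> \<tau> :: real
  assumes "2 * \<epsilon> \<le> \<tau>" "2 * \<epsilon> \<le> 1 - \<tau>"
  shows "decay (- \<epsilon>) j k * (min 1 (2 powr (real k - real j)) * 2 powr (- (real k * \<tau>)))
    \<le> 2 powr (- (real j * \<tau>)) * decay \<epsilon> j k"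
proof (cases "k < j")
  case True
  have "0 \<le> (real j - real k) * (1 - \<tau> - 2 * \<epsilon>)"
    using True assms by (intro mult_nonneg_nonneg) auto
  then have "\<epsilon> * (real j - real k) + (real k - real j) - real k * \<tau> \<le> - (real j * \<tau>) - \<epsilon> * (real j - real k)"
    by (simp add: algebra_simps)
  then have "2 powr (\<epsilon> * (real j - real k) + (real k - real j) - real k * \<tau>) \<le> 2 powr (- (real j * \<tau>) - \<epsilon> * (real j - real k))"
    by (intro powr_mono) auto
  moreover have "min 1 (2 powr (real k - real j)) = 2 powr (real k - real j)"
    using True powr_mono[of "real k - real j" 0 2] by (simp add: min_def)
  ultimately show ?thesis
    using True by (simp add: decay_def powr_add[symmetric] algebra_simps)
next
  case False
  have "0 \<le> (real k - real j) * (\<tau> - 2 * \<epsilon>)"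
    using False assms by (intro mult_nonneg_nonneg) auto
  then have "\<epsilon> * (real k - real j) - real k * \<tau> \<le> - (real j * \<tau>) - \<epsilon> * (real k - real j)"
    by (simp add: algebra_simps)
  then have "2 powr (\<epsilon> * (real k - real j) - real k * \<tau>) \<le> 2 powr (- (real j * \<tau>) - \<epsilon> * (real k - real j))"
    by (intro powr_mono) auto
  moreover have "min 1 (2 powr (real k - real j)) = (1::real)"
    using False by (simp add: min_def ge_one_powr_ge_zero)
  ultimately show ?thesis
    using False by (simp add: decay_def powr_add[symmetric] algebra_simps)
qed

text \<open>
The shift powers of the sum are estimated level by level at each scale \<open>2 powr (- j)\<close>, with weights centred at j; the
resulting bounds \<open>2 powr (- (j * s * p)) * h j\<close> are summed by Hardy's inequality.
\<close>

lemma besov_synthesis: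
  fixes s p q :: real
  assumes p: "0 < p" and q: "0 < q" and s: "0 < s" and sp: "s * p < 1"
    and sig: "CARD('d) * max (1 - p) 0 < s * p"
  shows "\<exists>C>0. \<forall>(u :: nat \<Rightarrow> real^'d \<Rightarrow> real) B. step_series s p q u B \<longrightarrow>
    borel_rep (\<lambda>x. \<Sum>k. u k x) (\<lambda>x. \<Sum>k. u k x) \<and> (\<lambda>x. \<Sum>k. u k x) \<in> besov_space s p q \<and>
    besov_norm s p q (\<lambda>x. \<Sum>k. u k x) powr q \<le> C * (\<Sum>k. B k powr (q / p))"
proof -
  \<comment> \<open>Half of the smaller of the two decay rates; the other half is kept for the summation over the scales.\<close>
  define \<epsilon> where "\<epsilon> = min (s * p) (1 - s * p) / 2"
  have e: "0 < \<epsilon>" "2 * \<epsilon> \<le> s * p" "2 * \<epsilon> \<le> 1 - s * p"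
    using s p sp by (auto simp: \<epsilon>_def)
  have qp: "0 < q / p" using p q by simp
  define C1 where "C1 = weight_const p \<epsilon>"
  have C1: "0 < C1" unfolding C1_def by (rule weight_const_pos[OF p e(1)])
  define C2 where "C2 = hardy_const (q / p) \<epsilon>"
  have C2: "0 < C2" unfolding C2_def by (rule hardy_const_pos[OF qp e(1)])
  define c0 where "c0 = 2 * 2 powr p * real CARD('d)"
  have c0: "0 < c0" by (simp add: c0_def)
  define C where "C = (C1 powr (q / p) + 2 powr (s * q) * (C1 * c0) powr (q / p)) * C2"
  have C: "0 < C" using C1 C2 by (simp add: C_def add_pos_nonneg)
  show ?thesis
  proof (intro exI[of _ C] conjI allI impI C)
    fix u :: "nat \<Rightarrow> real^'d \<Rightarrow> real" and B :: "nat \<Rightarrow> real"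
    assume ser: "step_series s p q u B"
    note u = step_seriesD(1)[OF ser] and B = step_seriesD(2)[OF ser]
      and le = step_seriesD(3)[OF ser] and sm = step_seriesD(4)[OF ser]
    define G where "G = (\<lambda>x. \<Sum>k. u k x)"
    define h where "h j = (\<Sum>k. decay \<epsilon> j k * B k)" for j
    have hs: "summable (\<lambda>k. decay \<epsilon> j k * B k)" "summable (\<lambda>j. h j powr (q / p))"
        "(\<Sum>j. h j powr (q / p)) \<le> C2 * (\<Sum>k. B k powr (q / p))" for j
      using discrete_hardy[OF qp e(1) B sm] unfolding h_def C2_def by auto
    have h0: "0 \<le> h j" for j
      unfolding h_def by (intro suminf_nonneg hs(1)) (simp add: B)
    have [measurable]: "u k \<in> borel_measurable borel" for k by (rule borel_dyadic_step[OF u])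
    have G [measurable]: "G \<in> borel_measurable borel" unfolding G_def by measurable
    have rep: "borel_rep G G"
      by (rule borel_rep_self[OF G]) (simp add: G_def dyadic_step_outside[OF u])
    have ae: "AE x in lborel. summable (\<lambda>k. u k x)"
      using step_series_L1(2)[OF p q sig ser] by eventually_elim (rule summable_rabs_cancel)
    \<comment> \<open>One estimate serves the quasi-norm of G, with scale 0, and its modulus, with scale j.\<close>
    have kern: "summable (\<lambda>k. decay (- \<epsilon>) j k * (a * (min 1 (2 powr (real k - real j)) * 2 powr (- (real k * (s * p)))) * B k))"
      "(\<Sum>k. decay (- \<epsilon>) j k * (a * (min 1 (2 powr (real k - real j)) * 2 powr (- (real k * (s * p)))) * B k))
         \<le> a * 2 powr (- (real j * (s * p))) * h j" if a: "0 \<le> a" for j a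
    proof -
      have k: "decay (- \<epsilon>) j k * (a * (min 1 (2 powr (real k - real j)) * 2 powr (- (real k * (s * p)))) * B k)
          \<le> a * 2 powr (- (real j * (s * p))) * (decay \<epsilon> j k * B k)" for k
        using mult_left_mono[OF mult_right_mono[OF synthesis_kernel_le[OF e(2,3), of j k] B[of k]] a]
        by (simp add: mult_ac)
      have sm': "summable (\<lambda>k. a * 2 powr (- (real j * (s * p))) * (decay \<epsilon> j k * B k))"
        by (intro summable_mult hs)
      show *: "summable (\<lambda>k. decay (- \<epsilon>) j k * (a * (min 1 (2 powr (real k - real j)) * 2 powr (- (real k * (s * p)))) * B k))"
        by (rule summable_comparison_test'[OF sm', of 0]) (use k a B in auto)
      have "(\<Sum>k. decay (- \<epsilon>) j k * (a * (min 1 (2 powr (real k - real j)) * 2 powr (- (real k * (s * p)))) * B k))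
         \<le> (\<Sum>k. a * 2 powr (- (real j * (s * p))) * (decay \<epsilon> j k * B k))"
        by (intro suminf_le k * sm')
      also have "\<dots> = a * 2 powr (- (real j * (s * p))) * h j"
        unfolding h_def by (rule suminf_mult[OF hs(1)])
      finally show "(\<Sum>k. decay (- \<epsilon>) j k * (a * (min 1 (2 powr (real k - real j)) * 2 powr (- (real k * (s * p)))) * B k))
         \<le> a * 2 powr (- (real j * (s * p))) * h j" .
    qed
    have Npk: "Lp_power p (u k) \<le> ennreal (2 powr (- (real k * (s * p))) * B k)" for k
      unfolding Lp_power_dyadic_step_real[OF u p] using le[of k] by (intro ennreal_leI) (simp add: mult.assoc)
    have NG: "Lp_power p G \<le> ennreal (C1 * h 0)"
    proof -
      have m1: "min 1 (2 powr (real k - real 0)) = (1::real)" for k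
        by (simp add: min_def ge_one_powr_ge_zero)
      have "Lp_power p G = (\<integral>\<^sup>+x. ennreal (\<bar>\<Sum>k. u k x\<bar> powr p) * indicator UNIV x \<partial>lborel)"
        by (simp add: Lp_power_def G_def)
      also have "\<dots> \<le> ennreal (C1 * (\<Sum>k. decay (- \<epsilon>) 0 k * (1 * (min 1 (2 powr (real k - real 0)) * 2 powr (- (real k * (s * p)))) * B k)))"
      unfolding C1_def
      proof (rule nn_integral_suminf_powr_le[OF p e(1)])
        fix k
        show "(\<integral>\<^sup>+x. ennreal (\<bar>u k x\<bar> powr p) * indicator UNIV x \<partial>lborel)
            \<le> ennreal (1 * (min 1 (2 powr (real k - real 0)) * 2 powr (- (real k * (s * p)))) * B k)"
          unfolding m1 using Npk[of k] by (simp add: Lp_power_def)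
      qed (use B kern(1)[of 1 0] in auto)
      also have "\<dots> \<le> ennreal (C1 * (1 * 2 powr (- (real 0 * (s * p))) * h 0))"
        using C1 by (intro ennreal_leI mult_left_mono kern(2)) auto
      finally show ?thesis by simp
    qed
    then have fin: "Lp_power p G < \<infinity>" by (rule order_le_less_trans) simp
    have WG: "shift_power p G y \<le> ennreal (C1 * c0 * 2 powr (- (real j * (s * p))) * h j)" if y: "norm y \<le> 2 powr (- real j)" for y j
    proof -
      have "AE x in lborel. G (x + y) - G x = (\<Sum>k. u k (x + y) - u k x)"
        using ae AE_lborel_shift[OF ae, of y]
        by eventually_elim (simp add: G_def suminf_diff)
      then have "shift_power p G y = (\<integral>\<^sup>+x. ennreal (\<bar>\<Sum>k. u k (x + y) - u k x\<bar> powr p) * indicator {x. x \<in> ucube \<and> x + y \<in> ucube} x \<partial>lborel)"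
        unfolding shift_power_def by (intro nn_integral_cong_AE) (auto elim: eventually_mono)
      also have "\<dots> \<le> ennreal (C1 * (\<Sum>k. decay (- \<epsilon>) j k * (c0 * (min 1 (2 powr (real k - real j)) * 2 powr (- (real k * (s * p)))) * B k)))"
      unfolding C1_def
      proof (rule nn_integral_suminf_powr_le[OF p e(1)])
        fix k
        have "(\<integral>\<^sup>+x. ennreal (\<bar>u k (x + y) - u k x\<bar> powr p) * indicator {x. x \<in> ucube \<and> x + y \<in> ucube} x \<partial>lborel) = shift_power p (u k) y"
          by (simp add: shift_power_def)
        also have "\<dots> \<le> ennreal (c0 * min 1 (2 powr (real k - real j))) * Lp_power p (u k)"
          using shift_power_dyadic_step_le[OF u p y] by (simp add: c0_def)
        also have "\<dots> \<le> ennreal (c0 * min 1 (2 powr (real k - real j))) * ennreal (2 powr (- (real k * (s * p))) * B k)"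
          by (intro mult_left_mono Npk) simp
        also have "\<dots> = ennreal (c0 * (min 1 (2 powr (real k - real j)) * 2 powr (- (real k * (s * p)))) * B k)"
          using c0 B[of k] by (subst ennreal_mult'[symmetric]) (auto simp: mult_ac)
        finally show "(\<integral>\<^sup>+x. ennreal (\<bar>u k (x + y) - u k x\<bar> powr p) * indicator {x. x \<in> ucube \<and> x + y \<in> ucube} x \<partial>lborel)
           \<le> ennreal (c0 * (min 1 (2 powr (real k - real j)) * 2 powr (- (real k * (s * p)))) * B k)" .
      next
        fix k show "(\<lambda>x. u k (x + y) - u k x) \<in> borel_measurable borel" by measurable
      next
        show "{x. x \<in> ucube \<and> x + y \<in> ucube} \<in> sets borel" by measurable
      next
        fix k show "0 \<le> c0 * (min 1 (2 powr (real k - real j)) * 2 powr (- (real k * (s * p)))) * B k"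
          using c0 B[of k] by simp
      next
        show "summable (\<lambda>k. decay (- \<epsilon>) j k * (c0 * (min 1 (2 powr (real k - real j)) * 2 powr (- (real k * (s * p)))) * B k))"
          using c0 by (intro kern(1)) simp
      qed
      also have "\<dots> \<le> ennreal (C1 * (c0 * 2 powr (- (real j * (s * p))) * h j))"
        using C1 c0 by (intro ennreal_leI mult_left_mono kern(2)) auto
      finally show ?thesis by (simp add: mult_ac)
    qed
    have mod: "(2 powr (real j * s) * modulus p G (2 powr (- real j))) powr q \<le> (C1 * c0) powr (q / p) * h j powr (q / p)" for j
    proof -
      have "modulus p G (2 powr (- real j)) powr p \<le> C1 * c0 * 2 powr (- (real j * (s * p))) * h j"
        using C1 c0 h0 by (intro modulus_powr_le[OF rep p] WG) auto
      then have "2 powr (real j * (s * p)) * modulus p G (2 powr (- real j)) powr p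
          \<le> 2 powr (real j * (s * p)) * (C1 * c0 * 2 powr (- (real j * (s * p))) * h j)"
        by (intro mult_left_mono) auto
      also have "\<dots> = (2 powr (real j * (s * p)) * 2 powr (- (real j * (s * p)))) * (C1 * c0 * h j)"
        by (simp only: mult_ac)
      also have "2 powr (real j * (s * p)) * 2 powr (- (real j * (s * p))) = (1::real)"
        by (subst powr_add[symmetric]) simp
      finally have "(2 powr (real j * (s * p)) * modulus p G (2 powr (- real j)) powr p) powr (q / p) \<le> (C1 * c0 * h j) powr (q / p)"
        using qp by (intro powr_mono2) auto
      then show ?thesis
        using p C1 c0 h0[of j] modulus_nonneg[OF rep p fin, of "2 powr (- real j)"]
        by (simp add: powr_mult powr_powr mult_ac)
    qed
    have sm2: "summable (\<lambda>j. (C1 * c0) powr (q / p) * h j powr (q / p))"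
      by (intro summable_mult hs)
    have sm3: "summable (\<lambda>j. (2 powr (real j * s) * modulus p G (2 powr (- real j))) powr q)"
      by (rule summable_comparison_test'[OF sm2, of 0]) (use mod in auto)
    have "(\<Sum>j. (2 powr (real j * s) * modulus p G (2 powr (- real j))) powr q)
        \<le> (\<Sum>j. (C1 * c0) powr (q / p) * h j powr (q / p))"
      by (intro suminf_le mod sm3 sm2)
    also have "\<dots> = (C1 * c0) powr (q / p) * (\<Sum>j. h j powr (q / p))"
      by (rule suminf_mult[OF hs(2)])
    finally have S: "(\<Sum>j. (2 powr (real j * s) * modulus p G (2 powr (- real j))) powr q)
        \<le> (C1 * c0) powr (q / p) * (\<Sum>j. h j powr (q / p))" .
    have "enn2real (Lp_power p G) \<le> C1 * h 0"
      using NG C1 h0[of 0] by (simp add: enn2real_leI)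
    then have "enn2real (Lp_power p G) powr (q / p) \<le> (C1 * h 0) powr (q / p)"
      using qp by (intro powr_mono2) auto
    also have "\<dots> = C1 powr (q / p) * h 0 powr (q / p)"
      by (rule powr_mult)
    also have "h 0 powr (q / p) \<le> (\<Sum>j. h j powr (q / p))"
      using sum_le_suminf[OF hs(2), of "{0}"] by simp
    finally have N: "enn2real (Lp_power p G) powr (q / p) \<le> C1 powr (q / p) * (\<Sum>j. h j powr (q / p))"
      by (simp add: mult_left_mono)
    have "besov_norm s p q G powr q \<le> C1 powr (q / p) * (\<Sum>j. h j powr (q / p))
        + 2 powr (s * q) * ((C1 * c0) powr (q / p) * (\<Sum>j. h j powr (q / p)))"
      by (rule order_trans[OF besov_of_summable(2)[OF rep p fin s q sm3]])
        (intro add_mono N mult_left_mono S, simp)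
    also have "\<dots> = (C1 powr (q / p) + 2 powr (s * q) * (C1 * c0) powr (q / p)) * (\<Sum>j. h j powr (q / p))"
      by (simp add: algebra_simps)
    also have "\<dots> \<le> (C1 powr (q / p) + 2 powr (s * q) * (C1 * c0) powr (q / p)) * (C2 * (\<Sum>k. B k powr (q / p)))"
      by (intro mult_left_mono hs) auto
    finally have "besov_norm s p q G powr q \<le> C * (\<Sum>k. B k powr (q / p))"
      by (simp add: C_def mult.assoc)
    with rep besov_of_summable(1)[OF rep p fin s q sm3]
    show "borel_rep (\<lambda>x. \<Sum>k. u k x) (\<lambda>x. \<Sum>k. u k x)" "(\<lambda>x. \<Sum>k. u k x) \<in> besov_space s p q"
       "besov_norm s p q (\<lambda>x. \<Sum>k. u k x) powr q \<le> C * (\<Sum>k. B k powr (q / p))"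
      by (simp_all add: G_def)
  qed
qed

section \<open>Functions in the Besov space are series of step functions\<close>

lemma Lp_power_add_le:
  fixes f g :: "real^'d \<Rightarrow> real"
  assumes [measurable]: "f \<in> borel_measurable borel" "g \<in> borel_measurable borel" and p: "0 < p"
  shows "Lp_power p (\<lambda>x. f x + g x) \<le> ennreal (2 powr p) * (Lp_power p f + Lp_power p g)"
proof -
  have "Lp_power p (\<lambda>x. f x + g x) \<le> (\<integral>\<^sup>+x. ennreal (2 powr p) * (ennreal (\<bar>f x\<bar> powr p) + ennreal (\<bar>g x\<bar> powr p)) \<partial>lborel)"
    unfolding Lp_power_def
  proof (rule nn_integral_mono)
    fix x
    have "\<bar>f x + g x\<bar> powr p \<le> 2 powr p * (\<bar>f x\<bar> powr p + \<bar>g x\<bar> powr p)"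
      by (intro abs_add_powr_le p)
    then show "ennreal (\<bar>f x + g x\<bar> powr p) \<le> ennreal (2 powr p) * (ennreal (\<bar>f x\<bar> powr p) + ennreal (\<bar>g x\<bar> powr p))"
      by (simp add: ennreal_plus[symmetric] ennreal_mult'[symmetric] del: ennreal_plus)
  qed
  also have "\<dots> = ennreal (2 powr p) * (Lp_power p f + Lp_power p g)"
    unfolding Lp_power_def by (subst nn_integral_cmult, measurable, subst nn_integral_add) auto
  finally show ?thesis .
qed

lemma Lp_power_minus: "Lp_power p (\<lambda>x. - f x) = Lp_power p f"
  by (simp add: Lp_power_def)

text \<open>
Two points of one cube are at distance at most \<open>d * 2 powr (- k)\<close>, and \<open>d \<le> 2 ^ d\<close>: a shift between them is a chain of \<open>2 ^ d\<close>
shifts of length at most \<open>2 powr (- k)\<close>.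
\<close>

lemma ex_dyadic_step_approx_modulus:
  fixes f :: "real^'d \<Rightarrow> real"
  assumes r: "borel_rep f f'" and p: "0 < p" and fin: "Lp_power p f' < \<infinity>"
  shows "\<exists>g. dyadic_step k g \<and> Lp_power p (\<lambda>x. f' x - g x)
    \<le> ennreal (2 ^ CARD('d) * (2 * 2 powr p) ^ CARD('d) * modulus p f (2 powr (- real k)) powr p)"
proof -
  have b: "f' \<in> borel_measurable borel" and out: "\<And>x. x \<notin> ucube \<Longrightarrow> f' x = 0"
    using r by (auto simp: borel_rep_def)
  define T where "T = (2 * 2 powr p) ^ CARD('d) * modulus p f (2 powr (- real k)) powr p"
  have T0: "0 \<le> T" by (simp add: T_def)
  have W: "shift_power p f' z \<le> ennreal T" if z: "\<And>l. \<bar>z $ l\<bar> \<le> 1 / 2 ^ k" for z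
  proof -
    have "norm z \<le> (\<Sum>l\<in>UNIV. \<bar>z $ l\<bar>)" by (rule norm_le_l1_cart)
    also have "\<dots> \<le> (\<Sum>l\<in>(UNIV :: 'd set). 1 / 2 ^ k)" by (intro sum_mono z)
    also have "\<dots> = CARD('d) * (1 / 2 ^ k)" by simp
    also have "\<dots> \<le> 2 ^ CARD('d) * (1 / 2 ^ k)"
      by (intro mult_right_mono) (simp_all add: less_imp_le)
    finally have "norm (z /\<^sub>R 2 ^ CARD('d)) \<le> 1 / 2 ^ k"
      by (simp add: field_simps)
    also have "1 / 2 ^ k = 2 powr (- real k)"
      by (simp add: powr_minus_divide powr_realpow)
    finally have "shift_power p f' (z /\<^sub>R 2 ^ CARD('d)) \<le> ennreal (modulus p f (2 powr (- real k)) powr p)"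
      by (rule shift_power_le_modulus[OF r p fin])
    then have "ennreal ((2 * 2 powr p) ^ CARD('d)) * shift_power p f' (z /\<^sub>R 2 ^ CARD('d))
        \<le> ennreal ((2 * 2 powr p) ^ CARD('d)) * ennreal (modulus p f (2 powr (- real k)) powr p)"
      by (rule mult_left_mono) simp
    also have "\<dots> = ennreal T" by (simp add: T_def ennreal_mult')
    finally show ?thesis
      by (rule order_trans[OF shift_power_le_shift_power_dyadic_fraction[OF b p]])
  qed
  obtain g where g: "dyadic_step k g" and le: "(\<integral>\<^sup>+x. ennreal (\<bar>f' x - g x\<bar> powr p) * indicator ucube x \<partial>lborel)
      \<le> ennreal (2 ^ CARD('d)) * ennreal T"
    using ex_dyadic_step_approx[OF b W] by blast
  have "Lp_power p (\<lambda>x. f' x - g x) = (\<integral>\<^sup>+x. ennreal (\<bar>f' x - g x\<bar> powr p) * indicator ucube x \<partial>lborel)"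
    unfolding Lp_power_def using out dyadic_step_outside[OF g] p by (intro nn_integral_cong) (auto simp: indicator_def)
  also note le
  also have "ennreal (2 ^ CARD('d)) * ennreal T = ennreal (2 ^ CARD('d) * (2 * 2 powr p) ^ CARD('d) * modulus p f (2 powr (- real k)) powr p)"
    using T0 by (simp add: ennreal_mult'[symmetric] T_def mult.assoc)
  finally show ?thesis using g by blast
qed

text \<open>
The series of the functions \<open>\<bar>f' - g k\<bar> powr p\<close> has finite integral, so it converges almost everywhere and its terms tend to 0.
\<close>

lemma AE_tendsto_of_summable_Lp_power:
  fixes f' :: "real^'d \<Rightarrow> real"
  assumes [measurable]: "f' \<in> borel_measurable borel" "\<And>k. g k \<in> borel_measurable borel" and p: "0 < p"
    and le: "\<And>k. Lp_power p (\<lambda>x. f' x - g k x) \<le> ennreal (T k)" and T: "\<And>k. 0 \<le> T k" "summable T"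
  shows "AE x in lborel. (\<lambda>k. g k x) \<longlonglongrightarrow> f' x"
proof -
  have "(\<integral>\<^sup>+x. (\<Sum>k. ennreal (\<bar>f' x - g k x\<bar> powr p)) \<partial>lborel) = (\<Sum>k. Lp_power p (\<lambda>x. f' x - g k x))"
    unfolding Lp_power_def by (rule nn_integral_suminf) measurable
  also have "\<dots> \<le> (\<Sum>k. ennreal (T k))" by (intro suminf_le le) auto
  also have "\<dots> = ennreal (\<Sum>k. T k)" by (intro suminf_ennreal2 T)
  finally have "(\<integral>\<^sup>+x. (\<Sum>k. ennreal (\<bar>f' x - g k x\<bar> powr p)) \<partial>lborel) \<noteq> \<infinity>"
    by (auto simp: top_unique)
  then have "AE x in lborel. (\<Sum>k. ennreal (\<bar>f' x - g k x\<bar> powr p)) \<noteq> \<infinity>"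
    by (intro nn_integral_PInf_AE) measurable
  then show ?thesis
  proof eventually_elim
    fix x assume "(\<Sum>k. ennreal (\<bar>f' x - g k x\<bar> powr p)) \<noteq> \<infinity>"
    then have "summable (\<lambda>k. \<bar>f' x - g k x\<bar> powr p)"
      by (intro summable_suminf_not_top) auto
    then have "(\<lambda>k. \<bar>f' x - g k x\<bar> powr p) \<longlonglongrightarrow> 0" by (rule summable_LIMSEQ_zero)
    then have "(\<lambda>k. (\<bar>f' x - g k x\<bar> powr p) powr (1 / p)) \<longlonglongrightarrow> 0 powr (1 / p)"
      using p by (intro tendsto_powr') auto
    then have "(\<lambda>k. \<bar>f' x - g k x\<bar>) \<longlonglongrightarrow> 0"
      using p by (simp add: powr_powr)
    then have "(\<lambda>k. f' x - g k x) \<longlonglongrightarrow> 0" by (rule tendsto_rabs_zero_cancel)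
    then have "(\<lambda>k. f' x - (f' x - g k x)) \<longlonglongrightarrow> f' x - 0" by (intro tendsto_intros)
    then show "(\<lambda>k. g k x) \<longlonglongrightarrow> f' x" by simp
  qed
qed

text \<open>
With approximations \<open>g k\<close> of level k the terms are \<open>g 0\<close> and the differences \<open>g (Suc j) - g j\<close>. The latter are bounded by the
modulus at \<open>2 powr (- j)\<close>, because the modulus is monotone, and \<open>g 0\<close> is bounded by the \<open>L_p\<close> quasi-norm.
\<close>

lemma besov_decomposition:
  fixes s p q :: real
  assumes p: "0 < p" and q: "0 < q" and s: "0 < s"
  shows "\<exists>C>0. \<forall>(f :: real^'d \<Rightarrow> real) f'. borel_rep f f' \<longrightarrow> f \<in> besov_space s p q \<longrightarrow>
    (\<exists>u B. step_series s p q u B \<and> (\<Sum>k. B k powr (q / p)) \<le> C * besov_norm s p q f powr q \<and>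
      (AE x in lborel. (\<lambda>k. u k x) sums f' x))"
proof -
  define c2 where "c2 = 2 ^ CARD('d) * (2 * 2 powr p) ^ CARD('d)"
  define c3 where "c3 = 2 powr p * (1 + c2 * (2 * 2 powr p)) + 2 powr p * (c2 + c2) * 2 powr (s * p)"
  define cD where "cD = (2 * 2 powr p) powr (q / p) + 2 * 2 powr (s * q)"
  define C where "C = c3 powr (q / p) * (1 + cD)"
  have c2: "0 < c2" by (simp add: c2_def)
  have c3: "0 < c3" using c2 by (simp add: c3_def add_pos_pos)
  have qp: "0 < q / p" using p q by simp
  have cD: "0 < cD" by (simp add: cD_def add_pos_pos)
  have C: "0 < C" using c3 cD by (simp add: C_def)
  show ?thesis
  proof (intro exI[of _ C] conjI[OF C] allI impI)
    fix f f' :: "real^'d \<Rightarrow> real"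
    assume r: "borel_rep f f'" and f: "f \<in> besov_space s p q"
    have b [measurable]: "f' \<in> borel_measurable borel" using r by (auto simp: borel_rep_def)
    note SB = summable_of_besov[OF r p s q f]
    note fin = SB(1)
    define N where "N = enn2real (Lp_power p f')"
    have N: "Lp_power p f' = ennreal N" using fin by (simp add: N_def)
    have N0: "0 \<le> N" by (simp add: N_def)
    define \<Omega> where "\<Omega> j = modulus p f (2 powr (- real j)) powr p" for j :: nat
    have \<Omega>0: "0 \<le> \<Omega> j" for j by (simp add: \<Omega>_def)
    have \<Omega>Suc: "\<Omega> (Suc j) \<le> \<Omega> j" for j
      unfolding \<Omega>_def using p
      by (intro powr_mono2 modulus_mono[OF r p fin] modulus_nonneg[OF r p fin]) auto
    have \<Omega>N: "\<Omega> 0 \<le> 2 * 2 powr p * N"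
      unfolding \<Omega>_def N_def by (rule modulus_powr_le_Lp_power[OF r p fin]) simp
    define D where "D j = (2 powr (real j * s) * modulus p f (2 powr (- real j))) powr q" for j :: nat
    have Dsm: "summable D" and Dle: "suminf D \<le> cD * besov_norm s p q f powr q"
      using SB by (simp_all add: D_def[abs_def] cD_def)
    have D\<Omega>: "(2 powr (real j * s * p) * \<Omega> j) powr (q / p) = D j" for j
      using p modulus_nonneg[OF r p fin, of "2 powr (- real j)"]
      by (simp add: D_def \<Omega>_def powr_mult powr_powr mult_ac)
    define B where "B k = c3 * (case k of 0 \<Rightarrow> N | Suc j \<Rightarrow> 2 powr (real j * s * p) * \<Omega> j)" for k
    have B0: "0 \<le> B k" for k using c3 N0 \<Omega>0 by (auto simp: B_def split: nat.split)
    have BSuc: "B (Suc j) powr (q / p) = c3 powr (q / p) * D j" for j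
      using c3 \<Omega>0 by (simp add: B_def powr_mult[of c3] D\<Omega>)
    have Bz: "B 0 powr (q / p) = c3 powr (q / p) * N powr (q / p)"
      using c3 N0 by (simp add: B_def powr_mult)
    have smB: "summable (\<lambda>k. B k powr (q / p))"
    proof -
      have "summable (\<lambda>k. B (Suc k) powr (q / p))"
        unfolding BSuc by (intro summable_mult Dsm)
      then show ?thesis by (rule iffD1[OF summable_Suc_iff])
    qed
    have bn: "N powr (q / p) \<le> besov_norm s p q f powr q"
      using besov_norm_powr[OF r p q] by (simp add: N_def)
    have Ble: "(\<Sum>k. B k powr (q / p)) \<le> C * besov_norm s p q f powr q"
    proof -
      have "(\<Sum>k. B k powr (q / p)) = B 0 powr (q / p) + (\<Sum>k. B (Suc k) powr (q / p))"
        using suminf_split_head[OF smB] by simp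
      also have "(\<Sum>k. B (Suc k) powr (q / p)) = c3 powr (q / p) * suminf D"
        unfolding BSuc by (rule suminf_mult[OF Dsm])
      also have "B 0 powr (q / p) + c3 powr (q / p) * suminf D
          \<le> c3 powr (q / p) * besov_norm s p q f powr q + c3 powr (q / p) * (cD * besov_norm s p q f powr q)"
        unfolding Bz by (intro add_mono mult_left_mono bn Dle) auto
      finally show ?thesis by (simp add: C_def algebra_simps)
    qed
    have "\<forall>k. \<exists>g. dyadic_step k g \<and> Lp_power p (\<lambda>x. f' x - g x) \<le> ennreal (c2 * \<Omega> k)"
      using ex_dyadic_step_approx_modulus[OF r p fin] by (simp add: c2_def \<Omega>_def)
    from choice[OF this] obtain g where g': "\<forall>k. dyadic_step k (g k) \<and> Lp_power p (\<lambda>x. f' x - g k x) \<le> ennreal (c2 * \<Omega> k)"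
      by (rule exE)
    have g: "dyadic_step k (g k)" and gE: "Lp_power p (\<lambda>x. f' x - g k x) \<le> ennreal (c2 * \<Omega> k)" for k
      using g' by auto
    have [measurable]: "g k \<in> borel_measurable borel" for k by (rule borel_dyadic_step[OF g])
    define u where "u k = (case k of 0 \<Rightarrow> g 0 | Suc j \<Rightarrow> (\<lambda>x. g (Suc j) x - g j x))" for k
    have u: "dyadic_step k (u k)" for k
      by (auto simp: u_def split: nat.split intro!: g dyadic_step_diff intro: dyadic_step_mono[OF _ g])
    have ule: "(LINT x|lborel. \<bar>u k x\<bar> powr p) \<le> 2 powr (- (real k * s * p)) * B k" for k
    proof (cases k)
      case 0
      have "Lp_power p (u 0) = Lp_power p (\<lambda>x. f' x + - (f' x - g 0 x))" by (simp add: u_def)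
      also have "\<dots> \<le> ennreal (2 powr p) * (Lp_power p f' + Lp_power p (\<lambda>x. - (f' x - g 0 x)))"
        by (intro Lp_power_add_le p) measurable
      also have "\<dots> \<le> ennreal (2 powr p) * (ennreal N + ennreal (c2 * (2 * 2 powr p * N)))"
        unfolding Lp_power_minus N using gE[of 0] \<Omega>N c2
        by (intro mult_left_mono add_mono order_refl order_trans[OF gE[of 0]] ennreal_leI) auto
      also have "\<dots> = ennreal (2 powr p * (1 + c2 * (2 * 2 powr p)) * N)"
        using N0 c2 by (simp add: ennreal_plus[symmetric] ennreal_mult'[symmetric] algebra_simps del: ennreal_plus)
      also have "\<dots> \<le> ennreal (c3 * N)"
        using N0 c2 by (intro ennreal_leI mult_right_mono) (auto simp: c3_def)
      finally have "ennreal (LINT x|lborel. \<bar>u 0 x\<bar> powr p) \<le> ennreal (c3 * N)"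
        by (simp only: Lp_power_dyadic_step_real[OF u p])
      then show ?thesis using 0 c3 N0 by (simp add: B_def)
    next
      case (Suc j)
      have "Lp_power p (u k) = Lp_power p (\<lambda>x. (f' x - g j x) + - (f' x - g (Suc j) x))" by (simp add: u_def Suc)
      also have "\<dots> \<le> ennreal (2 powr p) * (Lp_power p (\<lambda>x. f' x - g j x) + Lp_power p (\<lambda>x. - (f' x - g (Suc j) x)))"
        by (intro Lp_power_add_le p) measurable
      also have "\<dots> \<le> ennreal (2 powr p) * (ennreal (c2 * \<Omega> j) + ennreal (c2 * \<Omega> j))"
        unfolding Lp_power_minus using \<Omega>Suc[of j] c2
        by (intro mult_left_mono add_mono order_trans[OF gE] ennreal_leI) auto
      also have "\<dots> = ennreal (2 powr p * (c2 + c2) * \<Omega> j)"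
        using \<Omega>0[of j] c2 by (simp add: ennreal_plus[symmetric] ennreal_mult'[symmetric] algebra_simps del: ennreal_plus)
      finally have "ennreal (LINT x|lborel. \<bar>u k x\<bar> powr p) \<le> ennreal (2 powr p * (c2 + c2) * \<Omega> j)"
        by (simp only: Lp_power_dyadic_step_real[OF u p])
      then have L: "(LINT x|lborel. \<bar>u k x\<bar> powr p) \<le> 2 powr p * (c2 + c2) * \<Omega> j"
        using c2 \<Omega>0[of j] by simp
      have E: "2 powr (- (real k * s * p)) * (2 powr (s * p) * 2 powr (real j * s * p)) = (1::real)"
        by (simp add: Suc powr_add[symmetric] algebra_simps)
      have "2 powr (- (real k * s * p)) * ((2 powr p * (c2 + c2) * 2 powr (s * p)) * (2 powr (real j * s * p) * \<Omega> j))
          = (2 powr (- (real k * s * p)) * (2 powr (s * p) * 2 powr (real j * s * p))) * (2 powr p * (c2 + c2) * \<Omega> j)"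
        by (simp only: mult_ac)
      then have "2 powr p * (c2 + c2) * \<Omega> j
          = 2 powr (- (real k * s * p)) * ((2 powr p * (c2 + c2) * 2 powr (s * p)) * (2 powr (real j * s * p) * \<Omega> j))"
        by (simp only: E mult_1)
      also have "\<dots> \<le> 2 powr (- (real k * s * p)) * (c3 * (2 powr (real j * s * p) * \<Omega> j))"
        using c2 \<Omega>0[of j] by (intro mult_left_mono mult_right_mono) (auto simp: c3_def)
      finally show ?thesis using L by (simp add: B_def Suc)
    qed
    \<comment> \<open>The terms D are bounded, hence \<open>\<Omega>\<close> decays geometrically and the approximations converge almost everywhere.\<close>
    have sums: "AE x in lborel. (\<lambda>k. u k x) sums f' x"
    proof -
      define M where "M = suminf D powr (p / q)"
      have "\<Omega> k \<le> M * decay (s * p) 0 k" for k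
      proof -
        have "D k \<le> suminf D"
          using sum_le_suminf[OF Dsm, of "{k}"] by (simp add: D_def)
        then have "((2 powr (real k * s * p) * \<Omega> k) powr (q / p)) powr (p / q) \<le> M"
          unfolding D\<Omega> M_def using p q by (intro powr_mono2) (auto simp: D_def)
        then have "2 powr (real k * s * p) * \<Omega> k \<le> M"
          using p q \<Omega>0[of k] by (simp add: powr_powr)
        then have "2 powr (- (real k * s * p)) * (2 powr (real k * s * p) * \<Omega> k) \<le> 2 powr (- (real k * s * p)) * M"
          by (rule mult_left_mono) simp
        moreover have "2 powr (- (real k * s * p)) * 2 powr (real k * s * p) = (1::real)"
          by (subst powr_add[symmetric]) simp
        ultimately show ?thesis
          by (simp add: mult.assoc[symmetric] decay_def) (simp add: mult_ac)
      qed
      then have le: "c2 * \<Omega> k \<le> c2 * M * decay (s * p) 0 k" for k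
        using c2 by (simp add: mult.assoc)
      have "summable (\<lambda>k. c2 * M * decay (s * p) 0 k)"
        using s p by (intro summable_mult summable_decay) simp
      then have "summable (\<lambda>k. c2 * \<Omega> k)"
        by (rule summable_comparison_test'[where N=0]) (use le c2 \<Omega>0 in \<open>auto simp: abs_mult\<close>)
      then have "AE x in lborel. (\<lambda>k. g k x) \<longlonglongrightarrow> f' x"
        using c2 \<Omega>0 by (intro AE_tendsto_of_summable_Lp_power[OF _ _ p gE]) auto
      then show ?thesis
      proof eventually_elim
        fix x assume lim: "(\<lambda>k. g k x) \<longlonglongrightarrow> f' x"
        have "(\<Sum>k<Suc n. u k x) = g n x" for n
          by (induction n) (simp_all add: u_def)
        then have "(\<lambda>n. \<Sum>k<Suc n. u k x) \<longlonglongrightarrow> f' x" using lim by simp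
        then show "(\<lambda>k. u k x) sums f' x"
          unfolding sums_def by (rule LIMSEQ_imp_Suc)
      qed
    qed
    have "step_series s p q u B" using u B0 ule smB by (simp add: step_series_def)
    then show "\<exists>u B. step_series s p q u B \<and> (\<Sum>k. B k powr (q / p)) \<le> C * besov_norm s p q f powr q \<and>
      (AE x in lborel. (\<lambda>k. u k x) sums f' x)"
      using Ble sums by blast
  qed
qed

section \<open>The Haar system\<close>

text \<open>
The l-th Rademacher sign: 1 on the left half and -1 on the right half of the interval of level k that contains \<open>x $ l\<close>.
\<close>

definition rademacher :: "nat \<Rightarrow> real^'d \<Rightarrow> 'd \<Rightarrow> real"
  where "rademacher k x l = (if even (cell (Suc k) x l) then 1 else - 1)"

text \<open>
The Haar function on the cube with index m whose factors in the directions of X are univariate Haar functions and whose other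
factors are indicators. On the cube these are, up to the indexing, the characters of the group of sign vectors, so that products and expansions become
operations on the index sets X.
\<close>

definition cube_haar :: "nat \<Rightarrow> ('d \<Rightarrow> int) \<Rightarrow> 'd set \<Rightarrow> real^'d::finite \<Rightarrow> real"
  where "cube_haar k m X x = indicator (dyadic_cube k m) x * (\<Prod>l\<in>X. rademacher k x l)"

lemma mem_dyadic_interval_iff: "t \<in> dyadic_interval k i \<longleftrightarrow> \<lfloor>2 ^ k * t\<rfloor> = int i - 1"
proof -
  have "\<lfloor>2 ^ k * t\<rfloor> = int i - 1 \<longleftrightarrow> real_of_int (int i - 1) \<le> 2 ^ k * t \<and> 2 ^ k * t < real_of_int (int i - 1) + 1"
    by (rule floor_eq_iff)
  then show ?thesis by (simp add: dyadic_interval_def field_simps)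
qed

lemma haar1_eq:
  assumes "1 \<le> i"
  shows "haar1 k i t = (if \<lfloor>2 ^ k * t\<rfloor> = int i - 1 then if even \<lfloor>2 ^ Suc k * t\<rfloor> then 1 else - 1 else 0)"
proof -
  define n where "n = \<lfloor>2 ^ Suc k * t\<rfloor>"
  have "\<lfloor>2 ^ k * t\<rfloor> = \<lfloor>(2 ^ Suc k * t) / real_of_int 2\<rfloor>" by simp
  also have "\<dots> = n div 2" unfolding n_def by (rule floor_divide_real_eq_div) simp
  finally have div: "\<lfloor>2 ^ k * t\<rfloor> = n div 2" .
  have "t \<in> dyadic_interval (Suc k) (2 * i - 1) \<longleftrightarrow> n = 2 * int i - 2"
    using assms by (auto simp: mem_dyadic_interval_iff n_def of_nat_diff)
  moreover have "t \<in> dyadic_interval (Suc k) (2 * i) \<longleftrightarrow> n = 2 * int i - 1"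
    by (auto simp: mem_dyadic_interval_iff n_def)
  ultimately have "haar1 k i t = (if n = 2 * int i - 2 then 1 else if n = 2 * int i - 1 then - 1 else 0)"
    by (auto simp: haar1_def indicator_def)
  also have "\<dots> = (if n div 2 = int i - 1 then if even n then 1 else - 1 else 0)"
  proof (cases "even n")
    case True
    then obtain a where "n = 2 * a" by (rule evenE)
    then show ?thesis by auto
  next
    case False
    then obtain a where "n = 2 * a + 1" by (rule oddE)
    then show ?thesis by auto
  qed
  finally show ?thesis by (simp only: div n_def)
qed

lemma cube_haar_eq_prod:
  assumes "\<And>l. 1 \<le> i l" "\<And>l. m l = int (i l) - 1"
    and "\<And>l. \<psi> l = (if l \<in> X then haar1 k (i l) else indicator (dyadic_interval k (i l)))"
  shows "(\<Prod>l\<in>UNIV. \<psi> l (x $ l)) = cube_haar k m X x"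
proof -
  have "(\<Prod>l\<in>UNIV. \<psi> l (x $ l)) = (\<Prod>l\<in>UNIV. (if cell k x l = m l then 1 else 0) * (if l \<in> X then rademacher k x l else 1))"
    using assms by (intro prod.cong refl) (auto simp: haar1_eq indicator_def mem_dyadic_interval_iff rademacher_def cell_def)
  also have "\<dots> = (\<Prod>l\<in>UNIV. if cell k x l = m l then 1 else 0) * (\<Prod>l\<in>UNIV. if l \<in> X then rademacher k x l else 1)"
    by (rule prod.distrib)
  also have "(\<Prod>l\<in>UNIV. if l \<in> X then rademacher k x l else 1) = (\<Prod>l\<in>X. rademacher k x l)"
    by (simp add: prod.If_cases)
  also have "(\<Prod>l\<in>UNIV. if cell k x l = m l then 1 else 0) = (indicator (dyadic_cube k m) x :: real)"
    by (auto simp: indicator_def dyadic_cube_def fun_eq_iff intro!: prod_zero prod.neutral)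
  finally show ?thesis by (simp add: cube_haar_def)
qed

lemma haar_level_Suc_eq:
  "(haar_level (Suc k) :: (real^'d \<Rightarrow> real) set) = {cube_haar k m X | m X. m \<in> cells k \<and> X \<noteq> {}}"
proof (intro equalityI subsetI)
  fix h :: "real^'d \<Rightarrow> real" assume "h \<in> haar_level (Suc k)"
  then obtain \<psi> i where h: "h = (\<lambda>x. \<Prod>l\<in>UNIV. \<psi> l (x $ l))" and i: "\<And>l. i l \<in> {1..2 ^ k}"
    and \<psi>: "\<And>l. \<psi> l = haar1 k (i l) \<or> \<psi> l = indicator (dyadic_interval k (i l))"
    and ex: "\<exists>l. \<psi> l = haar1 k (i l)"
    by auto
  define m where "m l = int (i l) - 1" for l
  define X where "X = {l. \<psi> l = haar1 k (i l)}"
  have \<psi>': "\<psi> l = (if l \<in> X then haar1 k (i l) else indicator (dyadic_interval k (i l)))" for l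
    using \<psi>[of l] unfolding X_def mem_Collect_eq by (metis (full_types))
  have "h = cube_haar k m X"
    unfolding h using i by (intro ext cube_haar_eq_prod[where i=i] \<psi>') (auto simp: m_def)
  moreover have "m \<in> cells k"
  proof -
    have "0 \<le> m l \<and> m l < 2 ^ k" for l
    proof -
      have "int (i l) \<le> 2 ^ k"
        using of_nat_mono[of "i l" "2 ^ k", where 'a=int] i[of l] by simp
      moreover have "1 \<le> int (i l)" using i[of l] by simp
      ultimately show ?thesis unfolding m_def by linarith
    qed
    then show ?thesis by (simp add: cells_def)
  qed
  moreover have "X \<noteq> {}" using ex by (auto simp: X_def)
  ultimately show "h \<in> {cube_haar k m X | m X. m \<in> cells k \<and> X \<noteq> {}}" by blast
next
  fix h :: "real^'d \<Rightarrow> real" assume "h \<in> {cube_haar k m X | m X. m \<in> cells k \<and> X \<noteq> {}}"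
  then obtain m X where h: "h = cube_haar k m X" and m: "m \<in> cells k" and X: "X \<noteq> {}" by blast
  define i where "i l = nat (m l + 1)" for l
  define \<psi> where "\<psi> l = (if l \<in> X then haar1 k (i l) else indicator (dyadic_interval k (i l)))" for l
  have m': "0 \<le> m l" "m l < 2 ^ k" for l using m by (auto simp: cells_def)
  have i: "i l \<in> {1..2 ^ k}" for l
  proof -
    have "i l \<le> nat (2 ^ k)" unfolding i_def using m'[of l] by (intro nat_mono) simp
    then show ?thesis using m'[of l] by (simp add: i_def nat_power_eq)
  qed
  have "h = (\<lambda>x. \<Prod>l\<in>UNIV. \<psi> l (x $ l))"
    unfolding h
  proof (intro ext cube_haar_eq_prod[where i=i, symmetric])
    show "1 \<le> i l" for l using i[of l] by simp
    show "m l = int (i l) - 1" for l using m'(1)[of l] by (simp add: i_def)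
  qed (simp add: \<psi>_def)
  moreover have "\<forall>l. \<psi> l = haar1 k (i l) \<or> \<psi> l = indicator (dyadic_interval k (i l))" by (auto simp: \<psi>_def)
  moreover have "\<exists>l. \<psi> l = haar1 k (i l)" using X by (auto simp: \<psi>_def)
  ultimately show "h \<in> haar_level (Suc k)" using i by auto
qed

lemma abs_rademacher [simp]: "\<bar>rademacher k x l\<bar> = 1"
  by (simp add: rademacher_def)

lemma rademacher_mult_self [simp]: "rademacher k x l * rademacher k x l = 1"
  by (simp add: rademacher_def)

lemma abs_cube_haar: "\<bar>cube_haar k m X x\<bar> = indicator (dyadic_cube k m) x"
  by (simp add: cube_haar_def abs_mult abs_prod)

lemma rademacher_cong: "cell (Suc k) x = cell (Suc k) y \<Longrightarrow> rademacher k x = rademacher k y"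
  by (simp add: rademacher_def fun_eq_iff)

lemma dyadic_step_cube_haar:
  assumes "m \<in> cells k"
  shows "dyadic_step (Suc k) (cube_haar k m X)"
proof (rule dstepI)
  show "cube_haar k m X x = 0" if "x \<notin> ucube" for x
    using that dyadic_cube_subset_ucube[OF assms] by (auto simp: cube_haar_def indicator_def)
  show "cube_haar k m X x = cube_haar k m X y" if "cell (Suc k) x = cell (Suc k) y" for x y
    using rademacher_cong[OF that] cell_eq_mono[OF _ that, of k] by (simp add: cube_haar_def indicator_def dyadic_cube_def)
qed

lemma cube_haar_mult: "cube_haar k m X x * cube_haar k m Y x = cube_haar k m (X - Y \<union> (Y - X)) x"
proof -
  have "(\<Prod>l\<in>X. rademacher k x l) = (\<Prod>l\<in>X - Y. rademacher k x l) * (\<Prod>l\<in>X \<inter> Y. rademacher k x l)"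
    by (subst prod.union_disjoint[symmetric]) (auto intro!: prod.cong)
  moreover have "(\<Prod>l\<in>Y. rademacher k x l) = (\<Prod>l\<in>Y - X. rademacher k x l) * (\<Prod>l\<in>X \<inter> Y. rademacher k x l)"
    by (subst prod.union_disjoint[symmetric]) (auto intro!: prod.cong)
  moreover have "(\<Prod>l\<in>X \<inter> Y. rademacher k x l) * (\<Prod>l\<in>X \<inter> Y. rademacher k x l) = 1"
    by (simp add: prod.distrib[symmetric])
  moreover have "(\<Prod>l\<in>X - Y \<union> (Y - X). rademacher k x l) = (\<Prod>l\<in>X - Y. rademacher k x l) * (\<Prod>l\<in>Y - X. rademacher k x l)"
    by (rule prod.union_disjoint) auto
  ultimately have "(\<Prod>l\<in>X. rademacher k x l) * (\<Prod>l\<in>Y. rademacher k x l) = (\<Prod>l\<in>X - Y \<union> (Y - X). rademacher k x l)"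
    by (simp add: mult_ac)
  then show ?thesis
    by (simp add: cube_haar_def indicator_def)
qed

text \<open>
Exchanging the two halves of the cube in one of the directions in X is an involution of the subcubes that reverses the sign.
\<close>

lemma integral_cube_haar:
  fixes m :: "'d::finite \<Rightarrow> int"
  assumes "m \<in> cells k" "X \<noteq> {}"
  shows "(LINT x|lborel. cube_haar k m X x) = 0"
proof -
  obtain l where l: "l \<in> X" using assms by blast
  define A where "A = {n :: 'd \<Rightarrow> int. \<forall>i. n i div 2 = m i}"
  define g where "g n = (\<Prod>i\<in>X. if even (n i) then 1 else - 1 :: real)" for n :: "'d \<Rightarrow> int"
  have A: "finite A" using card_subcells(1)[of 1 m] by (simp add: A_def)
  have "cube_haar k m X x = g (cell (Suc k) x) * indicator {x. cell (Suc k) x \<in> A} x" for x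
    by (simp add: cube_haar_def g_def A_def rademacher_def indicator_def dyadic_cube_def fun_eq_iff cell_Suc_div[of k])
  then have I: "(LINT x|lborel. cube_haar k m X x) = (\<Sum>n\<in>A. g n * (1 / 2 ^ Suc k) ^ CARD('d))"
    using LINT_cells(2)[OF A, of g "Suc k"] by simp
  define flip where "flip n = n(l := if even (n l) then n l + 1 else n l - 1)" for n :: "'d \<Rightarrow> int"
  have ff: "flip (flip n) = n" for n by (auto simp: flip_def fun_eq_iff)
  have fA: "flip n \<in> A" if "n \<in> A" for n
  proof -
    have "(if even a then a + 1 else a - 1) div 2 = a div 2" for a :: int
      by (cases "even a") (auto elim!: evenE oddE)
    then have "flip n i div 2 = n i div 2" for i
      unfolding flip_def by (cases "i = l") (simp_all only: fun_upd_same fun_upd_other not_False_eq_True)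
    then show ?thesis using that by (simp add: A_def)
  qed
  have gf: "g (flip n) = - g n" for n
  proof -
    have "g (flip n) = (if even (flip n l) then 1 else - 1) * (\<Prod>i\<in>X - {l}. if even (flip n i) then 1 else - 1)"
      unfolding g_def using l by (subst prod.remove[of _ l]) auto
    also have "(\<Prod>i\<in>X - {l}. if even (flip n i) then 1 else - 1 :: real) = (\<Prod>i\<in>X - {l}. if even (n i) then 1 else - 1)"
      by (intro prod.cong) (auto simp: flip_def)
    also have "(if even (flip n l) then 1 else - 1) = - (if even (n l) then 1 else - 1 :: real)"
      by (simp add: flip_def)
    also have "- (if even (n l) then 1 else - 1 :: real) * (\<Prod>i\<in>X - {l}. if even (n i) then 1 else - 1) = - g n"
      unfolding g_def using l by (subst (2) prod.remove[of _ l]) auto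
    finally show ?thesis .
  qed
  have "(\<Sum>n\<in>A. g n) = (\<Sum>n\<in>A. g (flip n))"
    by (rule sum.reindex_bij_witness[of _ flip flip]) (auto simp: ff fA)
  also have "\<dots> = - (\<Sum>n\<in>A. g n)" by (simp add: gf sum_negf)
  finally have "(\<Sum>n\<in>A. g n) = 0" by simp
  then show ?thesis by (simp add: I sum_divide_distrib[symmetric] sum_distrib_right[symmetric])
qed

lemma finite_haar_level: "finite (haar_level k :: (real^'d \<Rightarrow> real) set)"
proof (cases k)
  case (Suc j)
  have "haar_level (Suc j) \<subseteq> (\<lambda>(m, X). cube_haar j m X :: real^'d \<Rightarrow> real) ` (cells j \<times> UNIV)"
    unfolding haar_level_Suc_eq by auto
  then show ?thesis unfolding Suc by (rule finite_subset) (simp add: finite_cells)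
qed simp

text \<open>
The Haar function of level 0 is the indicator of the closed cube and thus no dyadic step function; restricted to the half-open cube
it is one. On higher levels the restriction changes nothing.
\<close>

definition ucube_part :: "(real^'d \<Rightarrow> real) \<Rightarrow> real^'d \<Rightarrow> real"
  where "ucube_part h x = indicator ucube x * h x"

lemma ucube_subset_unit_cube: "ucube \<subseteq> unit_cube"
  by (auto simp: ucube_def mem_box_cart less_imp_le)

lemma dyadic_step_indicator_ucube: "dyadic_step 0 (indicator ucube)"
  by (rule dstepI) (auto simp: indicator_def mem_ucube_iff[of _ 0])

lemma haar_level_cases:
  fixes h :: "real^'d \<Rightarrow> real"
  assumes "h \<in> haar_level k"
  obtains (zero) "k = 0" "h = indicator unit_cube"
    | (Suc) j m X where "k = Suc j" "m \<in> cells j" "X \<noteq> {}" "h = cube_haar j m X"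
proof (cases k)
  case 0
  then show ?thesis using assms zero by simp
next
  case (Suc j)
  with assms have "h \<in> haar_level (Suc j)" by (simp only:)
  then have "h \<in> {cube_haar j m X | m X. m \<in> cells j \<and> X \<noteq> {}}"
    by (simp only: haar_level_Suc_eq)
  then show ?thesis using Suc that(2) by blast
qed

lemma ucube_part_cube_haar: "m \<in> cells j \<Longrightarrow> ucube_part (cube_haar j m X) = cube_haar j m X"
  using dyadic_cube_subset_ucube[of m j] by (auto simp: ucube_part_def fun_eq_iff cube_haar_def indicator_def)

text \<open>
All estimates of Haar coefficients use only this common shape of the absolute values. The subtraction \<open>k - 1\<close>, with
\<open>0 - 1 = 0\<close>, gives the correct level of the supporting cube also for \<open>k = 0\<close>.
\<close>

lemma abs_ucube_part_haar:
  fixes h :: "real^'d \<Rightarrow> real"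
  assumes "h \<in> haar_level k"
  shows "\<exists>m\<in>cells (k - 1). \<forall>x. \<bar>ucube_part h x\<bar> = indicator (dyadic_cube (k - 1) m) x"
  using assms
proof (cases rule: haar_level_cases)
  case zero
  have "\<bar>ucube_part h x\<bar> = indicator (dyadic_cube 0 (\<lambda>_. 0)) x" for x
    unfolding dyadic_cube_0 using zero ucube_subset_unit_cube by (auto simp: ucube_part_def indicator_def)
  then show ?thesis using zero by (auto simp: cells_0)
next
  case (Suc j m X)
  then show ?thesis by (auto simp: ucube_part_cube_haar abs_cube_haar)
qed

lemma dyadic_step_ucube_part_haar:
  fixes h :: "real^'d \<Rightarrow> real"
  assumes "h \<in> haar_level k"
  shows "dyadic_step k (ucube_part h)"
  using assms
proof (cases rule: haar_level_cases)
  case zero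
  have "ucube_part h = indicator ucube"
    using zero ucube_subset_unit_cube by (auto simp: ucube_part_def indicator_def fun_eq_iff)
  then show ?thesis using zero dyadic_step_indicator_ucube by simp
next
  case (Suc j m X)
  then show ?thesis by (simp add: ucube_part_cube_haar dyadic_step_cube_haar)
qed

lemma borel_haar:
  fixes h :: "real^'d \<Rightarrow> real"
  assumes "h \<in> haar_level k"
  shows "h \<in> borel_measurable borel"
  using assms
proof (cases rule: haar_level_cases)
  case (Suc j m X)
  then show ?thesis using borel_dyadic_step[OF dyadic_step_cube_haar[of m j X]] by simp
qed simp

lemma dyadic_step_times_ucube_part: "dyadic_step k u \<Longrightarrow> u x * ucube_part h x = u x * h x"
  using dyadic_step_outside[of k u x] by (auto simp: ucube_part_def indicator_def)

text \<open>
A step function of lower level is constant on the cube that supports h, and h has mean value zero.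
\<close>

lemma integral_dyadic_step_haar_eq_0:
  fixes h :: "real^'d \<Rightarrow> real"
  assumes u: "dyadic_step j u" and h: "h \<in> haar_level k" and jk: "j < k"
  shows "(LINT x|lborel. u x * h x) = 0"
  using h
proof (cases rule: haar_level_cases)
  case (Suc i m X)
  have u': "dyadic_step i u" using jk Suc by (intro dyadic_step_mono[OF _ u]) simp
  have "u x * h x = step_value i u m * cube_haar i m X x" for x
    using dyadic_step_eq_step_value[OF u', of x] by (auto simp: Suc cube_haar_def indicator_def dyadic_cube_def)
  then have "(\<lambda>x. u x * h x) = (\<lambda>x. step_value i u m * cube_haar i m X x)" by (rule ext)
  then show ?thesis by (simp only:) (simp add: integral_cube_haar Suc)
qed (use jk in simp)

lemma integral_ucube_part_haar_self:
  fixes h :: "real^'d \<Rightarrow> real"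
  assumes h: "h \<in> haar_level k"
  shows "(LINT x|lborel. ucube_part h x * h x) = (1 / 2 ^ (k - 1)) ^ CARD('d)"
proof -
  obtain m where m: "\<And>x. \<bar>ucube_part h x\<bar> = indicator (dyadic_cube (k - 1) m) x"
    using abs_ucube_part_haar[OF h] by blast
  have "ucube_part h x * h x = indicator (dyadic_cube (k - 1) m) x" for x
  proof -
    have "ucube_part h x * h x = \<bar>ucube_part h x\<bar> * \<bar>ucube_part h x\<bar>" by (simp add: ucube_part_def indicator_def)
    then show ?thesis by (simp add: m indicator_def)
  qed
  then show ?thesis by (simp add: measure_def emeasure_dyadic_cube)
qed

text \<open>
On different levels the function of lower level is constant where the other one lives. On one level either the supporting
cubes are disjoint, or the product is the Haar function of the symmetric difference of the two index sets.
\<close>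

lemma integral_haar_orthogonal:
  fixes h h' :: "real^'d \<Rightarrow> real"
  assumes h: "h \<in> haar_level j" and h': "h' \<in> haar_level k" and ne: "h \<noteq> h'"
  shows "(LINT x|lborel. ucube_part h x * h' x) = 0"
proof -
  have comm: "ucube_part h x * h' x = ucube_part h' x * h x" for x by (simp add: ucube_part_def)
  consider "j < k" | "k < j" | "j = k" by linarith
  then show ?thesis
  proof cases
    case 1
    then show ?thesis by (rule integral_dyadic_step_haar_eq_0[OF dyadic_step_ucube_part_haar[OF h] h'])
  next
    case 2
    then show ?thesis unfolding comm by (rule integral_dyadic_step_haar_eq_0[OF dyadic_step_ucube_part_haar[OF h'] h])
  next
    case 3
    from h show ?thesis
    proof (cases rule: haar_level_cases)
      case zero
      then show ?thesis using 3 h' ne by simp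
    next
      case (Suc i m X)
      with h' 3 have "h' \<in> haar_level (Suc i)" by simp
      then obtain m' X' where X': "m' \<in> cells i" "X' \<noteq> {}" "h' = cube_haar i m' X'"
        by (cases rule: haar_level_cases) auto
      show ?thesis
      proof (cases "m = m'")
        case True
        then have "X \<noteq> X'" using ne Suc X' by auto
        then have "X - X' \<union> (X' - X) \<noteq> {}" by blast
        then show ?thesis
          using True Suc X' by (simp add: ucube_part_cube_haar cube_haar_mult integral_cube_haar)
      next
        case False
        have "(\<lambda>x. ucube_part h x * h' x) = (\<lambda>x. 0)"
        proof (rule ext)
          fix x
          have "cube_haar i m X x = 0 \<or> cube_haar i m' X' x = 0"
            using False by (simp add: cube_haar_def indicator_def dyadic_cube_def)
          then show "ucube_part h x * h' x = 0"
            using Suc X' by (simp add: ucube_part_cube_haar)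
        qed
        then show ?thesis by (simp only:) simp
      qed
    qed
  qed
qed

lemma borel_rep_haar:
  fixes h :: "real^'d \<Rightarrow> real"
  assumes h: "h \<in> haar_level k"
  shows "borel_rep h (ucube_part h)"
proof -
  have "AE x in lebesgue_on unit_cube. h x = ucube_part h x"
    unfolding AE_unit_cube_lborel by (intro AE_I2) (simp add: ucube_part_def)
  moreover have "ucube_part h \<in> borel_measurable borel" by (rule borel_dyadic_step[OF dyadic_step_ucube_part_haar[OF h]])
  ultimately show ?thesis by (auto simp: borel_rep_def ucube_part_def)
qed

lemma haar_coeff_rep:
  fixes h :: "real^'d \<Rightarrow> real"
  assumes r: "borel_rep f f'" and h: "h \<in> haar_level k"
  shows "haar_coeff h f = (2 ^ (k - 1)) ^ CARD('d) * (LINT x|lborel. f' x * h x)"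
proof -
  have [measurable]: "f' \<in> borel_measurable borel" "h \<in> borel_measurable borel"
    using r borel_haar[OF h] by (auto simp: borel_rep_def)
  have I: "(LINT x|lebesgue_on unit_cube. f x * h x) = (LINT x|lborel. f' x * h x)"
    by (rule borel_rep_LINT(2)[OF r, of "\<lambda>x v. v * h x"]) auto
  note rh = borel_rep_haar[OF h]
  have "Lp_power 2 (ucube_part h) = ennreal (LINT x|lborel. \<bar>ucube_part h x\<bar> powr 2)"
    by (rule Lp_power_dyadic_step_real[OF dyadic_step_ucube_part_haar[OF h]]) simp
  also have "(\<lambda>x. \<bar>ucube_part h x\<bar> powr 2) = (\<lambda>x. ucube_part h x * h x)"
    by (auto simp: fun_eq_iff ucube_part_def indicator_def powr_numeral power2_eq_square)
  also have "(LINT x|lborel. ucube_part h x * h x) = (1 / 2 ^ (k - 1)) ^ CARD('d)"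
    by (rule integral_ucube_part_haar_self[OF h])
  finally have "Lp_power 2 (ucube_part h) = ennreal ((1 / 2 ^ (k - 1)) ^ CARD('d))" .
  then have "Lp_norm 2 unit_cube h = ((1 / 2 ^ (k - 1)) ^ CARD('d)) powr (1 / 2)"
    using borel_rep_Lp_space(2)[OF rh, of 2] by simp
  then have n2: "(Lp_norm 2 unit_cube h)\<^sup>2 = (1 / 2 ^ (k - 1)) ^ CARD('d)"
    by (simp add: powr_half_sqrt)
  then show ?thesis
    unfolding haar_coeff_def I n2 by (simp add: power_one_over field_simps)
qed

lemma card_UNIV_set: "card (UNIV :: 'd::finite set set) = 2 ^ CARD('d)"
  using card_Pow[of "UNIV :: 'd set"] by simp

section \<open>Haar coefficients and step functions level by level\<close>

text \<open>
Each cube supports fewer than \<open>2 ^ d\<close> Haar functions of the given level.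
\<close>

lemma sum_haar_level_le:
  fixes F :: "(real^'d \<Rightarrow> real) \<Rightarrow> real"
  assumes F: "\<And>h. 0 \<le> F h" and G: "\<And>m. 0 \<le> G m"
    and le: "\<And>h m. h \<in> haar_level k \<Longrightarrow> m \<in> cells (k - 1) \<Longrightarrow>
      (\<And>x. \<bar>ucube_part h x\<bar> = indicator (dyadic_cube (k - 1) m) x) \<Longrightarrow> F h \<le> G m"
  shows "(\<Sum>h\<in>haar_level k. F h) \<le> 2 ^ CARD('d) * (\<Sum>m\<in>cells (k - 1). G m)"
proof (cases k)
  case 0
  have "indicator unit_cube \<in> (haar_level 0 :: (real^'d \<Rightarrow> real) set)" by simp
  from abs_ucube_part_haar[OF this] obtain m where m: "m \<in> cells 0"
      "\<And>x. \<bar>ucube_part (indicator unit_cube) x\<bar> = indicator (dyadic_cube 0 (m :: 'd \<Rightarrow> int)) x" by auto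
  have "F (indicator unit_cube) \<le> G m"
    using m 0 by (intro le) auto
  also have "\<dots> = (\<Sum>m\<in>cells (k - 1). G m)" using m 0 by (simp add: cells_0)
  finally have "F (indicator unit_cube) \<le> (\<Sum>m\<in>cells (k - 1). G m)" .
  moreover have "1 * (\<Sum>m\<in>cells (k - 1). G m) \<le> 2 ^ CARD('d) * (\<Sum>m\<in>cells (k - 1). G m)"
    using G by (intro mult_right_mono sum_nonneg) auto
  ultimately show ?thesis using 0 by simp
next
  case (Suc j)
  define P where "P = (cells j :: ('d \<Rightarrow> int) set) \<times> {X :: 'd set. X \<noteq> {}}"
  have eq: "haar_level k = (\<lambda>(m, X). cube_haar j m X) ` P"
    unfolding Suc haar_level_Suc_eq P_def by auto
  have "(\<Sum>h\<in>haar_level k. F h) \<le> (\<Sum>(m, X)\<in>P. F (cube_haar j m X))"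
    unfolding eq by (rule order_trans[OF sum_image_le]) (auto simp: P_def F case_prod_beta comp_def)
  also have "\<dots> \<le> (\<Sum>(m, X)\<in>P. G m)"
  proof (rule sum_mono)
    fix mX assume mX: "mX \<in> P"
    obtain m X where [simp]: "mX = (m, X)" by (cases mX)
    have m: "m \<in> cells j" "X \<noteq> {}" using mX by (auto simp: P_def)
    have "F (cube_haar j m X) \<le> G m"
    proof (rule le)
      show "cube_haar j m X \<in> haar_level k" unfolding Suc haar_level_Suc_eq using m by blast
    qed (use m Suc in \<open>simp_all add: ucube_part_cube_haar abs_cube_haar\<close>)
    then show "(case mX of (m, X) \<Rightarrow> F (cube_haar j m X)) \<le> (case mX of (m, X) \<Rightarrow> G m)" by simp
  qed
  also have "\<dots> = (\<Sum>m\<in>cells j. \<Sum>X\<in>{X :: 'd set. X \<noteq> {}}. G m)"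
    unfolding P_def by (rule sum.cartesian_product[symmetric])
  also have "\<dots> = real (card {X :: 'd set. X \<noteq> {}}) * (\<Sum>m\<in>cells j. G m)"
    by (simp add: sum_distrib_left)
  also have "\<dots> \<le> 2 ^ CARD('d) * (\<Sum>m\<in>cells j. G m)"
  proof (intro mult_right_mono sum_nonneg G)
    have "card {X :: 'd set. X \<noteq> {}} \<le> card (UNIV :: 'd set set)" by (intro card_mono) auto
    then show "real (card {X :: 'd set. X \<noteq> {}}) \<le> 2 ^ CARD('d)"
      unfolding card_UNIV_set using of_nat_mono[where 'a=real] by fastforce
  qed
  finally show ?thesis using Suc by simp
qed

text \<open>
A coefficient is at most the mean of \<open>\<bar>u\<bar>\<close> over the supporting cube, and the p-th powers of these means are summed by
\<open>sum_local_L1_powr_le\<close>.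
\<close>

lemma haar_analysis_le:
  fixes u :: "real^'d \<Rightarrow> real" and p :: real
  assumes u: "dyadic_step j u" and kj: "k \<le> j" and p: "0 < p"
  shows "(\<Sum>h\<in>haar_level k. \<bar>(2 ^ (k - 1)) ^ CARD('d) * (LINT x|lborel. u x * h x)\<bar> powr p)
    \<le> 2 ^ CARD('d) * 2 powr (CARD('d) * max (1 - p) 0)
      * 2 powr (real k * CARD('d) + real (j - k) * (CARD('d) * max (1 - p) 0)) * (LINT x|lborel. \<bar>u x\<bar> powr p)"
proof -
  define K where "K = k - 1"
  define I where "I = (LINT x|lborel. \<bar>u x\<bar> powr p)"
  have I0: "0 \<le> I" unfolding I_def by (intro integral_nonneg_AE AE_I2) simp
  define G where "G m = ((2 ^ K) ^ CARD('d)) powr p * (LINT x|lborel. \<bar>u x\<bar> * indicator (dyadic_cube K m) x) powr p"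
    for m :: "'d \<Rightarrow> int"
  have "(\<Sum>h\<in>haar_level k. \<bar>(2 ^ (k - 1)) ^ CARD('d) * (LINT x|lborel. u x * h x)\<bar> powr p)
      \<le> 2 ^ CARD('d) * (\<Sum>m\<in>cells (k - 1). G m)"
  proof (rule sum_haar_level_le)
    fix h :: "real^'d \<Rightarrow> real" and m :: "'d \<Rightarrow> int"
    assume h: "h \<in> haar_level k" and m: "m \<in> cells (k - 1)"
      and ab: "\<And>x. \<bar>ucube_part h x\<bar> = indicator (dyadic_cube (k - 1) m) x"
    have "\<bar>LINT x|lborel. u x * h x\<bar> \<le> (LINT x|lborel. \<bar>u x * h x\<bar>)"
      by (rule integral_abs_bound)
    also have "(\<lambda>x. \<bar>u x * h x\<bar>) = (\<lambda>x. \<bar>u x\<bar> * indicator (dyadic_cube K m) x)"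
    proof (rule ext)
      fix x
      have "\<bar>u x * h x\<bar> = \<bar>u x * ucube_part h x\<bar>" by (simp only: dyadic_step_times_ucube_part[OF u])
      then show "\<bar>u x * h x\<bar> = \<bar>u x\<bar> * indicator (dyadic_cube K m) x"
        by (simp only: abs_mult ab K_def)
    qed
    finally have "\<bar>(2 ^ K) ^ CARD('d) * (LINT x|lborel. u x * h x)\<bar>
        \<le> (2 ^ K) ^ CARD('d) * (LINT x|lborel. \<bar>u x\<bar> * indicator (dyadic_cube K m) x)"
      by (simp add: abs_mult mult_left_mono)
    then have "\<bar>(2 ^ K) ^ CARD('d) * (LINT x|lborel. u x * h x)\<bar> powr p
        \<le> ((2 ^ K) ^ CARD('d) * (LINT x|lborel. \<bar>u x\<bar> * indicator (dyadic_cube K m) x)) powr p"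
      using p by (intro powr_mono2) auto
    also have "\<dots> = G m" unfolding G_def by (rule powr_mult)
    finally show "\<bar>(2 ^ (k - 1)) ^ CARD('d) * (LINT x|lborel. u x * h x)\<bar> powr p \<le> G m"
      by (simp add: K_def)
  qed (auto simp: G_def)
  also have "(\<Sum>m\<in>cells (k - 1). G m) = ((2 ^ K) ^ CARD('d)) powr p
      * (\<Sum>m\<in>cells K. (LINT x|lborel. \<bar>u x\<bar> * indicator (dyadic_cube K m) x) powr p)"
    by (simp add: G_def sum_distrib_left K_def)
  also have "\<dots> \<le> ((2 ^ K) ^ CARD('d)) powr p
      * (2 powr (CARD('d) * (real (j - K) * max (p - 1) 0 - j * (p - 1))) * I)"
    unfolding I_def using kj by (intro mult_left_mono sum_local_L1_powr_le[OF u _ p]) (auto simp: K_def)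
  also have "\<dots> = 2 powr (CARD('d) * (K + real (j - K) * max (1 - p) 0)) * I"
  proof -
    have jK: "real (j - K) = real j - real K" using kj by (simp add: K_def of_nat_diff)
    have "((2 ^ K) ^ CARD('d)) powr p = 2 powr (CARD('d) * (K * p))"
      by (simp add: powr_realpow[symmetric] powr_powr mult_ac)
    moreover have "CARD('d) * (K * p) + CARD('d) * (real (j - K) * max (p - 1) 0 - j * (p - 1))
        = CARD('d) * (K + real (j - K) * max (1 - p) 0)"
    proof -
      have mx: "max (p - 1) 0 = max (1 - p) 0 + (p - 1)" by (simp add: max_def)
      show ?thesis unfolding jK mx by (simp add: algebra_simps)
    qed
    ultimately show ?thesis by (simp add: powr_add[symmetric] mult.assoc[symmetric])
  qed
  also have "2 powr (CARD('d) * (K + real (j - K) * max (1 - p) 0)) * I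
    \<le> 2 powr (CARD('d) * max (1 - p) 0 + (real k * CARD('d) + real (j - k) * (CARD('d) * max (1 - p) 0))) * I"
  proof (intro mult_right_mono powr_mono I0)
    have "real (j - K) \<le> real (j - k) + 1" "real K \<le> real k" using kj by (auto simp: K_def)
    then have "K + real (j - K) * max (1 - p) 0 \<le> k + (real (j - k) + 1) * max (1 - p) 0"
      by (intro add_mono mult_right_mono) auto
    then have "CARD('d) * (K + real (j - K) * max (1 - p) 0) \<le> CARD('d) * (k + (real (j - k) + 1) * max (1 - p) 0)"
      by (intro mult_left_mono) auto
    then show "CARD('d) * (K + real (j - K) * max (1 - p) 0)
        \<le> CARD('d) * max (1 - p) 0 + (real k * CARD('d) + real (j - k) * (CARD('d) * max (1 - p) 0))"
      by (simp add: algebra_simps)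
  qed simp
  finally show ?thesis by (simp add: I_def powr_add mult.assoc)
qed

lemma card_haar_at_point:
  fixes x :: "real^'d"
  shows "card {h \<in> haar_level k. ucube_part h x \<noteq> 0} \<le> 2 ^ CARD('d)"
proof (cases k)
  case 0
  have "card {h \<in> haar_level k. ucube_part h x \<noteq> 0} \<le> card (haar_level k :: (real^'d \<Rightarrow> real) set)"
    by (intro card_mono finite_haar_level) auto
  also have "\<dots> \<le> 2 ^ CARD('d)" using 0 by simp
  finally show ?thesis .
next
  case (Suc j)
  have "{h \<in> haar_level k. ucube_part h x \<noteq> 0} \<subseteq> cube_haar j (cell j x) ` UNIV"
    unfolding Suc haar_level_Suc_eq by (auto simp: ucube_part_cube_haar cube_haar_def indicator_def dyadic_cube_def split: if_splits)
  then have "card {h \<in> haar_level k. ucube_part h x \<noteq> 0} \<le> card (cube_haar j (cell j x) ` UNIV)"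
    by (intro card_mono) auto
  also have "\<dots> \<le> card (UNIV :: 'd set set)" by (rule card_image_le) simp
  finally show ?thesis by (simp add: card_UNIV_set)
qed

definition haar_level_part :: "((real^'d \<Rightarrow> real) \<Rightarrow> real) \<Rightarrow> nat \<Rightarrow> real^'d \<Rightarrow> real"
  where "haar_level_part \<gamma> k x = (\<Sum>h\<in>haar_level k. \<gamma> h * ucube_part h x)"

lemma dyadic_step_haar_level_part: "dyadic_step k (haar_level_part \<gamma> k)"
  unfolding haar_level_part_def[abs_def] by (intro dyadic_step_sum dyadic_step_cmult dyadic_step_ucube_part_haar)

text \<open>
At each point at most \<open>2 ^ d\<close> terms of the level are nonzero, so that the p-th power of the sum is bounded by a constant times the
sum of the p-th powers.
\<close>

lemma haar_synthesis_le:
  fixes \<gamma> :: "(real^'d \<Rightarrow> real) \<Rightarrow> real" and p s :: real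
  assumes p: "0 < p"
  shows "(LINT x|lborel. \<bar>haar_level_part \<gamma> k x\<bar> powr p)
    \<le> 2 powr (- (real k * s * p)) * (2 ^ CARD('d) * (2 ^ CARD('d)) powr p * level_sum s p \<gamma> k)"
proof -
  define c :: real where "c = (2 ^ CARD('d)) powr p"
  have pt: "\<bar>haar_level_part \<gamma> k x\<bar> powr p \<le> (\<Sum>h\<in>haar_level k. c * \<bar>\<gamma> h\<bar> powr p * \<bar>ucube_part h x\<bar> powr p)" for x
  proof -
    define S where "S = {h \<in> haar_level k. ucube_part h x \<noteq> 0}"
    have fS: "finite S" unfolding S_def using finite_haar_level[where k=k and 'd='d] by simp
    have "haar_level_part \<gamma> k x = (\<Sum>h\<in>S. \<gamma> h * ucube_part h x)"
      unfolding haar_level_part_def S_def by (intro sum.mono_neutral_right finite_haar_level) auto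
    then have "\<bar>haar_level_part \<gamma> k x\<bar> \<le> (\<Sum>h\<in>S. \<bar>\<gamma> h * ucube_part h x\<bar>)" by (simp add: sum_abs)
    then have "\<bar>haar_level_part \<gamma> k x\<bar> powr p \<le> (\<Sum>h\<in>S. \<bar>\<gamma> h * ucube_part h x\<bar>) powr p"
      using p by (intro powr_mono2) auto
    also have "\<dots> \<le> real (2 ^ CARD('d)) powr p * (\<Sum>h\<in>S. \<bar>\<gamma> h * ucube_part h x\<bar> powr p)"
      using fS p card_haar_at_point[of k x] by (intro sum_powr_le_crude) (auto simp: S_def)
    also have "\<dots> = (\<Sum>h\<in>S. c * \<bar>\<gamma> h\<bar> powr p * \<bar>ucube_part h x\<bar> powr p)"
      by (simp add: c_def sum_distrib_left abs_mult powr_mult mult.assoc)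
    also have "\<dots> = (\<Sum>h\<in>haar_level k. c * \<bar>\<gamma> h\<bar> powr p * \<bar>ucube_part h x\<bar> powr p)"
      unfolding S_def using p by (intro sum.mono_neutral_left finite_haar_level) auto
    finally show ?thesis .
  qed
  have int: "integrable lborel (\<lambda>x. c * \<bar>\<gamma> h\<bar> powr p * \<bar>ucube_part h x\<bar> powr p)" if "h \<in> haar_level k" for h :: "real^'d \<Rightarrow> real"
    by (intro integrable_mult_right integrable_dyadic_step_powr[OF dyadic_step_ucube_part_haar[OF that] p])
  have L: "(LINT x|lborel. \<bar>ucube_part h x\<bar> powr p) = (1 / 2 ^ (k - 1)) ^ CARD('d)" if h: "h \<in> haar_level k" for h :: "real^'d \<Rightarrow> real"
  proof -
    obtain m where m: "\<And>x. \<bar>ucube_part h x\<bar> = indicator (dyadic_cube (k - 1) m) x" using abs_ucube_part_haar[OF h] by blast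
    have "(\<lambda>x. \<bar>ucube_part h x\<bar> powr p) = indicator (dyadic_cube (k - 1) m)"
      using p by (auto simp: m fun_eq_iff indicator_def)
    then show ?thesis by (simp add: measure_def emeasure_dyadic_cube)
  qed
  have "(LINT x|lborel. \<bar>haar_level_part \<gamma> k x\<bar> powr p)
      \<le> (LINT x|lborel. (\<Sum>h\<in>haar_level k. c * \<bar>\<gamma> h\<bar> powr p * \<bar>ucube_part h x\<bar> powr p))"
    by (intro integral_mono integrable_dyadic_step_powr[OF dyadic_step_haar_level_part p] Bochner_Integration.integrable_sum int pt)
  also have "\<dots> = (\<Sum>h\<in>haar_level k. c * \<bar>\<gamma> h\<bar> powr p * (1 / 2 ^ (k - 1)) ^ CARD('d))"
    by (subst Bochner_Integration.integral_sum[OF int]) (simp_all add: L)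
  also have "\<dots> \<le> (\<Sum>h\<in>haar_level k. 2 powr (- (real k * s * p)) * (2 ^ CARD('d) * c *
        (2 powr (real k * (s * p - real CARD('d))) * \<bar>\<gamma> h\<bar> powr p)))"
  proof (rule sum_mono)
    fix h :: "real^'d \<Rightarrow> real"
    have "(1 / 2 ^ (k - 1) :: real) \<le> 2 * (1 / 2 ^ k)"
      by (cases k) auto
    then have "(1 / 2 ^ (k - 1) :: real) ^ CARD('d) \<le> (2 * (1 / 2 ^ k)) ^ CARD('d)"
      by (intro power_mono) auto
    also have "\<dots> = 2 ^ CARD('d) * 2 powr (- (real k * CARD('d)))"
      by (simp add: power_mult_distrib powr_minus_divide powr_realpow[symmetric] powr_powr power_divide)
    also have "2 powr (- (real k * CARD('d))) = 2 powr (- (real k * s * p)) * 2 powr (real k * (s * p - real CARD('d)))"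
      by (simp add: powr_add[symmetric] algebra_simps)
    finally have "c * \<bar>\<gamma> h\<bar> powr p * (1 / 2 ^ (k - 1)) ^ CARD('d)
      \<le> c * \<bar>\<gamma> h\<bar> powr p * (2 ^ CARD('d) * (2 powr (- (real k * s * p)) * 2 powr (real k * (s * p - real CARD('d)))))"
      by (intro mult_left_mono) (auto simp: c_def)
    then show "c * \<bar>\<gamma> h\<bar> powr p * (1 / 2 ^ (k - 1)) ^ CARD('d)
      \<le> 2 powr (- (real k * s * p)) * (2 ^ CARD('d) * c * (2 powr (real k * (s * p - real CARD('d))) * \<bar>\<gamma> h\<bar> powr p))"
      by (simp only: mult_ac)
  qed
  also have "\<dots> = 2 powr (- (real k * s * p)) * (2 ^ CARD('d) * c * level_sum s p \<gamma> k)"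
    by (simp add: level_sum_def sum_distrib_left)
  finally show ?thesis by (simp add: c_def)
qed

text \<open>
On the larger cube, the indicator of the smaller cube is the product of the factors \<open>(1 + e l * rademacher k x l) / 2\<close>, since the
signs of the halves determine the subcube; multiplying out gives a sum over all index sets.
\<close>

lemma indicator_dyadic_cube_Suc:
  fixes m :: "'d::finite \<Rightarrow> int"
  defines "e \<equiv> \<lambda>l. if even (m l) then 1 else - 1 :: real"
  shows "indicator (dyadic_cube (Suc k) m) x
    = (\<Sum>X\<in>UNIV. (\<Prod>l\<in>X. e l) / 2 ^ CARD('d) * cube_haar k (\<lambda>l. m l div 2) X x)"
proof -
  let ?n = "\<lambda>l. m l div 2"
  have "indicator (dyadic_cube (Suc k) m) x = indicator (dyadic_cube k ?n) x * (\<Prod>l\<in>UNIV. (e l * rademacher k x l + 1) / 2)"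
  proof (cases "x \<in> dyadic_cube k ?n")
    case True
    then have div: "cell (Suc k) x l div 2 = m l div 2" for l
      using cell_Suc_div[of k x l] by (simp add: dyadic_cube_def fun_eq_iff)
    have val: "(e l * rademacher k x l + 1) / 2 = (if cell (Suc k) x l = m l then 1 else 0)" for l
    proof -
      have "even (cell (Suc k) x l) = even (m l) \<longleftrightarrow> cell (Suc k) x l = m l"
        using div[of l] by (metis even_iff_mod_2_eq_zero mult_div_mod_eq not_mod_2_eq_1_eq_0)
      then show ?thesis by (auto simp: e_def rademacher_def)
    qed
    have "(\<Prod>l\<in>UNIV. (e l * rademacher k x l + 1) / 2) = (indicator (dyadic_cube (Suc k) m) x :: real)"
      unfolding val by (auto simp: indicator_def dyadic_cube_def fun_eq_iff intro!: prod_zero prod.neutral)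
    then show ?thesis using True by simp
  next
    case False
    have "x \<notin> dyadic_cube (Suc k) m"
    proof
      assume "x \<in> dyadic_cube (Suc k) m"
      then have "cell k x = ?n"
        by (intro ext) (simp add: cell_Suc_div[of k x] dyadic_cube_def)
      then show False using False by (simp add: dyadic_cube_def)
    qed
    then show ?thesis using False by simp
  qed
  also have "(\<Prod>l\<in>UNIV. (e l * rademacher k x l + 1) / 2) = (\<Prod>l\<in>UNIV. e l * rademacher k x l + 1) / 2 ^ CARD('d)"
    by (simp add: prod_dividef)
  also have "(\<Prod>l\<in>UNIV. e l * rademacher k x l + 1) = (\<Sum>X\<in>UNIV. \<Prod>l\<in>X. e l * rademacher k x l)"
    by (subst prod_add) simp_all
  also have "indicator (dyadic_cube k ?n) x * ((\<Sum>X\<in>UNIV. \<Prod>l\<in>X. e l * rademacher k x l) / 2 ^ CARD('d))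
      = (\<Sum>X\<in>UNIV. (\<Prod>l\<in>X. e l) / 2 ^ CARD('d) * cube_haar k ?n X x)"
    by (simp add: cube_haar_def prod.distrib sum_distrib_left sum_divide_distrib mult_ac)
  finally show ?thesis .
qed

lemma integrable_times_cube_haar:
  fixes f :: "real^'d \<Rightarrow> real"
  assumes "integrable lborel f"
  shows "integrable lborel (\<lambda>x. f x * cube_haar k m X x)"
proof -
  have "cube_haar k m X \<in> borel_measurable borel"
  proof -
    have [measurable]: "(\<lambda>x. rademacher k x l) \<in> borel_measurable borel" for l :: 'd
      unfolding rademacher_def by measurable
    show ?thesis unfolding cube_haar_def[abs_def] by measurable
  qed
  then show ?thesis
    using assms by (intro Bochner_Integration.integrable_bound[OF assms])
      (auto simp: abs_mult abs_cube_haar indicator_def intro!: AE_I2)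
qed

text \<open>
By induction on the level, since the indicator of a smaller cube is a combination of Haar functions on the larger cube and of the
indicator of the latter.
\<close>

lemma integral_dyadic_cube_eq_0:
  fixes f :: "real^'d \<Rightarrow> real"
  assumes f: "integrable lborel f" and out: "\<And>x. x \<notin> ucube \<Longrightarrow> f x = 0"
    and z: "\<And>h. h \<in> haar_system \<Longrightarrow> (LINT x|lborel. f x * h x) = 0"
    and m: "m \<in> cells k"
  shows "(LINT x|lborel. f x * indicator (dyadic_cube k m) x) = 0"
  using m
proof (induction k arbitrary: m)
  case 0
  then have "m = (\<lambda>_. 0)" by (simp add: cells_0)
  then have "(\<lambda>x. f x * indicator (dyadic_cube 0 m) x) = (\<lambda>x. f x * indicator unit_cube x)"
    using out ucube_subset_unit_cube by (simp only: dyadic_cube_0) (auto simp: fun_eq_iff indicator_def)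
  moreover have "indicator unit_cube \<in> (haar_system :: (real^'d \<Rightarrow> real) set)"
    unfolding haar_system_def by (intro UN_I[of 0]) auto
  ultimately show ?case using z by simp
next
  case (Suc k)
  let ?n = "\<lambda>l. m l div 2"
  define e where "e = (\<lambda>l. if even (m l) then 1 else - 1 :: real)"
  have half: "a div 2 < b" if "a < 2 * b" for a b :: int using that by presburger
  have n: "?n \<in> cells k" using Suc.prems half by (simp add: cells_def pos_imp_zdiv_nonneg_iff)
  have zero: "(LINT x|lborel. f x * cube_haar k ?n X x) = 0" for X
  proof (cases "X = {}")
    case True
    then have "(\<lambda>x. f x * cube_haar k ?n X x) = (\<lambda>x. f x * indicator (dyadic_cube k ?n) x)"
      by (simp add: cube_haar_def)
    then show ?thesis using Suc.IH[OF n] by simp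
  next
    case False
    then have "cube_haar k ?n X \<in> haar_level (Suc k)" unfolding haar_level_Suc_eq using n by blast
    then have "cube_haar k ?n X \<in> haar_system" unfolding haar_system_def by blast
    then show ?thesis by (rule z)
  qed
  have "(LINT x|lborel. f x * indicator (dyadic_cube (Suc k) m) x)
     = (LINT x|lborel. (\<Sum>X\<in>UNIV. (\<Prod>l\<in>X. e l) / 2 ^ CARD('d) * (f x * cube_haar k ?n X x)))"
    unfolding indicator_dyadic_cube_Suc e_def by (simp add: sum_distrib_left mult_ac)
  also have "\<dots> = (\<Sum>X\<in>UNIV. (LINT x|lborel. (\<Prod>l\<in>X. e l) / 2 ^ CARD('d) * (f x * cube_haar k ?n X x)))"
    by (intro Bochner_Integration.integral_sum integrable_mult_right integrable_times_cube_haar f)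
  also have "\<dots> = 0" by (simp add: zero)
  finally show ?case .
qed

section \<open>Haar coefficients of series\<close>

lemma abs_haar_le_1:
  fixes h :: "real^'d \<Rightarrow> real"
  assumes "h \<in> haar_level k"
  shows "\<bar>h x\<bar> \<le> 1"
  using assms
proof (cases rule: haar_level_cases)
  case zero
  then show ?thesis by (simp add: indicator_def)
next
  case (Suc j m X)
  then show ?thesis by (simp add: abs_cube_haar indicator_def)
qed

lemma L1_series:
  fixes u :: "nat \<Rightarrow> real^'d \<Rightarrow> real"
  assumes u: "\<And>k. dyadic_step k (u k)" and sm: "summable (\<lambda>k. LINT x|lborel. \<bar>u k x\<bar>)"
    and ae: "AE x in lborel. summable (\<lambda>k. \<bar>u k x\<bar>)"
    and f [measurable]: "f \<in> borel_measurable borel" and sums: "AE x in lborel. (\<lambda>k. u k x) sums f x"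
    and h [measurable]: "h \<in> borel_measurable borel" and h1: "\<And>x. \<bar>h x\<bar> \<le> 1"
  shows "integrable lborel (\<lambda>x. f x * h x)"
    and "(\<lambda>k. LINT x|lborel. u k x * h x) sums (LINT x|lborel. f x * h x)"
proof -
  have [measurable]: "u k \<in> borel_measurable borel" for k by (rule borel_dyadic_step[OF u])
  have le: "\<bar>u k x * h x\<bar> \<le> \<bar>u k x\<bar>" for k x
    using h1[of x] by (simp add: abs_mult mult_left_le)
  have I: "integrable lborel (\<lambda>x. u k x * h x)" for k
    by (rule Bochner_Integration.integrable_bound[OF integrable_dyadic_step[OF u[of k]]]) (use le in auto)
  have S: "AE x in lborel. summable (\<lambda>k. norm (u k x * h x))"
    using ae
  proof eventually_elim
    fix x assume "summable (\<lambda>k. \<bar>u k x\<bar>)"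
    then show "summable (\<lambda>k. norm (u k x * h x))"
      by (rule summable_comparison_test'[where N=0]) (use le[of _ x] in auto)
  qed
  have S2: "summable (\<lambda>k. LINT x|lborel. norm (u k x * h x))"
  proof (rule summable_comparison_test'[OF sm, of 0])
    fix k
    have "(LINT x|lborel. norm (u k x * h x)) \<le> (LINT x|lborel. \<bar>u k x\<bar>)"
      using le by (intro integral_mono integrable_norm I integrable_abs integrable_dyadic_step[OF u]) auto
    then show "norm (LINT x|lborel. norm (u k x * h x)) \<le> (LINT x|lborel. \<bar>u k x\<bar>)"
      by simp
  qed
  have eq: "AE x in lborel. (\<Sum>k. u k x * h x) = f x * h x"
    using sums by eventually_elim (auto dest: sums_mult2 sums_unique[symmetric])
  show "integrable lborel (\<lambda>x. f x * h x)"
    by (rule integrable_cong_AE_imp[OF integrable_suminf[OF I S S2] _ eq]) measurable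
  have "(LINT x|lborel. (\<Sum>k. u k x * h x)) = (LINT x|lborel. f x * h x)"
    using eq by (intro integral_cong_AE) measurable
  then show "(\<lambda>k. LINT x|lborel. u k x * h x) sums (LINT x|lborel. f x * h x)"
    using sums_integral[OF I S S2] by simp
qed

lemma dyadic_step_compose: "dyadic_step k u \<Longrightarrow> F 0 = 0 \<Longrightarrow> dyadic_step k (\<lambda>x. F (u x))"
  by (rule dstepI) (simp add: dyadic_step_outside, rule arg_cong[where f=F], rule dstepD)

lemma integral_times_dyadic_step_eq_0:
  fixes f :: "real^'d \<Rightarrow> real"
  assumes f: "integrable lborel f"
    and z: "\<And>m. m \<in> cells k \<Longrightarrow> (LINT x|lborel. f x * indicator (dyadic_cube k m) x) = 0"
    and v: "dyadic_step k v"
  shows "(LINT x|lborel. f x * v x) = 0"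
proof -
  have "f x * v x = (\<Sum>m\<in>cells k. step_value k v m * (f x * indicator (dyadic_cube k m) x))" for x
  proof -
    have "v x = v x * (\<Sum>m\<in>cells k. indicator (dyadic_cube k m) x)"
      unfolding indicator_ucube_sum[symmetric] using dyadic_step_outside[OF v, of x] by (auto simp: indicator_def)
    also have "\<dots> = (\<Sum>m\<in>cells k. step_value k v m * indicator (dyadic_cube k m) x)"
      unfolding sum_distrib_left using dyadic_step_eq_step_value[OF v, of x]
      by (intro sum.cong refl) (auto simp: dyadic_cube_def indicator_def)
    finally have vx: "v x = (\<Sum>m\<in>cells k. step_value k v m * indicator (dyadic_cube k m) x)" .
    show ?thesis by (simp only: vx sum_distrib_left mult_ac)
  qed
  then have "(LINT x|lborel. f x * v x) = (LINT x|lborel. (\<Sum>m\<in>cells k. step_value k v m * (f x * indicator (dyadic_cube k m) x)))"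
    by presburger
  also have "\<dots> = (\<Sum>m\<in>cells k. LINT x|lborel. step_value k v m * (f x * indicator (dyadic_cube k m) x))"
    by (intro Bochner_Integration.integral_sum integrable_mult_right integrable_real_mult_indicator f) simp
  also have "\<dots> = 0" by (simp add: z)
  finally show ?thesis .
qed

text \<open>
The integral of f against every dyadic step function vanishes. The signs of the partial sums are such step functions, and
f times these signs tends to \<open>\<bar>f\<bar>\<close> almost everywhere, dominated by \<open>\<bar>f\<bar>\<close>.
\<close>

lemma AE_zero_of_haar_zero:
  fixes f :: "real^'d \<Rightarrow> real"
  assumes f: "integrable lborel f" and out: "\<And>x. x \<notin> ucube \<Longrightarrow> f x = 0"
    and u: "\<And>k. dyadic_step k (u k)" and sums: "AE x in lborel. (\<lambda>k. u k x) sums f x"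
    and z: "\<And>h. h \<in> haar_system \<Longrightarrow> (LINT x|lborel. f x * h x) = 0"
  shows "AE x in lborel. f x = 0"
proof -
  have [measurable]: "f \<in> borel_measurable borel" using f by auto
  define v where "v n x = sgn (\<Sum>k<n. u k x)" for n x
  have v: "dyadic_step n (v n)" for n
    unfolding v_def[abs_def] by (rule dyadic_step_compose[where F=sgn, OF dyadic_step_sum]) (auto intro: dyadic_step_mono[OF _ u])
  have [measurable]: "v n \<in> borel_measurable borel" for n by (rule borel_dyadic_step[OF v])
  have zero: "(LINT x|lborel. f x * v n x) = 0" for n
    by (rule integral_times_dyadic_step_eq_0[OF f _ v]) (rule integral_dyadic_cube_eq_0[OF f out z])
  have "(\<lambda>n. LINT x|lborel. f x * v n x) \<longlonglongrightarrow> (LINT x|lborel. \<bar>f x\<bar>)"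
  proof (rule integral_dominated_convergence[where w="\<lambda>x. \<bar>f x\<bar>"])
    show "AE x in lborel. (\<lambda>n. f x * v n x) \<longlonglongrightarrow> \<bar>f x\<bar>"
      using sums
    proof eventually_elim
      fix x assume "(\<lambda>k. u k x) sums f x"
      then have lim: "(\<lambda>n. \<Sum>k<n. u k x) \<longlonglongrightarrow> f x" by (simp add: sums_def)
      show "(\<lambda>n. f x * v n x) \<longlonglongrightarrow> \<bar>f x\<bar>"
      proof (cases "f x = 0")
        case False
        then have "(\<lambda>n. f x * v n x) \<longlonglongrightarrow> f x * sgn (f x)"
          unfolding v_def by (intro tendsto_mult tendsto_const tendsto_sgn lim)
        then show ?thesis by (simp add: mult_sgn_abs abs_sgn)
      qed simp
    qed
    show "AE x in lborel. norm (f x * v n x) \<le> \<bar>f x\<bar>" for n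
      by (intro AE_I2) (simp add: v_def abs_mult abs_sgn_eq)
  qed (use f in auto)
  then have "(LINT x|lborel. \<bar>f x\<bar>) = 0" by (simp add: zero LIMSEQ_const_iff)
  then have "AE x in lborel. \<bar>f x\<bar> = 0"
    using f by (subst (asm) integral_nonneg_eq_0_iff_AE) auto
  then show ?thesis by simp
qed

lemma haar_level_unique:
  fixes h :: "real^'d \<Rightarrow> real"
  assumes "h \<in> haar_level j" "h \<in> haar_level k"
  shows "j = k"
proof -
  have F: False if "i < l" "h \<in> haar_level i" "h \<in> haar_level l" for i l
    using integral_dyadic_step_haar_eq_0[OF dyadic_step_ucube_part_haar[OF that(2)] that(3,1)] integral_ucube_part_haar_self[OF that(2)] by simp
  show ?thesis
    using F[of j k] F[of k j] assms by (cases j k rule: linorder_cases) auto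
qed

lemma integral_haar_level_part:
  fixes h :: "real^'d \<Rightarrow> real"
  assumes h: "h \<in> haar_level j"
  shows "(LINT x|lborel. haar_level_part \<gamma> k x * h x) = (if k = j then \<gamma> h * (1 / 2 ^ (j - 1)) ^ CARD('d) else 0)"
proof -
  have int: "integrable lborel (\<lambda>x. \<gamma> h' * (ucube_part h' x * h x))" if "h' \<in> haar_level k" for h' :: "real^'d \<Rightarrow> real"
  proof (intro integrable_mult_right Bochner_Integration.integrable_bound[OF integrable_dyadic_step[OF dyadic_step_ucube_part_haar[OF that]]])
    have [measurable]: "ucube_part h' \<in> borel_measurable borel" "h \<in> borel_measurable borel"
      using borel_dyadic_step[OF dyadic_step_ucube_part_haar[OF that]] borel_haar[OF h] by auto
    show "(\<lambda>x. ucube_part h' x * h x) \<in> borel_measurable lborel" by measurable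
    show "AE x in lborel. norm (ucube_part h' x * h x) \<le> norm (ucube_part h' x)"
      using abs_haar_le_1[OF h] by (intro AE_I2) (simp add: abs_mult mult_left_le)
  qed
  have "(LINT x|lborel. haar_level_part \<gamma> k x * h x) = (LINT x|lborel. (\<Sum>h'\<in>haar_level k. \<gamma> h' * (ucube_part h' x * h x)))"
    by (simp add: haar_level_part_def sum_distrib_right mult.assoc)
  also have "\<dots> = (\<Sum>h'\<in>haar_level k. LINT x|lborel. \<gamma> h' * (ucube_part h' x * h x))"
    by (rule Bochner_Integration.integral_sum[OF int])
  also have "\<dots> = (\<Sum>h'\<in>haar_level k. if h' = h then \<gamma> h * (1 / 2 ^ (j - 1)) ^ CARD('d) else 0)"
    using integral_haar_orthogonal[OF _ h] integral_ucube_part_haar_self[OF h] by (intro sum.cong refl) auto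
  also have "\<dots> = (if h \<in> haar_level k then \<gamma> h * (1 / 2 ^ (j - 1)) ^ CARD('d) else 0)"
    by (simp add: finite_haar_level)
  also have "h \<in> haar_level k \<longleftrightarrow> k = j" using haar_level_unique[OF h] h by blast
  finally show ?thesis .
qed

section \<open>The Haar map and its inverse\<close>

lemma level_sum_nonneg: "0 \<le> level_sum s p \<gamma> k"
  by (simp add: level_sum_def sum_nonneg)

text \<open>
The parts of the levels of the expansion form a step series; its sum has the prescribed coefficients because the series may be
integrated termwise against each Haar function.
\<close>

lemma besov_of_sequence:
  fixes s p q :: real
  assumes p: "0 < p" and q: "0 < q" and s: "0 < s" and sp: "s * p < 1"
    and sig: "CARD('d) * max (1 - p) 0 < s * p"
  shows "\<exists>C>0. \<forall>\<gamma>\<in>lqlp_space s p q. \<exists>G :: real^'d \<Rightarrow> real. G \<in> besov_space s p q \<and> haar_map G = \<gamma> \<and>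
    besov_norm s p q G powr q \<le> C * (\<Sum>k. level_sum s p \<gamma> k powr (q / p))"
proof -
  obtain C where C: "0 < C" and syn: "\<forall>(u :: nat \<Rightarrow> real^'d \<Rightarrow> real) B. step_series s p q u B \<longrightarrow>
    borel_rep (\<lambda>x. \<Sum>k. u k x) (\<lambda>x. \<Sum>k. u k x) \<and> (\<lambda>x. \<Sum>k. u k x) \<in> besov_space s p q \<and>
    besov_norm s p q (\<lambda>x. \<Sum>k. u k x) powr q \<le> C * (\<Sum>k. B k powr (q / p))"
    using besov_synthesis[OF p q s sp sig] by blast
  define c where "c = 2 ^ CARD('d) * (2 ^ CARD('d)) powr p"
  have c: "0 < c" by (simp add: c_def)
  show ?thesis
  proof (rule exI[of _ "C * c powr (q / p)"], intro conjI ballI)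
    show "0 < C * c powr (q / p)" using C c by simp
    fix \<gamma> :: "(real^'d \<Rightarrow> real) \<Rightarrow> real" assume \<gamma>: "\<gamma> \<in> lqlp_space s p q"
    define B where "B k = c * level_sum s p \<gamma> k" for k
    have B: "0 \<le> B k" for k using c level_sum_nonneg[of s p \<gamma> k] by (simp add: B_def)
    have Bp: "B k powr (q / p) = c powr (q / p) * level_sum s p \<gamma> k powr (q / p)" for k
      unfolding B_def by (rule powr_mult)
    have sml: "summable (\<lambda>k. level_sum s p \<gamma> k powr (q / p))" using \<gamma> by (simp add: lqlp_space_def)
    have sm: "summable (\<lambda>k. B k powr (q / p))" unfolding Bp by (intro summable_mult sml)
    have le: "(LINT x|lborel. \<bar>haar_level_part \<gamma> k x\<bar> powr p) \<le> 2 powr (- (real k * s * p)) * B k" for k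
      using haar_synthesis_le[OF p, of \<gamma> k s] by (simp add: B_def c_def)
    have ser: "step_series s p q (haar_level_part \<gamma>) B"
      using dyadic_step_haar_level_part B le sm by (auto simp: step_series_def)
    define G where "G = (\<lambda>x. \<Sum>k. haar_level_part \<gamma> k x)"
    have "borel_rep G G \<and> G \<in> besov_space s p q \<and> besov_norm s p q G powr q \<le> C * (\<Sum>k. B k powr (q / p))"
      unfolding G_def by (rule syn[rule_format, OF ser])
    then have rep: "borel_rep G G" and GB: "G \<in> besov_space s p q"
      and nG: "besov_norm s p q G powr q \<le> C * (\<Sum>k. B k powr (q / p))" by auto
    have [measurable]: "G \<in> borel_measurable borel" using rep by (simp add: borel_rep_def)
    note L1 = step_series_L1[OF p q sig ser]
    have sums: "AE x in lborel. (\<lambda>k. haar_level_part \<gamma> k x) sums G x"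
      using L1(2) by eventually_elim (simp add: G_def summable_sums summable_rabs_cancel)
    have "haar_coeff h G = \<gamma> h" if h: "h \<in> haar_level j" for h :: "real^'d \<Rightarrow> real" and j
    proof -
      have "(\<lambda>k. LINT x|lborel. haar_level_part \<gamma> k x * h x) sums (LINT x|lborel. G x * h x)"
        by (rule L1_series(2)[OF dyadic_step_haar_level_part L1 _ sums borel_haar[OF h] abs_haar_le_1[OF h]]) measurable
      moreover have "(\<lambda>k. LINT x|lborel. haar_level_part \<gamma> k x * h x) sums (\<gamma> h * (1 / 2 ^ (j - 1)) ^ CARD('d))"
        unfolding integral_haar_level_part[OF h] by (rule sums_single)
      ultimately have "(LINT x|lborel. G x * h x) = \<gamma> h * (1 / 2 ^ (j - 1)) ^ CARD('d)"
        by (rule sums_unique2)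
      then show ?thesis
        unfolding haar_coeff_rep[OF rep h] by (simp add: power_one_over)
    qed
    then have "haar_map G = \<gamma>"
      using \<gamma> by (auto simp: haar_map_def fun_eq_iff haar_system_def lqlp_space_def)
    moreover have "(\<Sum>k. B k powr (q / p)) = c powr (q / p) * (\<Sum>k. level_sum s p \<gamma> k powr (q / p))"
      unfolding Bp by (rule suminf_mult[OF sml])
    ultimately show "\<exists>G :: real^'d \<Rightarrow> real. G \<in> besov_space s p q \<and> haar_map G = \<gamma> \<and>
        besov_norm s p q G powr q \<le> C * c powr (q / p) * (\<Sum>k. level_sum s p \<gamma> k powr (q / p))"
      using GB nG by (intro exI[of _ G]) (simp add: mult.assoc)
  qed
qed

text \<open>
The coefficients of level k are series over the levels \<open>j \<ge> k\<close> of a decomposition. Their p-th powers are estimated with weights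
centred at k, then summed over the Haar functions of the level, and finally over k by Hardy's inequality.
\<close>

lemma sequence_of_besov:
  fixes s p q :: real
  assumes p: "0 < p" and q: "0 < q" and s: "0 < s"
    and sig: "CARD('d) * max (1 - p) 0 < s * p"
  shows "\<exists>C>0. \<forall>f :: real^'d \<Rightarrow> real. f \<in> besov_space s p q \<longrightarrow>
    haar_map f \<in> lqlp_space s p q \<and>
    (\<Sum>k. level_sum s p (haar_map f) k powr (q / p)) \<le> C * besov_norm s p q f powr q"
proof -
  define \<sigma> where "\<sigma> = CARD('d) * max (1 - p) 0"
  \<comment> \<open>Half of the rate at which the contribution of level j to the coefficients of level k decays.\<close>
  define \<epsilon> where "\<epsilon> = (s * p - \<sigma>) / 2"
  have e: "0 < \<epsilon>" using sig by (simp add: \<epsilon>_def \<sigma>_def)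
  have e2: "2 * \<epsilon> = s * p - \<sigma>" by (simp add: \<epsilon>_def)
  have qp: "0 < q / p" using p q by simp
  obtain C0 where C0: "0 < C0" and dec: "\<forall>(f :: real^'d \<Rightarrow> real) f'. borel_rep f f' \<longrightarrow> f \<in> besov_space s p q \<longrightarrow>
    (\<exists>u B. step_series s p q u B \<and> (\<Sum>k. B k powr (q / p)) \<le> C0 * besov_norm s p q f powr q \<and>
      (AE x in lborel. (\<lambda>k. u k x) sums f' x))"
    using besov_decomposition[OF p q s, where 'd='d] by blast
  define C1 where "C1 = weight_const p \<epsilon>"
  have C1: "0 < C1" unfolding C1_def by (rule weight_const_pos[OF p e])
  define C2 where "C2 = hardy_const (q / p) \<epsilon>"
  have C2: "0 < C2" unfolding C2_def by (rule hardy_const_pos[OF qp e])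
  define c where "c = 2 ^ CARD('d) * 2 powr \<sigma>"
  have c: "0 < c" by (simp add: c_def)
  define C where "C = (C1 * c) powr (q / p) * (C2 * C0)"
  have C: "0 < C" using C0 C1 C2 c by (simp add: C_def)
  show ?thesis
  proof (rule exI[of _ C], intro conjI allI impI C)
    fix f :: "real^'d \<Rightarrow> real" assume f: "f \<in> besov_space s p q"
    then have "f \<in> borel_measurable (lebesgue_on unit_cube)" by (simp add: besov_space_def Lp_space_def)
    then obtain f' where r: "borel_rep f f'" using ex_borel_rep by blast
    have [measurable]: "f' \<in> borel_measurable borel" using r by (simp add: borel_rep_def)
    obtain u B where ser: "step_series s p q u B"
      and Ble: "(\<Sum>k. B k powr (q / p)) \<le> C0 * besov_norm s p q f powr q"
      and sums: "AE x in lborel. (\<lambda>k. u k x) sums f' x"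
      using dec[rule_format, OF r f] by blast
    note u = step_seriesD(1)[OF ser] and B = step_seriesD(2)[OF ser]
      and le = step_seriesD(3)[OF ser] and sm = step_seriesD(4)[OF ser]
    note L1 = step_series_L1[OF p q sig ser]
    define \<H> where "\<H> k = (\<Sum>j. decay \<epsilon> k j * B j)" for k
    have hs: "summable (\<lambda>j. decay \<epsilon> k j * B j)" "summable (\<lambda>k. \<H> k powr (q / p))"
        "(\<Sum>k. \<H> k powr (q / p)) \<le> C2 * (\<Sum>k. B k powr (q / p))" for k
      using discrete_hardy[OF qp e B sm] unfolding \<H>_def C2_def by auto
    have H0: "0 \<le> \<H> k" for k
      unfolding \<H>_def by (intro suminf_nonneg hs(1)) (simp add: B)
    define a where "a k h j = \<bar>(2 ^ (k - 1)) ^ CARD('d) * (LINT x|lborel. u j x * h x)\<bar>" for k h j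
    have a0: "0 \<le> a k h j" for k h j by (simp add: a_def)
    have sum_a: "(\<Sum>h\<in>haar_level k. a k h j powr p) \<le> c * 2 powr (- (real k * (s * p - CARD('d)))) * (decay (2 * \<epsilon>) k j * B j)" for k j
    proof (cases "k \<le> j")
      case True
      have "(\<Sum>h\<in>haar_level k. a k h j powr p) \<le> c * 2 powr (real k * CARD('d) + real (j - k) * \<sigma>) * (LINT x|lborel. \<bar>u j x\<bar> powr p)"
        using haar_analysis_le[OF u True p] by (simp add: a_def c_def \<sigma>_def)
      also have "\<dots> \<le> c * 2 powr (real k * CARD('d) + real (j - k) * \<sigma>) * (2 powr (- (real j * s * p)) * B j)"
        using c by (intro mult_left_mono le) auto
      also have "\<dots> = c * (2 powr (real k * CARD('d) + real (j - k) * \<sigma>) * 2 powr (- (real j * s * p))) * B j"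
        by (simp only: mult_ac)
      also have "2 powr (real k * CARD('d) + real (j - k) * \<sigma>) * 2 powr (- (real j * s * p))
          = 2 powr (- (real k * (s * p - CARD('d)))) * decay (2 * \<epsilon>) k j"
        unfolding decay_def e2 powr_add[symmetric] using True by (simp add: of_nat_diff algebra_simps)
      finally show ?thesis by (simp only: mult_ac)
    next
      case False
      then have "a k h j = 0" if "h \<in> haar_level k" for h
        using integral_dyadic_step_haar_eq_0[OF u that, of j] by (simp add: a_def)
      then have "(\<Sum>h\<in>haar_level k. a k h j powr p) = 0" by simp
      then show ?thesis using c B[of j] by simp
    qed
    have dd: "decay (- \<epsilon>) k j * decay (2 * \<epsilon>) k j = decay \<epsilon> k j" for k j by (simp add: decay_mult)
    have sum_ad: "(\<Sum>h\<in>haar_level k. decay (- \<epsilon>) k j * a k h j powr p)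
        \<le> c * 2 powr (- (real k * (s * p - CARD('d)))) * (decay \<epsilon> k j * B j)" for k j
    proof -
      have "(\<Sum>h\<in>haar_level k. decay (- \<epsilon>) k j * a k h j powr p) = decay (- \<epsilon>) k j * (\<Sum>h\<in>haar_level k. a k h j powr p)"
        by (simp add: sum_distrib_left)
      also have "\<dots> \<le> decay (- \<epsilon>) k j * (c * 2 powr (- (real k * (s * p - CARD('d)))) * (decay (2 * \<epsilon>) k j * B j))"
        by (intro mult_left_mono sum_a) simp
      also have "\<dots> = c * 2 powr (- (real k * (s * p - CARD('d)))) * ((decay (- \<epsilon>) k j * decay (2 * \<epsilon>) k j) * B j)"
        by (simp only: mult_ac)
      finally show ?thesis unfolding dd .
    qed
    have smc: "summable (\<lambda>j. c * 2 powr (- (real k * (s * p - CARD('d)))) * (decay \<epsilon> k j * B j))" for k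
      by (intro summable_mult hs)
    have sma: "summable (\<lambda>j. decay (- \<epsilon>) k j * a k h j powr p)" if h: "h \<in> haar_level k" for h k
    proof (rule summable_comparison_test'[OF smc[of k], of 0])
      fix j
      have "decay (- \<epsilon>) k j * a k h j powr p \<le> (\<Sum>h\<in>haar_level k. decay (- \<epsilon>) k j * a k h j powr p)"
        by (rule member_le_sum[OF h]) (simp_all add: finite_haar_level)
      also note sum_ad
      finally show "norm (decay (- \<epsilon>) k j * a k h j powr p) \<le> c * 2 powr (- (real k * (s * p - CARD('d)))) * (decay \<epsilon> k j * B j)"
        by simp
    qed
    have coeff: "\<bar>haar_map f h\<bar> powr p \<le> C1 * (\<Sum>j. decay (- \<epsilon>) k j * a k h j powr p)" if h: "h \<in> haar_level k" for h k
    proof -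
      have w: "summable (a k h)" "suminf (a k h) powr p \<le> C1 * (\<Sum>j. decay (- \<epsilon>) k j * a k h j powr p)"
        using weighted_suminf_powr_le[OF p e a0 sma[OF h]] unfolding C1_def by auto
      have "(\<lambda>j. (2 ^ (k - 1)) ^ CARD('d) * (LINT x|lborel. u j x * h x)) sums ((2 ^ (k - 1)) ^ CARD('d) * (LINT x|lborel. f' x * h x))"
        by (intro sums_mult L1_series(2)[OF u L1 _ sums borel_haar[OF h] abs_haar_le_1[OF h]]) measurable
      then have "haar_coeff h f = (\<Sum>j. (2 ^ (k - 1)) ^ CARD('d) * (LINT x|lborel. u j x * h x))"
        unfolding haar_coeff_rep[OF r h] by (rule sums_unique)
      also have "\<bar>\<dots>\<bar> \<le> suminf (a k h)"
        unfolding a_def by (rule summable_rabs) (use w(1) in \<open>simp add: a_def[abs_def]\<close>)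
      finally have "\<bar>haar_coeff h f\<bar> powr p \<le> suminf (a k h) powr p"
        using p by (intro powr_mono2) auto
      also note w(2)
      finally show ?thesis using h by (auto simp: haar_map_def haar_system_def)
    qed
    have lev: "level_sum s p (haar_map f) k \<le> C1 * c * \<H> k" for k
    proof -
      have "(\<Sum>h\<in>haar_level k. \<bar>haar_map f h\<bar> powr p) \<le> (\<Sum>h\<in>haar_level k. C1 * (\<Sum>j. decay (- \<epsilon>) k j * a k h j powr p))"
        by (intro sum_mono coeff)
      also have "\<dots> = C1 * (\<Sum>j. \<Sum>h\<in>haar_level k. decay (- \<epsilon>) k j * a k h j powr p)"
        by (subst suminf_sum, erule sma, rule sum_distrib_left[symmetric])
      also have "(\<Sum>j. \<Sum>h\<in>haar_level k. decay (- \<epsilon>) k j * a k h j powr p)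
          \<le> (\<Sum>j. c * 2 powr (- (real k * (s * p - CARD('d)))) * (decay \<epsilon> k j * B j))"
        by (intro suminf_le sum_ad summable_sum sma smc)
      also have "\<dots> = c * 2 powr (- (real k * (s * p - CARD('d)))) * \<H> k"
        unfolding \<H>_def by (rule suminf_mult[OF hs(1)])
      finally have le1: "(\<Sum>h\<in>haar_level k. \<bar>haar_map f h\<bar> powr p) \<le> C1 * (c * 2 powr (- (real k * (s * p - CARD('d)))) * \<H> k)"
        using C1 by (simp add: mult_left_mono)
      have "level_sum s p (haar_map f) k = 2 powr (real k * (s * p - CARD('d))) * (\<Sum>h\<in>haar_level k. \<bar>haar_map f h\<bar> powr p)"
        by (simp add: level_sum_def sum_distrib_left)
      also have "\<dots> \<le> 2 powr (real k * (s * p - CARD('d))) * (C1 * (c * 2 powr (- (real k * (s * p - CARD('d)))) * \<H> k))"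
        by (intro mult_left_mono le1) simp
      also have "\<dots> = (2 powr (real k * (s * p - CARD('d))) * 2 powr (- (real k * (s * p - CARD('d))))) * (C1 * c * \<H> k)"
        by (simp only: mult_ac)
      also have "2 powr (real k * (s * p - CARD('d))) * 2 powr (- (real k * (s * p - CARD('d)))) = (1::real)"
        by (subst powr_add[symmetric]) simp
      finally show ?thesis by simp
    qed
    have levp: "level_sum s p (haar_map f) k powr (q / p) \<le> (C1 * c) powr (q / p) * \<H> k powr (q / p)" for k
    proof -
      have "level_sum s p (haar_map f) k powr (q / p) \<le> (C1 * c * \<H> k) powr (q / p)"
        using qp level_sum_nonneg by (intro powr_mono2 lev) auto
      then show ?thesis by (simp only: powr_mult[of "C1 * c"])
    qed
    have smH: "summable (\<lambda>k. (C1 * c) powr (q / p) * \<H> k powr (q / p))" by (intro summable_mult hs)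
    have smL: "summable (\<lambda>k. level_sum s p (haar_map f) k powr (q / p))"
      by (rule summable_comparison_test'[OF smH, of 0]) (use levp in auto)
    then show "haar_map f \<in> lqlp_space s p q"
      by (simp add: lqlp_space_def haar_map_def)
    have "(\<Sum>k. level_sum s p (haar_map f) k powr (q / p)) \<le> (\<Sum>k. (C1 * c) powr (q / p) * \<H> k powr (q / p))"
      by (intro suminf_le levp smL smH)
    also have "\<dots> = (C1 * c) powr (q / p) * (\<Sum>k. \<H> k powr (q / p))"
      by (rule suminf_mult[OF hs(2)])
    also have "\<dots> \<le> (C1 * c) powr (q / p) * (C2 * (C0 * besov_norm s p q f powr q))"
      using C2 by (intro mult_left_mono order_trans[OF hs(3)] Ble) auto
    finally show "(\<Sum>k. level_sum s p (haar_map f) k powr (q / p)) \<le> C * besov_norm s p q f powr q"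
      by (simp add: C_def mult.assoc)
  qed
qed

lemma besov_ex_borel_rep: "f \<in> besov_space s p q \<Longrightarrow> \<exists>f'. borel_rep f f'"
  by (rule ex_borel_rep) (simp add: besov_space_def Lp_space_def)

lemma besov_ex_series:
  fixes f :: "real^'d \<Rightarrow> real" and s p q :: real
  assumes p: "0 < p" and q: "0 < q" and s: "0 < s" and f: "f \<in> besov_space s p q" and r: "borel_rep f f'"
  shows "\<exists>u B. step_series s p q u B \<and> (AE x in lborel. (\<lambda>k. u k x) sums f' x)"
  using besov_decomposition[OF p q s, where 'd='d] f r by blast

lemma besov_integrable_haar:
  fixes f :: "real^'d \<Rightarrow> real" and s p q :: real
  assumes p: "0 < p" and q: "0 < q" and s: "0 < s"
    and sig: "CARD('d) * max (1 - p) 0 < s * p"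
    and f: "f \<in> besov_space s p q" and r: "borel_rep f f'"
  shows "integrable lborel f'"
    and "h \<in> haar_level k \<Longrightarrow> integrable lborel (\<lambda>x. f' x * h x)"
    and "(\<And>h. h \<in> haar_system \<Longrightarrow> haar_coeff h f = 0) \<Longrightarrow> AE x in lborel. f' x = 0"
proof -
  have b: "f' \<in> borel_measurable borel" and out: "\<And>x. x \<notin> ucube \<Longrightarrow> f' x = 0"
    using r by (auto simp: borel_rep_def)
  obtain u B where ser: "step_series s p q u B" and sums: "AE x in lborel. (\<lambda>k. u k x) sums f' x"
    using besov_ex_series[OF p q s f r] by blast
  note u = step_seriesD(1)[OF ser]
  note L1 = step_series_L1[OF p q sig ser]
  show int: "integrable lborel f'"
    using L1_series(1)[OF u L1 b sums, of "\<lambda>x. 1"] by simp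
  show "integrable lborel (\<lambda>x. f' x * h x)" if "h \<in> haar_level k"
    by (rule L1_series(1)[OF u L1 b sums borel_haar[OF that] abs_haar_le_1[OF that]])
  assume z: "\<And>h. h \<in> haar_system \<Longrightarrow> haar_coeff h f = 0"
  have z0: "(LINT x|lborel. f' x * h x) = 0" if h: "h \<in> haar_system" for h
  proof -
    obtain k where "h \<in> haar_level k" using h by (auto simp: haar_system_def)
    then show ?thesis using z[OF h] haar_coeff_rep[OF r, of h k] by simp
  qed
  show "AE x in lborel. f' x = 0"
    by (rule AE_zero_of_haar_zero[OF int out u sums z0])
qed

text \<open>
The corresponding combination of two decompositions is a step series again, and its sum is the combination of f and g
almost everywhere.
\<close>

lemma besov_lincomb:
  fixes f g :: "real^'d \<Rightarrow> real" and s p q a b :: real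
  assumes p: "0 < p" and q: "0 < q" and s: "0 < s" and sp: "s * p < 1"
    and sig: "CARD('d) * max (1 - p) 0 < s * p"
    and f: "f \<in> besov_space s p q" and g: "g \<in> besov_space s p q"
  shows "(\<lambda>x. a * f x + b * g x) \<in> besov_space s p q"
proof -
  obtain f' g' where rf: "borel_rep f f'" and rg: "borel_rep g g'"
    using besov_ex_borel_rep[OF f] besov_ex_borel_rep[OF g] by blast
  obtain u B where useries: "step_series s p q u B" and usums: "AE x in lborel. (\<lambda>k. u k x) sums f' x"
    using besov_ex_series[OF p q s f rf] by blast
  obtain v D where vseries: "step_series s p q v D" and vsums: "AE x in lborel. (\<lambda>k. v k x) sums g' x"
    using besov_ex_series[OF p q s g rg] by blast
  note u = step_seriesD(1)[OF useries] and B = step_seriesD(2)[OF useries]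
    and ule = step_seriesD(3)[OF useries] and Bsm = step_seriesD(4)[OF useries]
  note v = step_seriesD(1)[OF vseries] and D = step_seriesD(2)[OF vseries]
    and vle = step_seriesD(3)[OF vseries] and Dsm = step_seriesD(4)[OF vseries]
  define w where "w k x = a * u k x + b * v k x" for k x
  define E where "E k = 2 powr p * (\<bar>a\<bar> powr p * B k + \<bar>b\<bar> powr p * D k)" for k
  have w: "dyadic_step k (w k)" for k
    unfolding w_def[abs_def] by (intro dyadic_step_add dyadic_step_cmult u v)
  have E: "0 \<le> E k" for k using B[of k] D[of k] by (simp add: E_def)
  have wle: "(LINT x|lborel. \<bar>w k x\<bar> powr p) \<le> 2 powr (- (real k * s * p)) * E k" for k
  proof -
    have Iu: "integrable lborel (\<lambda>x. \<bar>a\<bar> powr p * \<bar>u k x\<bar> powr p)"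
      and Iv: "integrable lborel (\<lambda>x. \<bar>b\<bar> powr p * \<bar>v k x\<bar> powr p)"
      by (intro integrable_mult_right integrable_dyadic_step_powr[OF u p] integrable_dyadic_step_powr[OF v p])+
    have "(LINT x|lborel. \<bar>w k x\<bar> powr p) \<le> (LINT x|lborel. 2 powr p * (\<bar>a\<bar> powr p * \<bar>u k x\<bar> powr p + \<bar>b\<bar> powr p * \<bar>v k x\<bar> powr p))"
    proof (intro integral_mono integrable_dyadic_step_powr[OF w p] integrable_mult_right Bochner_Integration.integrable_add Iu Iv)
      fix x
      show "\<bar>w k x\<bar> powr p \<le> 2 powr p * (\<bar>a\<bar> powr p * \<bar>u k x\<bar> powr p + \<bar>b\<bar> powr p * \<bar>v k x\<bar> powr p)"
        using abs_add_powr_le[OF p, of "a * u k x" "b * v k x"] by (simp add: w_def abs_mult powr_mult)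
    qed (rule integrable_dyadic_step_powr[OF u p] integrable_dyadic_step_powr[OF v p])+
    also have "\<dots> = 2 powr p * (\<bar>a\<bar> powr p * (LINT x|lborel. \<bar>u k x\<bar> powr p) + \<bar>b\<bar> powr p * (LINT x|lborel. \<bar>v k x\<bar> powr p))"
      using Iu Iv by simp
    also have "\<dots> \<le> 2 powr p * (\<bar>a\<bar> powr p * (2 powr (- (real k * s * p)) * B k) + \<bar>b\<bar> powr p * (2 powr (- (real k * s * p)) * D k))"
      by (intro mult_left_mono add_mono ule vle) auto
    finally show ?thesis by (simp add: E_def algebra_simps)
  qed
  have Esm: "summable (\<lambda>k. E k powr (q / p))"
  proof -
    define c where "c = (2 powr p) powr (q / p) * 2 powr (q / p)"
    have le: "E k powr (q / p) \<le> c * ((\<bar>a\<bar> powr p) powr (q / p) * B k powr (q / p) + (\<bar>b\<bar> powr p) powr (q / p) * D k powr (q / p))" for k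
    proof -
      have "E k powr (q / p) = (2 powr p) powr (q / p) * (\<bar>a\<bar> powr p * B k + \<bar>b\<bar> powr p * D k) powr (q / p)"
        unfolding E_def by (rule powr_mult)
      also have "\<dots> \<le> (2 powr p) powr (q / p) * (2 powr (q / p) * ((\<bar>a\<bar> powr p * B k) powr (q / p) + (\<bar>b\<bar> powr p * D k) powr (q / p)))"
        using abs_add_powr_le[of "q / p" "\<bar>a\<bar> powr p * B k" "\<bar>b\<bar> powr p * D k"] B[of k] D[of k] p q
        by (intro mult_left_mono) simp_all
      finally show ?thesis by (simp add: c_def powr_mult mult.assoc)
    qed
    have "summable (\<lambda>k. c * ((\<bar>a\<bar> powr p) powr (q / p) * B k powr (q / p) + (\<bar>b\<bar> powr p) powr (q / p) * D k powr (q / p)))"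
      by (intro summable_mult summable_add Bsm Dsm)
    then show ?thesis
      by (rule summable_comparison_test'[where N=0]) (use le in auto)
  qed
  have ser: "step_series s p q w E" using w E wle Esm by (simp add: step_series_def)
  define G where "G = (\<lambda>x. \<Sum>k. w k x)"
  have G: "borel_rep G G" "G \<in> besov_space s p q"
    using besov_synthesis[OF p q s sp sig] ser unfolding G_def by blast+
  have "AE x in lborel. a * f' x + b * g' x = G x"
    using usums vsums
  proof eventually_elim
    fix x assume "(\<lambda>k. u k x) sums f' x" "(\<lambda>k. v k x) sums g' x"
    then have "(\<lambda>k. w k x) sums (a * f' x + b * g' x)"
      unfolding w_def by (intro sums_add sums_mult)
    then show "a * f' x + b * g' x = G x" by (simp add: G_def sums_iff)
  qed
  then have "AE x in lebesgue_on unit_cube. a * f x + b * g x = G x"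
    by (simp add: borel_rep_AE_iff[OF borel_rep_lincomb[OF rf rg] G(1)])
  then have "borel_rep (\<lambda>x. a * f x + b * g x) G" by (rule borel_rep_cong[OF G(1)])
  then show ?thesis using besov_cong_rep(1)[OF _ G(1) p] G(2) by blast
qed

lemma haar_map_lincomb:
  fixes f g :: "real^'d \<Rightarrow> real" and s p q a b :: real
  assumes p: "0 < p" and q: "0 < q" and s: "0 < s"
    and sig: "CARD('d) * max (1 - p) 0 < s * p"
    and f: "f \<in> besov_space s p q" and g: "g \<in> besov_space s p q"
  shows "haar_map (\<lambda>x. a * f x + b * g x) = (\<lambda>h. a * haar_map f h + b * haar_map g h)"
proof -
  obtain f' g' where rf: "borel_rep f f'" and rg: "borel_rep g g'"
    using besov_ex_borel_rep[OF f] besov_ex_borel_rep[OF g] by blast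
  have "haar_coeff h (\<lambda>x. a * f x + b * g x) = a * haar_coeff h f + b * haar_coeff h g" if "h \<in> haar_level k" for h k
  proof -
    have "(LINT x|lborel. (a * f' x + b * g' x) * h x) = (LINT x|lborel. a * (f' x * h x) + b * (g' x * h x))"
      by (simp add: algebra_simps)
    also have "\<dots> = a * (LINT x|lborel. f' x * h x) + b * (LINT x|lborel. g' x * h x)"
      using besov_integrable_haar(2)[OF p q s sig f rf that] besov_integrable_haar(2)[OF p q s sig g rg that] by simp
    finally show ?thesis
      unfolding haar_coeff_rep[OF rf that] haar_coeff_rep[OF rg that] haar_coeff_rep[OF borel_rep_lincomb[OF rf rg] that]
      by (simp add: algebra_simps)
  qed
  then show ?thesis by (auto simp: haar_map_def haar_system_def fun_eq_iff)
qed

text \<open>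
If the coefficients agree, then those of the difference vanish, and the difference lies in the Besov space by linearity.
\<close>

lemma haar_map_eq_iff:
  fixes f g :: "real^'d \<Rightarrow> real" and s p q :: real
  assumes p: "0 < p" and q: "0 < q" and s: "0 < s" and sp: "s * p < 1"
    and sig: "CARD('d) * max (1 - p) 0 < s * p"
    and f: "f \<in> besov_space s p q" and g: "g \<in> besov_space s p q"
  shows "haar_map f = haar_map g \<longleftrightarrow> (AE x in lebesgue_on unit_cube. f x = g x)"
proof -
  obtain f' g' where rf: "borel_rep f f'" and rg: "borel_rep g g'"
    using besov_ex_borel_rep[OF f] besov_ex_borel_rep[OF g] by blast
  show ?thesis
  proof
    assume eq: "haar_map f = haar_map g"
    have d: "(\<lambda>x. 1 * f x + (- 1) * g x) \<in> besov_space s p q"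
      by (rule besov_lincomb[OF p q s sp sig f g])
    have hd: "haar_map (\<lambda>x. 1 * f x + (- 1) * g x) = (\<lambda>h. 0)"
      unfolding haar_map_lincomb[OF p q s sig f g] eq by simp
    have "haar_coeff h (\<lambda>x. 1 * f x + (- 1) * g x) = 0" if "h \<in> haar_system" for h
      using fun_cong[OF hd, of h] that by (simp add: haar_map_def)
    then have "AE x in lborel. 1 * f' x + (- 1) * g' x = 0"
      by (rule besov_integrable_haar(3)[OF p q s sig d borel_rep_lincomb[OF rf rg]])
    then have "AE x in lborel. f' x = g' x" by eventually_elim simp
    then show "AE x in lebesgue_on unit_cube. f x = g x"
      by (simp add: borel_rep_AE_iff[OF rf rg])
  next
    assume "AE x in lebesgue_on unit_cube. f x = g x"
    then have rf': "borel_rep f g'" by (rule borel_rep_cong[OF rg])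
    have "haar_coeff h f = haar_coeff h g" if "h \<in> haar_level k" for h k
      by (simp add: haar_coeff_rep[OF rf' that] haar_coeff_rep[OF rg that])
    then show "haar_map f = haar_map g"
      by (auto simp: haar_map_def haar_system_def fun_eq_iff)
  qed
qed

lemma besov_norm_nonneg: "0 \<le> besov_norm s p q f"
  by (simp add: besov_norm_def)

lemma lqlp_norm_powr:
  assumes "0 < q" "\<gamma> \<in> lqlp_space s p q"
  shows "lqlp_norm s p q \<gamma> powr q = (\<Sum>k. level_sum s p \<gamma> k powr (q / p))"
proof -
  have "0 \<le> (\<Sum>k. level_sum s p \<gamma> k powr (q / p))"
    using assms by (intro suminf_nonneg) (auto simp: lqlp_space_def)
  then show ?thesis using assms by (simp add: lqlp_norm_def powr_powr)
qed

lemma powr_le_imp_le_root: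
  fixes a b C q :: real
  assumes "0 < q" "0 \<le> a" "0 \<le> b" "0 < C" "a powr q \<le> C * b powr q"
  shows "a \<le> C powr (1 / q) * b"
proof -
  have "(a powr q) powr (1 / q) \<le> (C * b powr q) powr (1 / q)"
    using assms by (intro powr_mono2) auto
  then show ?thesis using assms by (simp add: powr_powr powr_mult)
qed

text \<open>
The lower norm estimate for g comes from the function synthesised from the coefficients of g, which by injectivity equals g
almost everywhere.
\<close>

lemma haar_map_image_and_norm:
  fixes s p q :: real
  assumes p: "0 < p" and q: "0 < q" and s: "0 < s" and sp: "s * p < 1"
    and sig: "CARD('d) * max (1 - p) 0 < s * p"
  shows "haar_map ` besov_space s p q = (lqlp_space s p q :: ((real^'d \<Rightarrow> real) \<Rightarrow> real) set)"
    and "\<exists>c>0. \<exists>C>0. \<forall>g\<in>(besov_space s p q :: (real^'d \<Rightarrow> real) set).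
        c * besov_norm s p q g \<le> lqlp_norm s p q (haar_map g) \<and>
        lqlp_norm s p q (haar_map g) \<le> C * besov_norm s p q g"
proof -
  obtain C1 where C1: "0 < C1" and syn: "\<forall>\<gamma>\<in>lqlp_space s p q. \<exists>G :: real^'d \<Rightarrow> real. G \<in> besov_space s p q \<and> haar_map G = \<gamma> \<and>
    besov_norm s p q G powr q \<le> C1 * (\<Sum>k. level_sum s p \<gamma> k powr (q / p))"
    using besov_of_sequence[OF p q s sp sig] by blast
  obtain C2 where C2: "0 < C2" and ana: "\<forall>f :: real^'d \<Rightarrow> real. f \<in> besov_space s p q \<longrightarrow>
    haar_map f \<in> lqlp_space s p q \<and>
    (\<Sum>k. level_sum s p (haar_map f) k powr (q / p)) \<le> C2 * besov_norm s p q f powr q"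
    using sequence_of_besov[OF p q s sig] by blast
  show "haar_map ` besov_space s p q = (lqlp_space s p q :: ((real^'d \<Rightarrow> real) \<Rightarrow> real) set)"
  proof (intro equalityI subsetI)
    fix \<gamma> :: "(real^'d \<Rightarrow> real) \<Rightarrow> real" assume "\<gamma> \<in> haar_map ` besov_space s p q"
    then show "\<gamma> \<in> lqlp_space s p q" using ana by blast
  next
    fix \<gamma> :: "(real^'d \<Rightarrow> real) \<Rightarrow> real" assume "\<gamma> \<in> lqlp_space s p q"
    then obtain G :: "real^'d \<Rightarrow> real" where "G \<in> besov_space s p q" "haar_map G = \<gamma>" using syn by blast
    then show "\<gamma> \<in> haar_map ` besov_space s p q" by blast
  qed
  have pos: "0 < 1 / C1 powr (1 / q)" "0 < C2 powr (1 / q)" using C1 C2 by auto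
  show "\<exists>c>0. \<exists>C>0. \<forall>g\<in>(besov_space s p q :: (real^'d \<Rightarrow> real) set).
        c * besov_norm s p q g \<le> lqlp_norm s p q (haar_map g) \<and>
        lqlp_norm s p q (haar_map g) \<le> C * besov_norm s p q g"
  proof (rule exI[of _ "1 / C1 powr (1 / q)"], rule conjI, rule pos,
      rule exI[of _ "C2 powr (1 / q)"], rule conjI, rule pos, intro conjI ballI)
    fix g :: "real^'d \<Rightarrow> real" assume g: "g \<in> besov_space s p q"
    have hg: "haar_map g \<in> lqlp_space s p q" using ana g by blast
    have nn: "0 \<le> lqlp_norm s p q (haar_map g)" by (simp add: lqlp_norm_def)
    obtain G :: "real^'d \<Rightarrow> real" where G: "G \<in> besov_space s p q" "haar_map G = haar_map g"
      and nG: "besov_norm s p q G powr q \<le> C1 * (\<Sum>k. level_sum s p (haar_map g) k powr (q / p))"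
      using syn hg by blast
    have ae: "AE x in lebesgue_on unit_cube. G x = g x"
      using haar_map_eq_iff[OF p q s sp sig G(1) g] G(2) by simp
    obtain g' where rg: "borel_rep g g'" using besov_ex_borel_rep[OF g] by blast
    have "besov_norm s p q G = besov_norm s p q g"
      by (rule besov_cong_rep(2)[OF borel_rep_cong[OF rg ae] rg p])
    then have "besov_norm s p q g \<le> C1 powr (1 / q) * lqlp_norm s p q (haar_map g)"
      using nG by (intro powr_le_imp_le_root q besov_norm_nonneg nn C1) (simp add: lqlp_norm_powr[OF q hg])
    then show "1 / C1 powr (1 / q) * besov_norm s p q g \<le> lqlp_norm s p q (haar_map g)"
      using C1 by (simp add: field_simps)
    show "lqlp_norm s p q (haar_map g) \<le> C2 powr (1 / q) * besov_norm s p q g"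
      using ana[rule_format, OF g] by (intro powr_le_imp_le_root q besov_norm_nonneg nn C2) (simp add: lqlp_norm_powr[OF q hg])
  qed
qed

section \<open>The Haar system as a basis\<close>

text \<open>
Each level is finite and nonempty, and the levels are disjoint.
\<close>

lemma haar_system_bij_nat: "\<exists>e :: nat \<Rightarrow> _. bij_betw e UNIV (haar_system :: (real^'d \<Rightarrow> real) set)"
proof -
  have c: "countable (haar_system :: (real^'d \<Rightarrow> real) set)"
    unfolding haar_system_def by (rule countable_UN[OF _ countable_finite[OF finite_haar_level]]) simp
  have ne: "haar_level k \<noteq> ({} :: (real^'d \<Rightarrow> real) set)" for k
  proof (cases k)
    case (Suc j)
    have "(\<lambda>_. 0) \<in> (cells j :: ('d \<Rightarrow> int) set)" by (simp add: cells_def)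
    then have "cube_haar j (\<lambda>_. 0) (UNIV :: 'd set) \<in> haar_level k"
      unfolding Suc haar_level_Suc_eq by blast
    then show ?thesis by blast
  qed simp
  define pick where "pick k = (SOME h. h \<in> (haar_level k :: (real^'d \<Rightarrow> real) set))" for k
  have pick: "pick k \<in> haar_level k" for k
    unfolding pick_def using ne[of k] by (simp add: some_in_eq)
  have "inj pick"
    using haar_level_unique pick by (metis injI)
  moreover have "range pick \<subseteq> haar_system" using pick by (auto simp: haar_system_def)
  ultimately have "infinite (haar_system :: (real^'d \<Rightarrow> real) set)"
    using infinite_iff_countable_subset by blast
  then have "bij_betw (from_nat_into haar_system) UNIV (haar_system :: (real^'d \<Rightarrow> real) set)"
    using bij_betw_from_nat_into[OF c] by simp
  then show ?thesis by blast
qed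

lemma haar_map_haar:
  fixes h :: "real^'d \<Rightarrow> real"
  assumes h: "h \<in> haar_level k"
  shows "haar_map h = (\<lambda>h'. if h' = h then 1 else 0)"
proof -
  note rh = borel_rep_haar[OF h]
  have "haar_coeff h' h = (if h' = h then 1 else 0)" if h': "h' \<in> haar_level j" for h' j
    using integral_haar_orthogonal[OF h h'] integral_ucube_part_haar_self[OF h']
    unfolding haar_coeff_rep[OF rh h'] by (auto simp: power_one_over)
  then have "haar_coeff h' h = (if h' = h then 1 else 0)" if "h' \<in> haar_system" for h'
    using that by (auto simp: haar_system_def)
  moreover have "h \<in> haar_system" using h by (auto simp: haar_system_def)
  ultimately show ?thesis by (intro ext) (simp add: haar_map_def)
qed

lemma haar_in_besov:
  fixes h :: "real^'d \<Rightarrow> real" and s p q :: real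
  assumes p: "0 < p" and q: "0 < q" and s: "0 < s" and sp: "s * p < 1"
    and sig: "CARD('d) * max (1 - p) 0 < s * p"
    and h: "h \<in> haar_level k"
  shows "h \<in> besov_space s p q"
proof -
  note rh = borel_rep_haar[OF h]
  have b: "ucube_part h \<in> borel_measurable borel" using rh by (simp add: borel_rep_def)
  define u where "u j = (if j = k then ucube_part h else (\<lambda>x. 0))" for j
  define B where "B j = (if j = k then 2 powr (real k * s * p) * (LINT x|lborel. \<bar>ucube_part h x\<bar> powr p) else 0)" for j
  have I0: "0 \<le> (LINT x|lborel. \<bar>ucube_part h x\<bar> powr p)" by (intro integral_nonneg_AE AE_I2) simp
  have "2 powr (- (real k * s * p)) * 2 powr (real k * s * p) = (1::real)"
    by (subst powr_add[symmetric]) simp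
  then have le: "(LINT x|lborel. \<bar>u j x\<bar> powr p) \<le> 2 powr (- (real j * s * p)) * B j" for j
    using p by (auto simp: u_def B_def mult.assoc[symmetric])
  have "summable (\<lambda>j. B j powr (q / p))"
    using p q by (intro summable_finite[of "{k}"]) (auto simp: B_def)
  then have "step_series s p q u B"
    using dyadic_step_ucube_part_haar[OF h] I0 le by (auto simp: step_series_def u_def B_def)
  then have G: "(\<lambda>x. \<Sum>j. u j x) \<in> besov_space s p q"
    using besov_synthesis[OF p q s sp sig] by blast
  have "(\<lambda>x. \<Sum>j. u j x) = ucube_part h"
  proof
    fix x
    have "u j x = (if j = k then ucube_part h x else 0)" for j by (simp add: u_def)
    then show "(\<Sum>j. u j x) = ucube_part h x"
      using sums_single[of k "\<lambda>j. ucube_part h x"] by (simp add: sums_iff)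
  qed
  then have "ucube_part h \<in> besov_space s p q" using G by simp
  then show ?thesis using besov_cong_rep(1)[OF rh borel_rep_self[OF b] p] by (simp add: ucube_part_def)
qed

text \<open>
Subtracting a partial sum changes the coefficients of the basis elements that occur in it and no others.
\<close>

lemma besov_haar_partial_sum:
  fixes g :: "real^'d \<Rightarrow> real" and s p q :: real and c :: "nat \<Rightarrow> real"
  assumes p: "0 < p" and q: "0 < q" and s: "0 < s" and sp: "s * p < 1"
    and sig: "CARD('d) * max (1 - p) 0 < s * p"
    and e: "bij_betw e UNIV (haar_system :: (real^'d \<Rightarrow> real) set)" and g: "g \<in> besov_space s p q"
  shows "(\<lambda>x. g x - (\<Sum>m<n. c m * e m x)) \<in> besov_space s p q \<and>
    haar_map (\<lambda>x. g x - (\<Sum>m<n. c m * e m x)) = (\<lambda>h. haar_map g h - (\<Sum>m<n. c m * (if h = e m then 1 else 0)))"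
proof (induction n)
  case 0
  then show ?case using g by simp
next
  case (Suc n)
  define S where "S x = g x - (\<Sum>m<n. c m * e m x)" for x
  have S: "S \<in> besov_space s p q" and hS: "haar_map S = (\<lambda>h. haar_map g h - (\<Sum>m<n. c m * (if h = e m then 1 else 0)))"
    using Suc by (simp_all add: S_def[abs_def])
  have "e n \<in> haar_system" using e by (auto simp: bij_betw_def)
  then obtain k where k: "e n \<in> haar_level k" by (auto simp: haar_system_def)
  have en: "e n \<in> besov_space s p q" by (rule haar_in_besov[OF p q s sp sig k])
  have eq: "(\<lambda>x. g x - (\<Sum>m<Suc n. c m * e m x)) = (\<lambda>x. 1 * S x + (- c n) * e n x)"
    by (simp add: S_def fun_eq_iff)
  have "haar_map (\<lambda>x. 1 * S x + (- c n) * e n x) = (\<lambda>h. haar_map g h - (\<Sum>m<Suc n. c m * (if h = e m then 1 else 0)))"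
    unfolding haar_map_lincomb[OF p q s sig S en] hS haar_map_haar[OF k] by (auto simp: fun_eq_iff)
  then show ?case
    unfolding eq using besov_lincomb[OF p q s sp sig S en, of 1 "- c n"] by blast
qed

lemma level_term_le_lqlp_norm:
  assumes p: "0 < p" and q: "0 < q" and \<gamma>: "\<gamma> \<in> lqlp_space s p q" and h: "h \<in> haar_level k"
  shows "(2 powr (real k * (s * p - real CARD('d))) * \<bar>\<gamma> (h :: real^'d \<Rightarrow> real)\<bar> powr p) powr (q / p)
    \<le> lqlp_norm s p q \<gamma> powr q"
proof -
  have "2 powr (real k * (s * p - real CARD('d))) * \<bar>\<gamma> h\<bar> powr p \<le> level_sum s p \<gamma> k"
    unfolding level_sum_def by (rule member_le_sum[OF h]) (auto simp: finite_haar_level)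
  then have "(2 powr (real k * (s * p - real CARD('d))) * \<bar>\<gamma> h\<bar> powr p) powr (q / p) \<le> level_sum s p \<gamma> k powr (q / p)"
    using p q by (intro powr_mono2) auto
  also have "\<dots> \<le> (\<Sum>k. level_sum s p \<gamma> k powr (q / p))"
    using \<gamma> sum_le_suminf[of "\<lambda>k. level_sum s p \<gamma> k powr (q / p)" "{k}"] by (simp add: lqlp_space_def)
  finally show ?thesis by (simp add: lqlp_norm_powr[OF q \<gamma>])
qed

text \<open>
Each level is finite, so it is exhausted by finitely many elements of the enumeration, and dominated convergence for series
applies.
\<close>

lemma lqlp_norm_tail_tendsto_0:
  fixes e :: "nat \<Rightarrow> real^'d \<Rightarrow> real"
  assumes p: "0 < p" and q: "0 < q" and \<gamma>: "\<gamma> \<in> lqlp_space s p q"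
    and e: "bij_betw e UNIV (haar_system :: (real^'d \<Rightarrow> real) set)"
  shows "(\<lambda>n. lqlp_norm s p q (\<lambda>h. if h \<in> e ` {..<n} then 0 else \<gamma> h)) \<longlonglongrightarrow> 0"
proof -
  define t where "t n h = (if h \<in> e ` {..<n} then 0 else \<gamma> h)" for n h
  define a where "a k = level_sum s p \<gamma> k powr (q / p)" for k
  define b where "b n k = level_sum s p (t n) k powr (q / p)" for n k
  have a: "summable a" using \<gamma> by (simp add: lqlp_space_def a_def[abs_def])
  have ba: "b n k \<le> a k" for n k
  proof -
    have "level_sum s p (t n) k \<le> level_sum s p \<gamma> k"
      unfolding level_sum_def using p by (intro sum_mono mult_left_mono) (auto simp: t_def)
    then show ?thesis unfolding a_def b_def using p q level_sum_nonneg by (intro powr_mono2) auto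
  qed
  have b0: "0 \<le> b n k" for n k by (simp add: b_def)
  have bz: "\<forall>\<^sub>F n in sequentially. b n k = 0" for k
  proof -
    have "haar_level k \<subseteq> range e" using e by (auto simp: bij_betw_def haar_system_def)
    from finite_subset_image[OF finite_haar_level this]
    obtain F where F: "finite F" "haar_level k = e ` F" by blast
    obtain N where N: "F \<subseteq> {..<N}" using F(1) finite_nat_set_iff_bounded by (auto simp: subset_eq)
    have "b n k = 0" if "N \<le> n" for n
    proof -
      have "t n h = 0" if "h \<in> haar_level k" for h
      proof -
        have "h \<in> e ` {..<n}" using that F(2) N \<open>N \<le> n\<close> by force
        then show ?thesis by (simp add: t_def)
      qed
      then show ?thesis using p by (simp add: b_def level_sum_def)
    qed
    then show ?thesis by (auto simp: eventually_sequentially)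
  qed
  have "(\<lambda>n. \<Sum>k. b n k) \<longlonglongrightarrow> (\<Sum>k. 0)"
  proof (rule tannerys_theorem[THEN conjunct2, THEN conjunct2])
    show "(\<lambda>n. b n k) \<longlonglongrightarrow> 0" for k
      by (rule tendsto_eventually[OF bz])
    show "\<forall>\<^sub>F (k, n) in sequentially \<times>\<^sub>F sequentially. norm (b n k) \<le> a k"
      using ba b0 by (intro always_eventually) auto
  qed (use a in auto)
  then have "(\<lambda>n. suminf (b n) powr (1 / q)) \<longlonglongrightarrow> 0 powr (1 / q)"
  proof (intro tendsto_powr')
    have "0 \<le> suminf (b n)" for n
    proof -
      have "summable (b n)" by (rule summable_comparison_test'[OF a, of 0]) (use ba b0 in auto)
      then show ?thesis by (intro suminf_nonneg b0)
    qed
    then show "0 \<noteq> (0::real) \<or> 0 < 1 / q \<and> (\<forall>\<^sub>F n in sequentially. 0 \<le> suminf (b n))"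
      using q by simp
  qed (simp_all add: tendsto_const)
  then show ?thesis by (simp add: lqlp_norm_def b_def[abs_def] t_def[abs_def])
qed

text \<open>
Norm convergence of the partial sums is convergence of the Haar coefficients in the sequence space. Existence of the expansion is the
convergence of truncated sequences; uniqueness holds because each single coefficient is continuous there.
\<close>

lemma haar_schauder_basis:
  fixes s p q :: real
  assumes p: "0 < p" and q: "0 < q" and s: "0 < s" and sp: "s * p < 1"
    and sig: "CARD('d) * max (1 - p) 0 < s * p"
    and e: "bij_betw e UNIV (haar_system :: (real^'d \<Rightarrow> real) set)"
  shows "schauder_basis (besov_space s p q) (besov_norm s p q) e"
  unfolding schauder_basis_def
proof (intro conjI ballI)
  note PS = besov_haar_partial_sum[OF p q s sp sig e]
  have inj: "e m = e n \<longleftrightarrow> m = n" for m n using e by (auto simp: bij_betw_def inj_on_def)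
  have esys: "e m \<in> haar_system" for m using e by (auto simp: bij_betw_def)
  obtain C1 C2 where C1: "0 < C1" and C2: "0 < C2" and
    eqv: "\<And>g :: real^'d \<Rightarrow> real. g \<in> besov_space s p q \<Longrightarrow>
        C1 * besov_norm s p q g \<le> lqlp_norm s p q (haar_map g) \<and>
        lqlp_norm s p q (haar_map g) \<le> C2 * besov_norm s p q g"
    using haar_map_image_and_norm(2)[OF p q s sp sig] by blast
  have img: "haar_map g \<in> lqlp_space s p q" if "g \<in> besov_space s p q" for g :: "real^'d \<Rightarrow> real"
    using haar_map_image_and_norm(1)[OF p q s sp sig] that by blast
  show "range e \<subseteq> besov_space s p q"
  proof safe
    fix m
    obtain k where "e m \<in> haar_level k" using esys[of m] by (auto simp: haar_system_def)
    then show "e m \<in> besov_space s p q" by (rule haar_in_besov[OF p q s sp sig])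
  qed
  fix g :: "real^'d \<Rightarrow> real" assume g: "g \<in> besov_space s p q"
  show "\<exists>!c. (\<lambda>n. besov_norm s p q (\<lambda>x. g x - (\<Sum>m<n. c m * e m x))) \<longlonglongrightarrow> 0"
  proof (rule ex1I)
    define c where "c m = haar_map g (e m)" for m
    have hm: "haar_map (\<lambda>x. g x - (\<Sum>m<n. c m * e m x)) = (\<lambda>h. if h \<in> e ` {..<n} then 0 else haar_map g h)" for n
    proof (rule ext)
      fix h
      have "(\<Sum>m<n. c m * (if h = e m then 1 else 0)) = (if h \<in> e ` {..<n} then haar_map g h else 0)"
      proof (cases "h \<in> e ` {..<n}")
        case True
        then obtain m0 where m0: "h = e m0" "m0 < n" by auto
        then have "(\<Sum>m<n. c m * (if h = e m then 1 else 0)) = (\<Sum>m<n. if m = m0 then c m0 else 0)"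
          by (intro sum.cong) (auto simp: inj)
        then show ?thesis using m0 True by (simp add: c_def)
      next
        case False
        then have "h \<noteq> e m" if "m < n" for m using that by auto
        then show ?thesis using False by simp
      qed
      then show "haar_map (\<lambda>x. g x - (\<Sum>m<n. c m * e m x)) h = (if h \<in> e ` {..<n} then 0 else haar_map g h)"
        using PS[OF g, of c n] by auto
    qed
    have lim: "(\<lambda>n. lqlp_norm s p q (haar_map (\<lambda>x. g x - (\<Sum>m<n. c m * e m x))) / C1) \<longlonglongrightarrow> 0 / C1"
      unfolding hm using C1 by (intro tendsto_divide tendsto_const lqlp_norm_tail_tendsto_0[OF p q img[OF g] e]) simp
    show "(\<lambda>n. besov_norm s p q (\<lambda>x. g x - (\<Sum>m<n. haar_map g (e m) * e m x))) \<longlonglongrightarrow> 0"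
      unfolding c_def[symmetric]
    proof (rule real_tendsto_sandwich[of "\<lambda>_. 0"])
      show "\<forall>\<^sub>F n in sequentially. 0 \<le> besov_norm s p q (\<lambda>x. g x - (\<Sum>m<n. c m * e m x))"
        by (simp add: besov_norm_nonneg)
      show "\<forall>\<^sub>F n in sequentially. besov_norm s p q (\<lambda>x. g x - (\<Sum>m<n. c m * e m x))
          \<le> lqlp_norm s p q (haar_map (\<lambda>x. g x - (\<Sum>m<n. c m * e m x))) / C1"
      proof (rule always_eventually, rule allI)
        fix n
        show "besov_norm s p q (\<lambda>x. g x - (\<Sum>m<n. c m * e m x))
          \<le> lqlp_norm s p q (haar_map (\<lambda>x. g x - (\<Sum>m<n. c m * e m x))) / C1"
          using eqv[OF conjunct1[OF PS[OF g, of c n]]] C1 by (simp add: pos_le_divide_eq mult.commute)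
      qed
    qed (use lim in simp_all)
  next
    fix c assume lim: "(\<lambda>n. besov_norm s p q (\<lambda>x. g x - (\<Sum>m<n. c m * e m x))) \<longlonglongrightarrow> 0"
    show "c = (\<lambda>m. haar_map g (e m))"
    proof (rule ext)
      fix m0
      obtain k where k: "e m0 \<in> haar_level k" using esys[of m0] by (auto simp: haar_system_def)
      define \<delta> where "\<delta> = (2 powr (real k * (s * p - real CARD('d))) * \<bar>haar_map g (e m0) - c m0\<bar> powr p) powr (q / p)"
      define N where "N n = besov_norm s p q (\<lambda>x. g x - (\<Sum>m<n. c m * e m x))" for n
      have le: "\<delta> \<le> (C2 * N n) powr q" if n: "m0 < n" for n
      proof -
        let ?r = "\<lambda>x. g x - (\<Sum>m<n. c m * e m x)"
        have r: "?r \<in> besov_space s p q" using PS[OF g, of c n] by blast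
        have "haar_map ?r (e m0) = haar_map g (e m0) - (\<Sum>m<n. c m * (if e m0 = e m then 1 else 0))"
          using PS[OF g, of c n] by simp
        also have "(\<Sum>m<n. c m * (if e m0 = e m then 1 else 0)) = (\<Sum>m<n. if m = m0 then c m0 else 0)"
          by (intro sum.cong) (auto simp: inj)
        also have "\<dots> = c m0" using n by simp
        finally have "\<delta> \<le> lqlp_norm s p q (haar_map ?r) powr q"
          using level_term_le_lqlp_norm[OF p q img[OF r] k] by (simp add: \<delta>_def)
        also have "\<dots> \<le> (C2 * N n) powr q"
          using eqv[OF r] q by (intro powr_mono2) (auto simp: N_def lqlp_norm_def)
        finally show ?thesis .
      qed
      have "(\<lambda>n. (C2 * N n) powr q) \<longlonglongrightarrow> (C2 * 0) powr q"
        using lim q C2 by (intro tendsto_powr' tendsto_mult tendsto_const) (auto simp: N_def besov_norm_nonneg)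
      then have "(\<lambda>n. (C2 * N n) powr q) \<longlonglongrightarrow> 0" by simp
      moreover have "\<forall>\<^sub>F n in sequentially. \<delta> \<le> (C2 * N n) powr q"
        using eventually_gt_at_top[of m0] by eventually_elim (rule le)
      ultimately have "\<delta> \<le> 0" by (rule tendsto_lowerbound) simp
      then have "\<delta> = 0" by (simp add: \<delta>_def antisym)
      then show "c m0 = haar_map g (e m0)" by (simp add: \<delta>_def)
    qed
  qed
qed

theorem theorem3:
  fixes s p q :: real
  assumes "max (real CARD('d::finite) * (1 / p - 1)) 0 < s" and "s < 1 / p"
    and "0 < q"
    and "(real CARD('d) - 1) / real CARD('d) < p"
  shows
    "(besov_space s p q :: (real^'d \<Rightarrow> real) set) \<subseteq> Lp_space 1 unit_cube \<and>
     (\<forall>f\<in>besov_space s p q. \<forall>g\<in>besov_space s p q. \<forall>a b.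
        (\<lambda>x. a * f x + b * g x) \<in> (besov_space s p q :: (real^'d \<Rightarrow> real) set) \<and>
        haar_map (\<lambda>x. a * f x + b * g x) = (\<lambda>h. a * haar_map f h + b * haar_map g h)) \<and>
     (\<forall>f\<in>besov_space s p q. \<forall>g\<in>besov_space s p q.
        haar_map f = haar_map g \<longleftrightarrow> (AE x in lebesgue_on (unit_cube :: (real^'d) set). f x = g x)) \<and>
     haar_map ` besov_space s p q = (lqlp_space s p q :: ((real^'d \<Rightarrow> real) \<Rightarrow> real) set) \<and>
     (\<exists>c>0. \<exists>C>0. \<forall>g\<in>(besov_space s p q :: (real^'d \<Rightarrow> real) set).
        c * besov_norm s p q g \<le> lqlp_norm s p q (haar_map g) \<and>
        lqlp_norm s p q (haar_map g) \<le> C * besov_norm s p q g) \<and>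
     (\<exists>e :: nat \<Rightarrow> _. bij_betw e UNIV (haar_system :: (real^'d \<Rightarrow> real) set)) \<and>
     (\<forall>e :: nat \<Rightarrow> _. bij_betw e UNIV (haar_system :: (real^'d \<Rightarrow> real) set) \<longrightarrow>
        unconditional_schauder_basis (besov_space s p q) (besov_norm s p q) e)"
proof -
  have d: "1 \<le> real CARD('d)" by (simp add: Suc_leI)
  have "0 \<le> (real CARD('d) - 1) / real CARD('d)" using d by simp
  then have p: "0 < p" using assms(4) by linarith
  note q = assms(3)
  have s: "0 < s" using assms(1) by simp
  have sp: "s * p < 1" using assms(2) p by (simp add: field_simps)
  \<comment> \<open>For \<open>p < 1\<close> this is the lower bound on s, multiplied by p.\<close>
  have sig: "CARD('d) * max (1 - p) 0 < s * p"
  proof (cases "p < 1")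
    case True
    have "CARD('d) * (1 - p) = (real CARD('d) * (1 / p - 1)) * p" using p by (simp add: field_simps)
    also have "\<dots> < s * p" using assms(1) p by (intro mult_strict_right_mono) auto
    finally show ?thesis using True by (simp add: max_def)
  qed (use s p in \<open>simp add: max_def\<close>)
  have "f \<in> Lp_space 1 unit_cube" if f: "f \<in> besov_space s p q" for f :: "real^'d \<Rightarrow> real"
  proof -
    obtain f' where r: "borel_rep f f'" using besov_ex_borel_rep[OF f] by blast
    have "integrable lborel f'" by (rule besov_integrable_haar(1)[OF p q s sig f r])
    then have "Lp_power 1 f' < \<infinity>" by (simp add: integrable_iff_bounded Lp_power_def)
    then show ?thesis using borel_rep_Lp_space(1)[OF r, of 1] by simp
  qed
  moreover have "unconditional_schauder_basis (besov_space s p q) (besov_norm s p q) e"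
    if e: "bij_betw e UNIV (haar_system :: (real^'d \<Rightarrow> real) set)" for e
    unfolding unconditional_schauder_basis_def
    by (intro allI impI haar_schauder_basis[OF p q s sp sig] bij_betw_trans[OF _ e])
  ultimately show ?thesis
    using besov_lincomb[OF p q s sp sig] haar_map_lincomb[OF p q s sig] haar_map_eq_iff[OF p q s sp sig]
      haar_map_image_and_norm[OF p q s sp sig] haar_system_bij_nat
    by (intro conjI subsetI ballI allI impI) blast+
qed

end
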